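(* Let $\Delta\in\mathcal G_\tau((\mathbb R^p\times\mathbb R^q)^{(n)})$ and consider the PDE $\Delta(x,U^{(n)})=0$ in $(\mathcal G_\tau(\mathbb R^p))^q$. Let $\Phi$ be a $\mathcal G$-$n$-complete projectable generalized group action on $\mathbb R^p\times\mathbb R^q$ with infinitesimal generator $X$, and write $\mathrm{pr}^{(n)}X=\sum_{j=1}^N\zeta_j(z)\partial_{z_j}$, where $N=\dim(\mathbb R^p\times\mathbb R^q)^{(n)}$. Suppose that for some $1\le i\le N$ and some $f\in\mathcal G_\tau(\mathbb R^{N-1})$ $$\Delta(z_1,\dots,z_N)=z_i-f(z'),\qquad z'=(z_1,\dots,z_{i-1},z_{i+1},\dots,z_N),$$ and that $z'\mapsto(\zeta_j(z',f(z')))_{j\neq i}$ (where $(z',f(z'))$ denotes the point with $i$-th coordinate $f(z')$ and remaining coordinates $z'$) defines a generalized vector field on $\mathbb R^{N-1}$ such that the corresponding system of ODEs possesses a flow in $(\widetilde{\mathcal G}_\tau(\mathbb R^{1+(N-1)}))^{N-1}$. If $$\mathrm{pr}^{(n)}X(\Delta)(\widetilde z)=0\quad\forall\widetilde z\in(\mathcal R^p\times\mathcal R^q)^{(n)}\text{ with }\Delta(\widetilde z)=0,$$ then $\Phi$ is a symmetry group of the PDE $\Delta(x,U^{(n)})=0$.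
   Context: Let $I=(0,1]$. $\mathcal G(\mathbb R)=\mathcal E_M/\mathcal N$, where $\mathcal E_M$ (resp. $\mathcal N$) consists of $(u_\varepsilon)_{\varepsilon\in I}\in C^\infty(\mathbb R)^I$ such that on each compact set each derivative is $O(\varepsilon^{-r})$ for some $r$ (resp. $O(\varepsilon^s)$ for all $s$) uniformly, as $\varepsilon\to0$. $\mathcal G_\tau(\mathbb R^m)=\mathcal E_\tau(\mathbb R^m)/\mathcal N_\tau(\mathbb R^m)$, where $\mathcal E_\tau$ consists of families $(u_\varepsilon)_{\varepsilon\in I}$ of functions in $\mathcal O_M(\mathbb R^m)$ (smooth functions all of whose derivatives are polynomially bounded) such that $\forall\alpha\,\exists r>0:\ \sup_x(1+|x|)^{-r}|\partial^\alpha u_\varepsilon(x)|=O(\varepsilon^{-r})$, and $\mathcal N_\tau$ of those with $\forall\alpha\,\exists r>0\,\forall s>0:\ \sup_x(1+|x|)^{-r}|\partial^\alpha u_\varepsilon(x)|=O(\varepsilon^s)$. $\widetilde{\mathcal G}_\tau(\mathbb R^{1+m})=\widetilde{\mathcal G}_\tau(\mathbb R\times\mathbb R^m)$ is defined analogously for families depending on $(\eta,x)$, with estimates uniform for $\eta$ in each compact set $K\subset\mathbb R$ (the exponents may depend on $K$) and weights $(1+|x|)^{-r}$. Compositions and insertions of points are componentwise in $\varepsilon$. $\mathcal R$ is the ring of generalized numbers (families $(r_\varepsilon)$ with $|r_\varepsilon|\le\varepsilon^{-s}$ for some $s$ and small $\varepsilon$, modulo families that are $O(\varepsilon^s)$ for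 all $s$); $\mathcal R_c$ is the set of those having a representative that stays in a compact set for small $\varepsilon$. A generalized group action on $\mathbb R^m$ is $\Phi\in(\widetilde{\mathcal G}_\tau(\mathbb R^{1+m}))^m$ with $\Phi(0,\cdot)=\mathrm{id}$ in $(\mathcal G_\tau(\mathbb R^m))^m$ and $\Phi(\eta_1+\eta_2,\cdot)=\Phi(\eta_1,\Phi(\eta_2,\cdot))$ as generalized functions of $(\eta_1,\eta_2,\cdot)\in\mathbb R^{2+m}$. A generalized vector field $\sum\xi_j(x)\partial_{x_j}$, $\xi\in(\mathcal G_\tau(\mathbb R^m))^m$, is $\mathcal G$-complete if $\dot x(t)=\xi(x(t))$, $x(t_o)=\widetilde x_o$ is uniquely solvable in $\mathcal G(\mathbb R)^m$ for any $\widetilde x_o\in\mathcal R^m$, $t_o\in\mathbb R$. With $\xi:=\frac{d}{d\eta}\big|_0\Phi(\eta,\cdot)$, if $X=\sum\xi_j\partial_{x_j}$ is $\mathcal G$-complete, $X$ is called the infinitesimal generator of $\Phi$ and $\Phi$ is called $\mathcal G$-complete. The flow of a system $\dot y=\zeta(y)$ on $\mathbb R^m$ is $h\in(\widetilde{\mathcal G}_\tau(\mathbb R^{1+m}))^m$ with $\frac{d}{d\eta}h=\zeta(h)$, $h(0,a)=a$. $\Phi$ on $\mathbb R^p\times\mathbb R^q$ is projectable if $\Phi(\eta,(x,u))=(\Xi_\eta(x),\Psi_\eta(x,u))$ with $\Xi\in(\widetilde{\mathcal G}_\tau(\mathbb R\times\mathbb R^p))^p$, $\Psi\in(\widetilde{\mathcal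 G}_\tau(\mathbb R\times\mathbb R^{p+q}))^q$. For $U\in(\mathcal G_\tau(\mathbb R^p))^q$, $\Phi_\eta(U)$ is the element $x\mapsto\Psi_\eta(\Xi_{-\eta}(x),U\circ\Xi_{-\eta}(x))$ of $(\mathcal G_\tau(\mathbb R^p))^q$. $(\mathbb R^p\times\mathbb R^q)^{(n)}\cong\mathbb R^N$ is the $n$-jet space, with coordinates $z=(x,u^{(n)})$, $(z_1,\dots,z_p)=x$; $(\mathcal R^p\times\mathcal R^q)^{(n)}\cong\mathcal R^N$ is the corresponding space of generalized points; $\mathrm{pr}^{(n)}U$ (also written $U^{(n)}$) collects $U$ and all its partial derivatives up to order $n$. The $n$-th prolongation $\mathrm{pr}^{(n)}\Phi$ (a generalized group action on $(\mathbb R^p\times\mathbb R^q)^{(n)}$) is defined as follows: for $z$ choose $h\in\mathcal O_M(\mathbb R^p)^q$ with $(z_1,\dots,z_p,\mathrm{pr}^{(n)}h(z_1,\dots,z_p))=z$ (e.g. a Taylor polynomial) and set $\mathrm{pr}^{(n)}\Phi(\eta,z):=(\Xi_\eta(z_1,\dots,z_p),\mathrm{pr}^{(n)}(\Phi_\eta(h))(\Xi_\eta(z_1,\dots,z_p)))$; this does not depend on the choice of $h$. If $\Phi$ is $\mathcal G$-complete with generator $X$ and $\mathrm{pr}^{(n)}\Phi$ is $\mathcal G$-complete as well, $\Phi$ and $X$ are called $\mathcal G$-$n$-complete and $\mathrm{pr}^{(n)}X|_z=\frac{d}{d\eta}\big|_0\mathrm{pr}^{(n)}\Phi_\eta(z)$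 is the infinitesimal generator of $\mathrm{pr}^{(n)}\Phi$. $\mathrm{pr}^{(n)}X(\Delta)=\sum_j\zeta_j\,\partial\Delta/\partial z_j$. $\Phi$ is a symmetry group of the PDE if for every solution $U\in(\mathcal G_\tau(\mathbb R^p))^q$ (i.e. $\Delta(x,\mathrm{pr}^{(n)}U(x))=0$ in $\mathcal G_\tau(\mathbb R^p)$) and every $\eta\in\mathcal R_c$, $\Phi_\eta(U)$ is again a solution. *)

theory Defs
  imports "HOL-Analysis.Analysis"
begin

text \<open>
  A generalized object (function, number, point) is given by a representing net, indexed by
  \<open>\<epsilon> \<in> (0,1]\<close>. Membership in one of the quotient spaces is membership of the net in the
  corresponding set of moderate nets; equality in the quotient is negligibility of the difference.
  Values of a net outside \<open>(0,1]\<close> are irrelevant. Vector-valued nets stand for tuples of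
  scalar generalized functions, and \<open>\<real>\<^sup>m\<close> is an arbitrary Euclidean space.
\<close>

type_synonym 'a net = "real \<Rightarrow> 'a"

section \<open>Smooth functions\<close>

text \<open>Multi-indices over the standard basis are written as lists of basis vectors;
  for smooth functions the order is immaterial.\<close>

primrec pderivs ::
  "'a::euclidean_space list \<Rightarrow> ('a \<Rightarrow> 'b::euclidean_space) \<Rightarrow> 'a \<Rightarrow> 'b" where
  "pderivs [] f = f"
| "pderivs (v # vs) f = (\<lambda>x. frechet_derivative (pderivs vs f) (at x) v)"

definition smooth :: "('a::euclidean_space \<Rightarrow> 'b::euclidean_space) \<Rightarrow> bool" where
  "smooth f \<longleftrightarrow> (\<forall>vs \<in> lists Basis. \<forall>x. pderivs vs f differentiable (at x))"

definition O_M :: "('a::euclidean_space \<Rightarrow> 'b::euclidean_space) set" where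
  "O_M = {f. smooth f \<and>
     (\<forall>vs \<in> lists Basis. \<exists>r C. \<forall>x. norm (pderivs vs f x) \<le> C * (1 + norm x) powr r)}"

text \<open>The analogue of \<open>O_M\<close> for functions of \<open>(\<eta>, x)\<close>: polynomial bounds in \<open>x\<close>,
  locally uniform in \<open>\<eta>\<close>.\<close>

definition O_M_loc :: "('t::euclidean_space \<times> 'a::euclidean_space \<Rightarrow> 'b::euclidean_space) set" where
  "O_M_loc = {f. smooth f \<and>
     (\<forall>K. compact K \<longrightarrow> (\<forall>vs \<in> lists Basis. \<exists>r C. \<forall>\<eta>\<in>K. \<forall>x.
        norm (pderivs vs f (\<eta>, x)) \<le> C * (1 + norm x) powr r))}"

section \<open>Moderate and negligible nets\<close>

definition E_M :: "('a::euclidean_space \<Rightarrow> 'b::euclidean_space) net set" where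
  "E_M = {u. (\<forall>\<epsilon>\<in>{0<..1}. smooth (u \<epsilon>)) \<and>
     (\<forall>K. compact K \<longrightarrow> (\<forall>vs \<in> lists Basis. \<exists>r C. \<forall>\<^sub>F \<epsilon> in at_right 0. \<forall>x\<in>K.
        norm (pderivs vs (u \<epsilon>) x) \<le> C * \<epsilon> powr (-r)))}"

definition N_M :: "('a::euclidean_space \<Rightarrow> 'b::euclidean_space) net set" where
  "N_M = {u. (\<forall>\<epsilon>\<in>{0<..1}. smooth (u \<epsilon>)) \<and>
     (\<forall>K. compact K \<longrightarrow> (\<forall>vs \<in> lists Basis. \<forall>s. \<exists>C. \<forall>\<^sub>F \<epsilon> in at_right 0. \<forall>x\<in>K.
        norm (pderivs vs (u \<epsilon>) x) \<le> C * \<epsilon> powr s))}"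

definition E_tau :: "('a::euclidean_space \<Rightarrow> 'b::euclidean_space) net set" where
  "E_tau = {u. (\<forall>\<epsilon>\<in>{0<..1}. u \<epsilon> \<in> O_M) \<and>
     (\<forall>vs \<in> lists Basis. \<exists>r>0. \<exists>C. \<forall>\<^sub>F \<epsilon> in at_right 0. \<forall>x.
        norm (pderivs vs (u \<epsilon>) x) \<le> C * \<epsilon> powr (-r) * (1 + norm x) powr r)}"

definition N_tau :: "('a::euclidean_space \<Rightarrow> 'b::euclidean_space) net set" where
  "N_tau = {u. (\<forall>\<epsilon>\<in>{0<..1}. u \<epsilon> \<in> O_M) \<and>
     (\<forall>vs \<in> lists Basis. \<exists>r>0. \<forall>s>0. \<exists>C. \<forall>\<^sub>F \<epsilon> in at_right 0. \<forall>x.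
        norm (pderivs vs (u \<epsilon>) x) \<le> C * \<epsilon> powr s * (1 + norm x) powr r)}"

text \<open>The spaces with a tilde: the first factor carries the parameters (\<open>\<real>\<close> for
  group actions and flows, \<open>\<real>\<^sup>2\<close> for the group law).\<close>

definition E_tau_loc ::
  "('t::euclidean_space \<times> 'a::euclidean_space \<Rightarrow> 'b::euclidean_space) net set" where
  "E_tau_loc = {u. (\<forall>\<epsilon>\<in>{0<..1}. u \<epsilon> \<in> O_M_loc) \<and>
     (\<forall>K. compact K \<longrightarrow> (\<forall>vs \<in> lists Basis. \<exists>r>0. \<exists>C. \<forall>\<^sub>F \<epsilon> in at_right 0. \<forall>\<eta>\<in>K. \<forall>x.
        norm (pderivs vs (u \<epsilon>) (\<eta>, x)) \<le> C * \<epsilon> powr (-r) * (1 + norm x) powr r))}"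

definition N_tau_loc ::
  "('t::euclidean_space \<times> 'a::euclidean_space \<Rightarrow> 'b::euclidean_space) net set" where
  "N_tau_loc = {u. (\<forall>\<epsilon>\<in>{0<..1}. u \<epsilon> \<in> O_M_loc) \<and>
     (\<forall>K. compact K \<longrightarrow> (\<forall>vs \<in> lists Basis. \<exists>r>0. \<forall>s>0. \<exists>C. \<forall>\<^sub>F \<epsilon> in at_right 0. \<forall>\<eta>\<in>K. \<forall>x.
        norm (pderivs vs (u \<epsilon>) (\<eta>, x)) \<le> C * \<epsilon> powr s * (1 + norm x) powr r))}"

definition moderate_pt :: "'a::euclidean_space net \<Rightarrow> bool" where
  "moderate_pt r \<longleftrightarrow> (\<exists>s. \<forall>\<^sub>F \<epsilon> in at_right 0. norm (r \<epsilon>) \<le> \<epsilon> powr (-s))"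

definition null_pt :: "'a::euclidean_space net \<Rightarrow> bool" where
  "null_pt r \<longleftrightarrow> (\<forall>s. \<exists>C. \<forall>\<^sub>F \<epsilon> in at_right 0. norm (r \<epsilon>) \<le> C * \<epsilon> powr s)"

definition R_c :: "real net set" where
  "R_c = {\<eta>. moderate_pt \<eta> \<and>
     (\<exists>\<eta>' K. null_pt (\<lambda>\<epsilon>. \<eta> \<epsilon> - \<eta>' \<epsilon>) \<and> compact K \<and> (\<forall>\<^sub>F \<epsilon> in at_right 0. \<eta>' \<epsilon> \<in> K))}"

section \<open>Generalized vector fields, flows and group actions\<close>

definition ode_solution ::
  "('a \<Rightarrow> 'a) net \<Rightarrow> real \<Rightarrow> 'a net \<Rightarrow> (real \<Rightarrow> 'a::euclidean_space) net \<Rightarrow> bool" where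
  "ode_solution \<xi> t0 x0 x \<longleftrightarrow> x \<in> E_M \<and>
     (\<lambda>\<epsilon> t. vector_derivative (x \<epsilon>) (at t) - \<xi> \<epsilon> (x \<epsilon> t)) \<in> N_M \<and>
     null_pt (\<lambda>\<epsilon>. x \<epsilon> t0 - x0 \<epsilon>)"

definition G_complete_field :: "('a::euclidean_space \<Rightarrow> 'a) net \<Rightarrow> bool" where
  "G_complete_field \<xi> \<longleftrightarrow> \<xi> \<in> E_tau \<and>
     (\<forall>t0 x0. moderate_pt x0 \<longrightarrow>
        (\<exists>x. ode_solution \<xi> t0 x0 x \<and>
           (\<forall>y. ode_solution \<xi> t0 x0 y \<longrightarrow> (\<lambda>\<epsilon> t. y \<epsilon> t - x \<epsilon> t) \<in> N_M)))"

definition is_flow ::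
  "('a \<Rightarrow> 'a) net \<Rightarrow> (real \<times> 'a::euclidean_space \<Rightarrow> 'a) net \<Rightarrow> bool" where
  "is_flow \<zeta> h \<longleftrightarrow> h \<in> E_tau_loc \<and>
     (\<lambda>\<epsilon> (\<eta>, a). vector_derivative (\<lambda>t. h \<epsilon> (t, a)) (at \<eta>) - \<zeta> \<epsilon> (h \<epsilon> (\<eta>, a))) \<in> N_tau_loc \<and>
     (\<lambda>\<epsilon> a. h \<epsilon> (0, a) - a) \<in> N_tau"

definition group_action :: "(real \<times> 'a::euclidean_space \<Rightarrow> 'a) net \<Rightarrow> bool" where
  "group_action \<Phi> \<longleftrightarrow> \<Phi> \<in> E_tau_loc \<and>
     (\<lambda>\<epsilon> x. \<Phi> \<epsilon> (0, x) - x) \<in> N_tau \<and>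
     (\<lambda>\<epsilon> ((\<eta>1, \<eta>2), x). \<Phi> \<epsilon> (\<eta>1 + \<eta>2, x) - \<Phi> \<epsilon> (\<eta>1, \<Phi> \<epsilon> (\<eta>2, x))) \<in> N_tau_loc"

definition generator ::
  "(real \<times> 'a::euclidean_space \<Rightarrow> 'a) net \<Rightarrow> ('a \<Rightarrow> 'a) net" where
  "generator \<Phi> = (\<lambda>\<epsilon> x. vector_derivative (\<lambda>\<eta>. \<Phi> \<epsilon> (\<eta>, x)) (at 0))"

definition G_complete_action :: "(real \<times> 'a::euclidean_space \<Rightarrow> 'a) net \<Rightarrow> bool" where
  "G_complete_action \<Phi> \<longleftrightarrow> group_action \<Phi> \<and> G_complete_field (generator \<Phi>)"

definition projectable ::
  "(real \<times> 'x \<times> 'u \<Rightarrow> 'x \<times> 'u) net \<Rightarrow>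
   (real \<times> 'x::euclidean_space \<Rightarrow> 'x) net \<Rightarrow>
   (real \<times> 'x \<times> 'u::euclidean_space \<Rightarrow> 'u) net \<Rightarrow> bool" where
  "projectable \<Phi> \<Xi> \<Psi> \<longleftrightarrow> \<Xi> \<in> E_tau_loc \<and> \<Psi> \<in> E_tau_loc \<and>
     (\<lambda>\<epsilon> (\<eta>, x, u). \<Phi> \<epsilon> (\<eta>, x, u) - (\<Xi> \<epsilon> (\<eta>, x), \<Psi> \<epsilon> (\<eta>, x, u))) \<in> N_tau_loc"

text \<open>\<open>\<Phi>\<^sub>\<eta>(U)\<close> for a generalized number \<open>\<eta>\<close>.\<close>

definition act_on ::
  "(real \<times> 'x \<Rightarrow> 'x) net \<Rightarrow> (real \<times> 'x \<times> 'u \<Rightarrow> 'u) net \<Rightarrow>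
   real net \<Rightarrow> ('x \<Rightarrow> 'u) net \<Rightarrow> ('x \<Rightarrow> 'u) net" where
  "act_on \<Xi> \<Psi> \<eta> U =
     (\<lambda>\<epsilon> x. \<Psi> \<epsilon> (\<eta> \<epsilon>, \<Xi> \<epsilon> (- \<eta> \<epsilon>, x), U \<epsilon> (\<Xi> \<epsilon> (- \<eta> \<epsilon>, x))))"

section \<open>Jet spaces and prolongation\<close>

text \<open>
  A multi-index on \<open>\<real>\<^sup>p\<close> is a function \<open>'p \<Rightarrow> nat\<close>. The multi-indices of order at most \<open>n\<close>
  are enumerated by a finite type \<open>'k\<close>, so that the \<open>n\<close>-jet space is the Euclidean space
  \<open>\<real>\<^sup>p \<times> (\<real>\<^sup>q)\<^sup>k\<close>: the component \<open>u $ k $ a\<close> of \<open>(x, u)\<close> is the coordinate belonging to the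
  derivative of the \<open>a\<close>-th dependent variable with multi-index \<open>\<mu> k\<close>. The coordinate
  directions of the jet space are the elements of \<open>Basis\<close>, and \<open>N\<close> is its dimension.
\<close>

type_synonym ('p, 'q, 'k) jets = "(real ^ 'p) \<times> (real ^ 'q ^ 'k)"

definition enumerates_multi_indices :: "('k::finite \<Rightarrow> 'p::finite \<Rightarrow> nat) \<Rightarrow> nat \<Rightarrow> bool" where
  "enumerates_multi_indices \<mu> n \<longleftrightarrow> bij_betw \<mu> UNIV {\<alpha>. (\<Sum>i\<in>UNIV. \<alpha> i) \<le> n}"

text \<open>The chosen list fixes an order of differentiation, immaterial for smooth functions.\<close>

definition multi_deriv ::
  "('p::finite \<Rightarrow> nat) \<Rightarrow> (real ^ 'p \<Rightarrow> 'b::euclidean_space) \<Rightarrow> real ^ 'p \<Rightarrow> 'b" where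
  "multi_deriv \<alpha> f =
     pderivs (map (\<lambda>i. axis i 1) (SOME js. \<forall>i. count_list js i = \<alpha> i)) f"

definition pr ::
  "('k::finite \<Rightarrow> 'p::finite \<Rightarrow> nat) \<Rightarrow> (real ^ 'p \<Rightarrow> real ^ 'q::finite) \<Rightarrow>
   real ^ 'p \<Rightarrow> real ^ 'q ^ 'k" where
  "pr \<mu> h x = (\<chi> k. multi_deriv (\<mu> k) h x)"

text \<open>The Taylor polynomial with prescribed jet \<open>z = (x, u)\<close>, i.e. the polynomial \<open>h\<close> of
  degree at most \<open>n\<close> satisfying \<open>(x, pr \<mu> h x) = z\<close>.\<close>

definition taylor ::
  "('k::finite \<Rightarrow> 'p::finite \<Rightarrow> nat) \<Rightarrow> ('p, 'q::finite, 'k) jets \<Rightarrow> real ^ 'p \<Rightarrow> real ^ 'q" where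
  "taylor \<mu> z y =
     (\<Sum>k\<in>UNIV. ((\<Prod>i\<in>UNIV. (y $ i - fst z $ i) ^ \<mu> k i / fact (\<mu> k i)) *\<^sub>R (snd z $ k)))"

text \<open>As a generalized function the prolongation does not depend on the choice of a function
  with jet \<open>z\<close>. On the level of representatives an arbitrary choice for each \<open>z\<close> need not give
  a net depending smoothly on \<open>z\<close>; the Taylor polynomial does.\<close>

definition prolong ::
  "('k::finite \<Rightarrow> 'p::finite \<Rightarrow> nat) \<Rightarrow>
   (real \<times> (real ^ 'p) \<Rightarrow> real ^ 'p) net \<Rightarrow>
   (real \<times> (real ^ 'p) \<times> (real ^ 'q::finite) \<Rightarrow> real ^ 'q) net \<Rightarrow>
   (real \<times> ('p, 'q, 'k) jets \<Rightarrow> ('p, 'q, 'k) jets) net" where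
  "prolong \<mu> \<Xi> \<Psi> = (\<lambda>\<epsilon> (\<eta>, z).
     (\<Xi> \<epsilon> (\<eta>, fst z),
      pr \<mu> (act_on \<Xi> \<Psi> (\<lambda>_. \<eta>) (\<lambda>_. taylor \<mu> z) \<epsilon>) (\<Xi> \<epsilon> (\<eta>, fst z))))"

definition G_n_complete ::
  "('k::finite \<Rightarrow> 'p::finite \<Rightarrow> nat) \<Rightarrow>
   (real \<times> (real ^ 'p) \<times> (real ^ 'q) \<Rightarrow> (real ^ 'p) \<times> (real ^ 'q)) net \<Rightarrow>
   (real \<times> (real ^ 'p) \<Rightarrow> real ^ 'p) net \<Rightarrow>
   (real \<times> (real ^ 'p) \<times> (real ^ 'q::finite) \<Rightarrow> real ^ 'q) net \<Rightarrow> bool" where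
  "G_n_complete \<mu> \<Phi> \<Xi> \<Psi> \<longleftrightarrow>
     G_complete_action \<Phi> \<and> G_complete_action (prolong \<mu> \<Xi> \<Psi>)"

text \<open>\<open>X(\<Delta>) = \<Sum>\<^sub>j \<zeta>\<^sub>j \<partial>\<Delta>/\<partial>z\<^sub>j\<close> for the vector field \<open>X\<close> with coefficients \<open>\<zeta>\<close>.\<close>

definition apply_field ::
  "('a::euclidean_space \<Rightarrow> 'a) net \<Rightarrow> ('a \<Rightarrow> real) net \<Rightarrow> ('a \<Rightarrow> real) net" where
  "apply_field \<zeta> \<Delta> =
     (\<lambda>\<epsilon> z. \<Sum>b\<in>Basis. (\<zeta> \<epsilon> z \<bullet> b) * frechet_derivative (\<Delta> \<epsilon>) (at z) b)"

definition is_solution ::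
  "('k::finite \<Rightarrow> 'p::finite \<Rightarrow> nat) \<Rightarrow> (('p, 'q::finite, 'k) jets \<Rightarrow> real) net \<Rightarrow>
   (real ^ 'p \<Rightarrow> real ^ 'q) net \<Rightarrow> bool" where
  "is_solution \<mu> \<Delta> U \<longleftrightarrow> U \<in> E_tau \<and> (\<lambda>\<epsilon> x. \<Delta> \<epsilon> (x, pr \<mu> (U \<epsilon>) x)) \<in> N_tau"

definition is_symmetry_group ::
  "('k::finite \<Rightarrow> 'p::finite \<Rightarrow> nat) \<Rightarrow> (('p, 'q, 'k) jets \<Rightarrow> real) net \<Rightarrow>
   (real \<times> (real ^ 'p) \<Rightarrow> real ^ 'p) net \<Rightarrow>
   (real \<times> (real ^ 'p) \<times> (real ^ 'q::finite) \<Rightarrow> real ^ 'q) net \<Rightarrow> bool" where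
  "is_symmetry_group \<mu> \<Delta> \<Xi> \<Psi> \<longleftrightarrow>
     (\<forall>U. is_solution \<mu> \<Delta> U \<longrightarrow> (\<forall>\<eta>\<in>R_c. is_solution \<mu> \<Delta> (act_on \<Xi> \<Psi> \<eta> U)))"

section \<open>Splitting off one coordinate\<close>

text \<open>
  \<open>\<real>\<^sup>N\<^sup>-\<^sup>1\<close> is \<open>real ^ 'r\<close>, where \<open>e\<close> enumerates the coordinate directions other than \<open>b\<close>.
  \<open>omit_coord e z\<close> is \<open>z'\<close>, and \<open>insert_coord e b z' t\<close> is the point with \<open>b\<close>-coordinate \<open>t\<close>
  and remaining coordinates \<open>z'\<close>.
\<close>

definition omit_coord :: "('r::finite \<Rightarrow> 'a::euclidean_space) \<Rightarrow> 'a \<Rightarrow> real ^ 'r" where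
  "omit_coord e z = (\<chi> j. z \<bullet> e j)"

definition insert_coord ::
  "('r::finite \<Rightarrow> 'a::euclidean_space) \<Rightarrow> 'a \<Rightarrow> real ^ 'r \<Rightarrow> real \<Rightarrow> 'a" where
  "insert_coord e b z' t = (\<Sum>j\<in>UNIV. (z' $ j) *\<^sub>R e j) + t *\<^sub>R b"

definition restrict_field ::
  "('r::finite \<Rightarrow> 'a::euclidean_space) \<Rightarrow> 'a \<Rightarrow> (real ^ 'r \<Rightarrow> real) net \<Rightarrow>
   ('a \<Rightarrow> 'a) net \<Rightarrow> (real ^ 'r \<Rightarrow> real ^ 'r) net" where
  "restrict_field e b f \<zeta> =
     (\<lambda>\<epsilon> z'. omit_coord e (\<zeta> \<epsilon> (insert_coord e b z' (f \<epsilon> z'))))"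

end

theory Submission
  imports Defs
begin

text \<open>
  A solution \<open>U\<close> is transformed into a solution because the prolonged action maps generalized
  zeros of \<open>\<Delta>\<close> to generalized zeros of \<open>\<Delta>\<close> (\<open>zero_set_invariant\<close>), and because the jet of the
  transformed function at a point \<open>X\<close> is the image under the prolonged action of the jet of \<open>U\<close> at
  \<open>\<Xi>\<^sub>-\<^sub>\<eta>(X)\<close> (\<open>prolong_jet\<close>).

  Invariance of the zero set. The zeros of \<open>\<Delta> = z\<^sub>i - f(z')\<close> form a graph. Let \<open>z\<close> be a zero, let
  \<open>h\<close> be the flow of the restricted field, started at \<open>z'\<close>, and lift it to the curve
  \<open>y = (h, f(h))\<close>, which runs in the graph. The components of \<open>y\<close> other than the \<open>i\<close>-th satisfy
  the differential equation of the prolonged field because \<open>h\<close> is a flow. The \<open>i\<close>-th component is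
  \<open>f(h)\<close>, with derivative \<open>df(h)\<close> applied to \<open>h'\<close>; that this is the \<open>i\<close>-th component of the field
  is the infinitesimal criterion, which says that at points of the graph the field is tangent to
  the graph (\<open>tangent_to_graph\<close>). So \<open>y\<close> and the orbit of \<open>z\<close> solve the same initial value
  problem. The field is \<open>\<G>\<close>-complete, hence they agree, and the orbit remains in the graph.

  The computation takes place at generalized points, where a null error stays null under all
  moderate operations. This is sufficient because a moderate net that vanishes at all generalized
  points is negligible together with its derivatives (\<open>N_tau_pointwise\<close>, and \<open>N_M_pointwise\<close> for
  locally uniform estimates and bounded points): a first derivative is bounded in terms of the
  function and its second derivative (\<open>derivative_interpolation\<close>).

  The jet identity. The prolonged action at a jet \<open>z\<close> is computed from the Taylor polynomial of
  \<open>z\<close>. The \<open>n\<close>-jet of \<open>\<Phi>\<^sub>\<eta>(U)\<close> at \<open>X\<close> depends only on the \<open>n\<close>-jet of \<open>U\<close> at \<open>\<Xi>\<^sub>-\<^sub>\<eta>(X)\<close>, so that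
  \<open>U\<close> may be replaced by its Taylor polynomial there. The prolonged action evaluates the result at
  \<open>\<Xi>\<^sub>\<eta>(\<Xi>\<^sub>-\<^sub>\<eta>(X))\<close> rather than at \<open>X\<close>; the group law makes the difference null.

  That all the nets formed on the way are again moderate is shown with a single notion of growth
  bound, \<open>tempered\<close>, which is closed under sums, products, composition and derivatives, and of
  which membership in each of the spaces of moderate nets is an instance.
\<close>

section \<open>Partial derivatives of smooth functions\<close>

lemma pderivs_append: "pderivs (vs @ ws) f = pderivs vs (pderivs ws f)"
  by (induction vs) simp_all

lemma smoothD:
  assumes "smooth f" "vs \<in> lists Basis"
  shows "pderivs vs f differentiable (at x)"
  using assms by (auto simp: smooth_def)

lemma smooth_differentiable: "smooth f \<Longrightarrow> f differentiable (at x)"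
  using smoothD[of f "[]"] by simp

lemma smooth_pderivs:
  assumes "smooth f" "ws \<in> lists Basis"
  shows "smooth (pderivs ws f)"
  unfolding smooth_def
proof (intro ballI allI)
  fix vs :: "'a list" and x assume "vs \<in> lists Basis"
  then have "vs @ ws \<in> lists Basis" using assms(2) by auto
  from smoothD[OF assms(1) this, of x] show "pderivs vs (pderivs ws f) differentiable (at x)"
    by (simp add: pderivs_append)
qed

lemma smooth_pderiv: "smooth f \<Longrightarrow> v \<in> Basis \<Longrightarrow> smooth (pderivs [v] f)"
  by (rule smooth_pderivs) auto

lemma continuous_on_pderivs:
  assumes "smooth f" "vs \<in> lists Basis"
  shows "continuous_on S (pderivs vs f)"
  using smoothD[OF assms] differentiable_imp_continuous_within
  by (metis continuous_at_imp_continuous_on)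

lemma directional_derivative:
  assumes "g differentiable (at (a + t *\<^sub>R v))"
  shows "((\<lambda>t. g (a + t *\<^sub>R v)) has_vector_derivative frechet_derivative g (at (a + t *\<^sub>R v)) v) (at t)"
proof -
  let ?L = "frechet_derivative g (at (a + t *\<^sub>R v))"
  have g: "(g has_derivative ?L) (at (a + t *\<^sub>R v))"
    using assms frechet_derivative_works by blast
  have "((\<lambda>t. a + t *\<^sub>R v) has_derivative (\<lambda>h. h *\<^sub>R v)) (at t)"
    by (auto intro!: derivative_eq_intros)
  from has_derivative_compose[OF this g]
  have "((\<lambda>t. g (a + t *\<^sub>R v)) has_derivative (\<lambda>h. ?L (h *\<^sub>R v))) (at t)" .
  moreover have "linear ?L" by (rule linear_frechet_derivative[OF assms])
  ultimately show ?thesis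
    by (simp add: has_vector_derivative_def linear_scale)
qed

text \<open>
  The mean value theorem in direction \<open>v\<close> and then in direction \<open>w\<close>. The left-hand side is
  symmetric in \<open>v\<close> and \<open>w\<close>, and this symmetry passes to the derivatives in the limit \<open>s \<rightarrow> 0\<close>.
\<close>
lemma second_difference:
  fixes f :: "'a::euclidean_space \<Rightarrow> 'b::euclidean_space"
  assumes f: "smooth f" and v: "v \<in> Basis" and w: "w \<in> Basis" and s: "s > 0"
  shows "\<exists>p q. 0 < p \<and> p < s \<and> 0 < q \<and> q < s \<and>
    (f (x + s *\<^sub>R v + s *\<^sub>R w) - f (x + s *\<^sub>R v) - f (x + s *\<^sub>R w) + f x) \<bullet> c =
    s\<^sup>2 * (pderivs [w, v] f (x + p *\<^sub>R v + q *\<^sub>R w) \<bullet> c)"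
proof -
  let ?D = "pderivs [v] f"
  have df: "f differentiable (at y)" for y by (rule smooth_differentiable[OF f])
  have dD: "?D differentiable (at y)" for y
    using smooth_differentiable[OF smooth_pderivs[OF f, of "[v]"]] v by simp
  have fv: "((\<lambda>t. f (a + t *\<^sub>R v) \<bullet> c) has_real_derivative ?D (a + t *\<^sub>R v) \<bullet> c) (at t)" for a t
    using directional_derivative[OF df, where a=a and t=t and v=v]
    by (auto simp: has_real_derivative_iff_has_vector_derivative
        intro: bounded_linear.has_vector_derivative[OF bounded_linear_inner_left])
  have Dw: "((\<lambda>t. ?D (a + t *\<^sub>R w) \<bullet> c) has_real_derivative pderivs [w, v] f (a + t *\<^sub>R w) \<bullet> c) (at t)" for a t
    using directional_derivative[OF dD, where a=a and t=t and v=w]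
    by (auto simp: has_real_derivative_iff_has_vector_derivative
        intro: bounded_linear.has_vector_derivative[OF bounded_linear_inner_left])
  define \<phi> where "\<phi> t = f ((x + s *\<^sub>R w) + t *\<^sub>R v) \<bullet> c - f (x + t *\<^sub>R v) \<bullet> c" for t
  have d\<phi>: "(\<phi> has_real_derivative (?D ((x + s *\<^sub>R w) + t *\<^sub>R v) \<bullet> c - ?D (x + t *\<^sub>R v) \<bullet> c)) (at t)" for t
    unfolding \<phi>_def by (intro DERIV_diff fv)
  from MVT2[OF s, of \<phi>, OF d\<phi>] obtain p where p: "0 < p" "p < s"
    "\<phi> s - \<phi> 0 = (s - 0) * (?D ((x + s *\<^sub>R w) + p *\<^sub>R v) \<bullet> c - ?D (x + p *\<^sub>R v) \<bullet> c)" by auto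
  from MVT2[OF s, of "\<lambda>t. ?D ((x + p *\<^sub>R v) + t *\<^sub>R w) \<bullet> c", OF Dw]
  obtain q where q: "0 < q" "q < s"
    "?D (x + p *\<^sub>R v + s *\<^sub>R w) \<bullet> c - ?D (x + p *\<^sub>R v) \<bullet> c = s * (pderivs [w, v] f (x + p *\<^sub>R v + q *\<^sub>R w) \<bullet> c)"
    by auto
  have "(f (x + s *\<^sub>R v + s *\<^sub>R w) - f (x + s *\<^sub>R v) - f (x + s *\<^sub>R w) + f x) \<bullet> c = \<phi> s - \<phi> 0"
    by (simp add: \<phi>_def inner_diff_left inner_add_left algebra_simps)
  also have "\<dots> = s\<^sup>2 * (pderivs [w, v] f (x + p *\<^sub>R v + q *\<^sub>R w) \<bullet> c)"
    using p(3) q(3) by (simp add: power2_eq_square algebra_simps)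
  finally show ?thesis using p q by blast
qed

lemma pderivs_swap:
  fixes f :: "'a::euclidean_space \<Rightarrow> 'b::euclidean_space"
  assumes f: "smooth f" and v: "v \<in> Basis" and w: "w \<in> Basis"
  shows "pderivs [v, w] f = pderivs [w, v] f"
proof
  fix x
  have "pderivs [v, w] f x \<bullet> c = pderivs [w, v] f x \<bullet> c" for c
  proof -
    define s where "s n = 1 / real (Suc n)" for n
    have s0: "s n > 0" for n by (simp add: s_def)
    have slim: "s \<longlonglongrightarrow> 0" unfolding s_def using LIMSEQ_inverse_real_of_nat by (simp add: inverse_eq_divide)
    have small: "g \<longlonglongrightarrow> 0" if "\<And>n. 0 < g n \<and> g n < s n" for g
      by (rule tendsto_sandwich[OF _ _ tendsto_const slim]) (auto intro!: always_eventually less_imp_le simp: that)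
    let ?d = "\<lambda>n. (f (x + s n *\<^sub>R v + s n *\<^sub>R w) - f (x + s n *\<^sub>R v) - f (x + s n *\<^sub>R w) + f x) \<bullet> c"
    have lim: "\<exists>z. z \<longlonglongrightarrow> x \<and> (\<forall>n. ?d n = (s n)\<^sup>2 * (pderivs [b, a] f (z n) \<bullet> c))"
      if ab: "a \<in> Basis" "b \<in> Basis" "(a = v \<and> b = w) \<or> (a = w \<and> b = v)" for a b
    proof -
      have "\<forall>n. \<exists>p q. 0 < p \<and> p < s n \<and> 0 < q \<and> q < s n \<and>
        (f (x + s n *\<^sub>R a + s n *\<^sub>R b) - f (x + s n *\<^sub>R a) - f (x + s n *\<^sub>R b) + f x) \<bullet> c =
        (s n)\<^sup>2 * (pderivs [b, a] f (x + p *\<^sub>R a + q *\<^sub>R b) \<bullet> c)"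
        using second_difference[OF f ab(1,2) s0] by blast
      then obtain p q where pq: "\<And>n. 0 < p n \<and> p n < s n" "\<And>n. 0 < q n \<and> q n < s n"
        and e: "\<And>n. (f (x + s n *\<^sub>R a + s n *\<^sub>R b) - f (x + s n *\<^sub>R a) - f (x + s n *\<^sub>R b) + f x) \<bullet> c =
        (s n)\<^sup>2 * (pderivs [b, a] f (x + p n *\<^sub>R a + q n *\<^sub>R b) \<bullet> c)" by metis
      have "(\<lambda>n. x + p n *\<^sub>R a + q n *\<^sub>R b) \<longlonglongrightarrow> x + 0 *\<^sub>R a + 0 *\<^sub>R b"
        by (intro tendsto_intros small pq)
      moreover have "?d n = (s n)\<^sup>2 * (pderivs [b, a] f (x + p n *\<^sub>R a + q n *\<^sub>R b) \<bullet> c)" for n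
        using e[of n] ab(3) by (auto simp: algebra_simps inner_diff_left inner_add_left)
      ultimately show ?thesis by (intro exI[of _ "\<lambda>n. x + p n *\<^sub>R a + q n *\<^sub>R b"]) simp
    qed
    from lim[of v w] v w obtain z where z: "z \<longlonglongrightarrow> x" "\<And>n. ?d n = (s n)\<^sup>2 * (pderivs [w, v] f (z n) \<bullet> c)" by metis
    from lim[of w v] v w obtain y where y: "y \<longlonglongrightarrow> x" "\<And>n. ?d n = (s n)\<^sup>2 * (pderivs [v, w] f (y n) \<bullet> c)" by metis
    have "pderivs [w, v] f (z n) \<bullet> c = pderivs [v, w] f (y n) \<bullet> c" for n
    proof -
      have "(s n)\<^sup>2 * (pderivs [w, v] f (z n) \<bullet> c) = (s n)\<^sup>2 * (pderivs [v, w] f (y n) \<bullet> c)"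
        using z(2)[of n] y(2)[of n] by (rule trans[OF sym])
      then show ?thesis using s0[of n] by (simp del: pderivs.simps)
    qed
    moreover have cont: "(\<lambda>n. pderivs us f (z n) \<bullet> c) \<longlonglongrightarrow> pderivs us f x \<bullet> c" if "us \<in> lists Basis" "z \<longlonglongrightarrow> x" for us z
      by (intro tendsto_intros continuous_on_tendsto_compose[OF continuous_on_pderivs[OF f that(1), of UNIV] that(2)]) auto
    ultimately have "(\<lambda>n. pderivs [v, w] f (y n) \<bullet> c) \<longlonglongrightarrow> pderivs [w, v] f x \<bullet> c"
      using cont[of "[w, v]" z] v w z(1) by (simp del: pderivs.simps)
    moreover have "(\<lambda>n. pderivs [v, w] f (y n) \<bullet> c) \<longlonglongrightarrow> pderivs [v, w] f x \<bullet> c"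
      using cont[of "[v, w]" y] v w y(1) by (simp del: pderivs.simps)
    ultimately show ?thesis using LIMSEQ_unique by blast
  qed
  then show "pderivs [v, w] f x = pderivs [w, v] f x" by (metis euclidean_eqI)
qed

lemma pderivs_append_single:
  fixes f :: "'a::euclidean_space \<Rightarrow> 'b::euclidean_space"
  assumes f: "smooth f" and "v \<in> Basis" "vs \<in> lists Basis"
  shows "pderivs (vs @ [v]) f = pderivs (v # vs) f"
  using assms(3)
proof (induction vs rule: list.induct)
  case (Cons w vs)
  then have vs: "vs \<in> lists Basis" and w: "w \<in> Basis" by auto
  have "pderivs ((w # vs) @ [v]) f = pderivs [w] (pderivs (v # vs) f)"
    using Cons.IH[OF vs] by simp
  also have "\<dots> = pderivs [w, v] (pderivs vs f)" by simp
  also have "\<dots> = pderivs [v, w] (pderivs vs f)"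
    by (rule pderivs_swap[OF smooth_pderivs[OF f vs] w assms(2)])
  finally show ?case by simp
qed simp

text \<open>
  Since neighbouring directions may be exchanged, the first direction of one list can be moved
  to the front of the other.
\<close>
lemma pderivs_mset_cong:
  fixes f :: "'a::euclidean_space \<Rightarrow> 'b::euclidean_space"
  assumes f: "smooth f" and "vs \<in> lists Basis" "mset vs = mset ws"
  shows "pderivs vs f = pderivs ws f"
  using assms(2,3)
proof (induction vs arbitrary: ws rule: list.induct)
  case (Cons v vs)
  then have vs: "vs \<in> lists Basis" and v: "v \<in> Basis" by auto
  have "v \<in> set ws" using Cons.prems(2) by (metis list.set_intros(1) mset_eq_setD)
  then obtain xs ys where ws: "ws = xs @ v # ys" by (meson split_list)
  have eq: "mset vs = mset (xs @ ys)" using Cons.prems(2) ws by simp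
  then have xys: "xs @ ys \<in> lists Basis" using vs by (metis in_lists_conv_set mset_eq_setD)
  have "pderivs (v # vs) f = pderivs [v] (pderivs (xs @ ys) f)"
    using Cons.IH[OF vs eq] by simp
  also have "\<dots> = pderivs (v # xs) (pderivs ys f)" by (simp add: pderivs_append)
  also have "\<dots> = pderivs (xs @ [v]) (pderivs ys f)"
    using xys v by (intro pderivs_append_single[symmetric] smooth_pderivs f) auto
  finally show ?case by (simp add: ws pderivs_append)
qed simp

section \<open>Growth bounds\<close>

text \<open>
  Growth is measured by powers of weights that are at least 2, so that constant factors and real
  exponents can be absorbed into a natural exponent.
\<close>
lemma powr_le_power:
  fixes r C :: real
  obtains m :: nat where "\<And>w. 2 \<le> w \<Longrightarrow> C * w powr r \<le> w ^ m"
proof -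
  obtain a :: nat where a: "C \<le> 2 ^ a" using real_arch_pow[of 2 C] by (auto intro: less_imp_le)
  have "C * w powr r \<le> w ^ (a + nat \<lceil>r\<rceil>)" if w: "2 \<le> w" for w
  proof -
    have "C * w powr r \<le> 2 ^ a * w powr r" using a by (intro mult_right_mono) auto
    also have "\<dots> \<le> w ^ a * w powr r" using w by (intro mult_right_mono power_mono) auto
    also have "w powr r \<le> w powr (real (nat \<lceil>r\<rceil>))"
      using w by (intro powr_mono) linarith+
    then have "w ^ a * w powr r \<le> w ^ a * w ^ nat \<lceil>r\<rceil>"
      using w by (intro mult_left_mono) (auto simp: powr_realpow)
    finally show ?thesis by (simp add: power_add)
  qed
  then show thesis by (rule that)
qed

lemma pderivs_singleton: "(f has_derivative f') (at x) \<Longrightarrow> pderivs [v] f x = f' v"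
  using frechet_derivative_at by fastforce

lemma differentiable_has_derivative:
  "f differentiable (at x) \<Longrightarrow> (f has_derivative frechet_derivative f (at x)) (at x)"
  by (simp flip: frechet_derivative_works)

lemma pderiv_linear:
  assumes "\<And>x. f differentiable (at x)" "bounded_linear L"
  shows "pderivs [v] (\<lambda>x. L (f x)) = (\<lambda>x. L (pderivs [v] f x))"
  using bounded_linear.has_derivative[OF assms(2) differentiable_has_derivative[OF assms(1)]]
  by (intro ext, subst pderivs_singleton) auto

lemma pderiv_add:
  assumes "\<And>x. f differentiable (at x)" "\<And>x. g differentiable (at x)"
  shows "pderivs [v] (\<lambda>x. f x + g x) = (\<lambda>x. pderivs [v] f x + pderivs [v] g x)"
  using has_derivative_add[OF assms[THEN differentiable_has_derivative]]
  by (intro ext, subst pderivs_singleton[of "\<lambda>x. f x + g x"]) auto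

lemma pderiv_scaleR:
  assumes "\<And>x. f differentiable (at x)" "\<And>x. g differentiable (at x)"
  shows "pderivs [v] (\<lambda>x. f x *\<^sub>R g x) = (\<lambda>x. f x *\<^sub>R pderivs [v] g x + pderivs [v] f x *\<^sub>R g x)"
  using has_derivative_scaleR[OF assms[THEN differentiable_has_derivative]]
  by (intro ext, subst pderivs_singleton[of "\<lambda>x. f x *\<^sub>R g x"]) auto

lemma pderiv_compose:
  fixes g :: "'a::euclidean_space \<Rightarrow> 'c::euclidean_space"
  assumes "\<And>x. g differentiable (at x)" "\<And>y. f differentiable (at y)"
  shows "pderivs [v] (\<lambda>x. f (g x)) = (\<lambda>x. \<Sum>b\<in>Basis. (pderivs [v] g x \<bullet> b) *\<^sub>R pderivs [b] f (g x))"
proof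
  fix x
  let ?L = "frechet_derivative f (at (g x))" and ?y = "frechet_derivative g (at x) v"
  have "linear ?L" by (rule linear_frechet_derivative[OF assms(2)])
  then have "(\<Sum>b\<in>Basis. (?y \<bullet> b) *\<^sub>R ?L b) = ?L ?y"
    by (subst (5) euclidean_representation[symmetric]) (simp add: linear_sum linear_scale)
  with has_derivative_compose[OF assms[THEN differentiable_has_derivative]]
  show "pderivs [v] (\<lambda>x. f (g x)) x = (\<Sum>b\<in>Basis. (pderivs [v] g x \<bullet> b) *\<^sub>R pderivs [b] f (g x))"
    by (subst pderivs_singleton[of "\<lambda>x. f (g x)"]) auto
qed

lemma pderivs_const: "vs \<noteq> [] \<Longrightarrow> pderivs vs (\<lambda>x. c) = (\<lambda>x. 0)"
proof (induction vs rule: list.induct)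
  case (Cons v vs)
  then show ?case by (cases "vs = []") auto
qed simp

definition controlled ::
  "real filter \<Rightarrow> 'a set \<Rightarrow> (real \<Rightarrow> 'a \<Rightarrow> real) \<Rightarrow> ('a::euclidean_space \<Rightarrow> 'b::euclidean_space) net \<Rightarrow> bool" where
  "controlled F D w u \<longleftrightarrow> (\<forall>\<epsilon>\<in>{0<..1}. \<forall>x. u \<epsilon> differentiable (at x)) \<and>
     (\<exists>k::nat. \<forall>\<^sub>F \<epsilon> in F. \<forall>x\<in>D. norm (u \<epsilon> x) \<le> w \<epsilon> x ^ k)"

text \<open>
  The common form of the growth conditions. The filter \<open>F\<close> selects the \<open>\<epsilon>\<close> for which the estimate
  has to hold, the set \<open>D\<close> is the region where it is uniform, and the weight \<open>w\<close> is the quantity in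
  which growth is polynomial.
\<close>
definition tempered ::
  "real filter \<Rightarrow> 'a set \<Rightarrow> (real \<Rightarrow> 'a \<Rightarrow> real) \<Rightarrow> ('a::euclidean_space \<Rightarrow> 'b::euclidean_space) net \<Rightarrow> bool" where
  "tempered F D w u \<longleftrightarrow> (\<forall>vs\<in>lists Basis. controlled F D w (\<lambda>\<epsilon>. pderivs vs (u \<epsilon>)))"

text \<open>
  A derivative of a product or of a composite involves all derivatives of lower order of the parts,
  so closure under these operations is proved by induction on the order.
\<close>
primrec tempered_upto ::
  "nat \<Rightarrow> real filter \<Rightarrow> 'a set \<Rightarrow> (real \<Rightarrow> 'a \<Rightarrow> real) \<Rightarrow> ('a::euclidean_space \<Rightarrow> 'b::euclidean_space) net \<Rightarrow> bool" where
  "tempered_upto 0 F D w u \<longleftrightarrow> controlled F D w u"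
| "tempered_upto (Suc n) F D w u \<longleftrightarrow> controlled F D w u \<and>
     (\<forall>v\<in>Basis. tempered_upto n F D w (\<lambda>\<epsilon>. pderivs [v] (u \<epsilon>)))"

text \<open>
  On \<open>D\<close> such weights are eventually at least 2 and dominate \<open>1/\<epsilon>\<close>, so that powers of the weight
  absorb constants and negative powers of \<open>\<epsilon>\<close>.
\<close>
definition admissible :: "real filter \<Rightarrow> 'a set \<Rightarrow> (real \<Rightarrow> 'a \<Rightarrow> real) \<Rightarrow> bool" where
  "admissible F D w \<longleftrightarrow> (\<forall>\<^sub>F \<epsilon> in F. \<epsilon> \<in> {0<..1} \<and> (\<forall>x\<in>D. 2 / \<epsilon> \<le> w \<epsilon> x))"

lemma tempered_upto_iff:
  "tempered_upto n F D w u \<longleftrightarrow>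
     (\<forall>vs\<in>lists Basis. length vs \<le> n \<longrightarrow> controlled F D w (\<lambda>\<epsilon>. pderivs vs (u \<epsilon>)))"
proof (induction n arbitrary: u)
  case (Suc n)
  have "(\<forall>vs\<in>lists Basis. length vs \<le> Suc n \<longrightarrow> controlled F D w (\<lambda>\<epsilon>. pderivs vs (u \<epsilon>))) \<longleftrightarrow>
    controlled F D w u \<and> (\<forall>v\<in>Basis. \<forall>vs\<in>lists Basis. length vs \<le> n \<longrightarrow>
      controlled F D w (\<lambda>\<epsilon>. pderivs (vs @ [v]) (u \<epsilon>)))" (is "?L \<longleftrightarrow> ?R")
  proof
    assume L: ?L
    have "controlled F D w u" using bspec[OF L, of "[]"] by simp
    moreover have "controlled F D w (\<lambda>\<epsilon>. pderivs (vs @ [v]) (u \<epsilon>))"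
      if "v \<in> Basis" "vs \<in> lists Basis" "length vs \<le> n" for v vs
      using bspec[OF L, of "vs @ [v]"] that by auto
    ultimately show ?R by blast
  next
    assume R: ?R
    show ?L
    proof (intro ballI impI)
      fix vs :: "'a list" assume "vs \<in> lists Basis" "length vs \<le> Suc n"
      then show "controlled F D w (\<lambda>\<epsilon>. pderivs vs (u \<epsilon>))"
        using R by (cases vs rule: rev_cases) auto
    qed
  qed
  then show ?case by (simp add: Suc pderivs_append)
qed simp

lemma tempered_iff_upto: "tempered F D w u \<longleftrightarrow> (\<forall>n. tempered_upto n F D w u)"
  by (auto simp: tempered_def tempered_upto_iff)

lemma tempered_upto_controlled: "tempered_upto n F D w u \<Longrightarrow> controlled F D w u"
  by (cases n) auto

lemma tempered_controlled: "tempered F D w u \<Longrightarrow> controlled F D w u"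
  by (auto simp: tempered_iff_upto dest: tempered_upto_controlled)

lemma tempered_upto_Suc_weaken: "tempered_upto (Suc n) F D w u \<Longrightarrow> tempered_upto n F D w u"
  by (auto simp: tempered_upto_iff)

lemma tempered_pderivs: "tempered F D w u \<Longrightarrow> vs \<in> lists Basis \<Longrightarrow> tempered F D w (\<lambda>\<epsilon>. pderivs vs (u \<epsilon>))"
  by (auto simp: tempered_def simp flip: pderivs_append)

lemma controlled_differentiable: "controlled F D w u \<Longrightarrow> \<epsilon> \<in> {0<..1} \<Longrightarrow> u \<epsilon> differentiable (at x)"
  by (auto simp: controlled_def)

context
  fixes F :: "real filter" and D :: "'a::euclidean_space set" and w :: "real \<Rightarrow> 'a \<Rightarrow> real"
  assumes adm: "admissible F D w"
begin

lemma eventually_weight: "\<forall>\<^sub>F \<epsilon> in F. \<epsilon> \<in> {0<..1} \<and> (\<forall>x\<in>D. 2 / \<epsilon> \<le> w \<epsilon> x \<and> 2 \<le> w \<epsilon> x)"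
  using adm unfolding admissible_def
proof (rule eventually_mono)
  fix \<epsilon> assume *: "\<epsilon> \<in> {0<..1} \<and> (\<forall>x\<in>D. 2 / \<epsilon> \<le> w \<epsilon> x)"
  then have "2 \<le> 2 / \<epsilon>" by (auto simp: field_simps)
  with * show "\<epsilon> \<in> {0<..1} \<and> (\<forall>x\<in>D. 2 / \<epsilon> \<le> w \<epsilon> x \<and> 2 \<le> w \<epsilon> x)" by force
qed

lemma controlled_cong:
  assumes "controlled F D w u" "\<And>\<epsilon>. \<epsilon> \<in> {0<..1} \<Longrightarrow> u \<epsilon> = v \<epsilon>"
  shows "controlled F D w v"
proof -
  obtain k where "\<forall>\<^sub>F \<epsilon> in F. \<forall>x\<in>D. norm (u \<epsilon> x) \<le> w \<epsilon> x ^ k"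
    using assms(1) unfolding controlled_def by blast
  with eventually_weight have "\<forall>\<^sub>F \<epsilon> in F. \<forall>x\<in>D. norm (v \<epsilon> x) \<le> w \<epsilon> x ^ k"
    by eventually_elim (use assms(2) in auto)
  moreover have "\<forall>\<epsilon>\<in>{0<..1}. \<forall>x. v \<epsilon> differentiable (at x)"
    using assms by (auto simp: controlled_def)
  ultimately show ?thesis unfolding controlled_def by blast
qed

lemma tempered_upto_cong:
  assumes "tempered_upto n F D w u" "\<And>\<epsilon>. \<epsilon> \<in> {0<..1} \<Longrightarrow> u \<epsilon> = v \<epsilon>"
  shows "tempered_upto n F D w v"
  unfolding tempered_upto_iff
proof (intro ballI impI)
  fix vs :: "'a list" assume "vs \<in> lists Basis" "length vs \<le> n"
  with assms(1) have "controlled F D w (\<lambda>\<epsilon>. pderivs vs (u \<epsilon>))" by (auto simp: tempered_upto_iff)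
  then show "controlled F D w (\<lambda>\<epsilon>. pderivs vs (v \<epsilon>))"
    by (rule controlled_cong) (simp add: assms(2))
qed

lemma tempered_cong:
  assumes "tempered F D w u" "\<And>\<epsilon>. \<epsilon> \<in> {0<..1} \<Longrightarrow> u \<epsilon> = v \<epsilon>"
  shows "tempered F D w v"
  using assms tempered_upto_cong unfolding tempered_iff_upto by blast

lemma controlled_bound:
  assumes "\<And>\<epsilon> x. \<epsilon> \<in> {0<..1} \<Longrightarrow> u \<epsilon> differentiable (at x)"
    and "\<forall>\<^sub>F \<epsilon> in F. \<forall>x\<in>D. norm (u \<epsilon> x) \<le> C * w \<epsilon> x ^ k"
  shows "controlled F D w u"
proof -
  obtain m where m: "\<And>w::real. 2 \<le> w \<Longrightarrow> C * w powr (real k) \<le> w ^ m"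
    using powr_le_power[of C "real k"] by blast
  have "\<forall>\<^sub>F \<epsilon> in F. \<forall>x\<in>D. norm (u \<epsilon> x) \<le> w \<epsilon> x ^ m"
    using eventually_weight assms(2)
  proof eventually_elim
    case (elim \<epsilon>)
    show ?case
    proof
      fix x assume x: "x \<in> D"
      with elim have "norm (u \<epsilon> x) \<le> C * w \<epsilon> x ^ k" "2 \<le> w \<epsilon> x" by auto
      with m[of "w \<epsilon> x"] show "norm (u \<epsilon> x) \<le> w \<epsilon> x ^ m" by (simp add: powr_realpow)
    qed
  qed
  with assms(1) show ?thesis unfolding controlled_def by blast
qed

lemma controlled_add:
  assumes f: "controlled F D w f" and g: "controlled F D w g"
  shows "controlled F D w (\<lambda>\<epsilon> x. f \<epsilon> x + g \<epsilon> x)"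
proof -
  obtain k l where "\<forall>\<^sub>F \<epsilon> in F. \<forall>x\<in>D. norm (f \<epsilon> x) \<le> w \<epsilon> x ^ k"
    "\<forall>\<^sub>F \<epsilon> in F. \<forall>x\<in>D. norm (g \<epsilon> x) \<le> w \<epsilon> x ^ l"
    using f g unfolding controlled_def by blast
  with eventually_weight have "\<forall>\<^sub>F \<epsilon> in F. \<forall>x\<in>D. norm (f \<epsilon> x + g \<epsilon> x) \<le> 2 * w \<epsilon> x ^ (k + l)"
  proof eventually_elim
    case (elim \<epsilon>)
    show ?case
    proof
      fix x assume x: "x \<in> D"
      with elim have "2 \<le> w \<epsilon> x" by auto
      then have "w \<epsilon> x ^ k \<le> w \<epsilon> x ^ (k + l)" "w \<epsilon> x ^ l \<le> w \<epsilon> x ^ (k + l)"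
        by (auto intro!: power_increasing)
      moreover have "norm (f \<epsilon> x) \<le> w \<epsilon> x ^ k" "norm (g \<epsilon> x) \<le> w \<epsilon> x ^ l" using elim x by auto
      ultimately show "norm (f \<epsilon> x + g \<epsilon> x) \<le> 2 * w \<epsilon> x ^ (k + l)"
        using norm_triangle_ineq[of "f \<epsilon> x" "g \<epsilon> x"] by linarith
    qed
  qed
  then show ?thesis
    by (rule controlled_bound[rotated]) (use f g in \<open>auto simp: controlled_def\<close>)
qed

lemma controlled_scaleR:
  assumes f: "controlled F D w f" and g: "controlled F D w g"
  shows "controlled F D w (\<lambda>\<epsilon> x. f \<epsilon> x *\<^sub>R g \<epsilon> x)"
proof -
  obtain k l where "\<forall>\<^sub>F \<epsilon> in F. \<forall>x\<in>D. norm (f \<epsilon> x) \<le> w \<epsilon> x ^ k"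
    "\<forall>\<^sub>F \<epsilon> in F. \<forall>x\<in>D. norm (g \<epsilon> x) \<le> w \<epsilon> x ^ l"
    using f g unfolding controlled_def by blast
  with eventually_weight have "\<forall>\<^sub>F \<epsilon> in F. \<forall>x\<in>D. norm (f \<epsilon> x *\<^sub>R g \<epsilon> x) \<le> 1 * w \<epsilon> x ^ (k + l)"
    by eventually_elim (force simp: power_add intro!: mult_mono)
  then show ?thesis
    by (rule controlled_bound[rotated])
      (use f g in \<open>auto simp: controlled_def intro!: differentiable_scaleR\<close>)
qed

lemma controlled_linear:
  assumes f: "controlled F D w f" and L: "bounded_linear L"
  shows "controlled F D w (\<lambda>\<epsilon> x. L (f \<epsilon> x))"
proof -
  obtain k where "\<forall>\<^sub>F \<epsilon> in F. \<forall>x\<in>D. norm (f \<epsilon> x) \<le> w \<epsilon> x ^ k"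
    using f unfolding controlled_def by blast
  moreover obtain B where B: "B > 0" "\<And>y. norm (L y) \<le> B * norm y"
    using bounded_linear.pos_bounded[OF L] by (metis mult.commute)
  ultimately have "\<forall>\<^sub>F \<epsilon> in F. \<forall>x\<in>D. norm (L (f \<epsilon> x)) \<le> B * w \<epsilon> x ^ k"
    by (auto elim!: eventually_mono) (meson B mult_left_mono order_trans less_imp_le)
  then show ?thesis
  proof (rule controlled_bound[rotated])
    fix \<epsilon> :: real and x assume "\<epsilon> \<in> {0<..1}"
    then have "(\<lambda>x. f \<epsilon> x) differentiable (at x)" using f by (auto simp: controlled_def)
    then show "(\<lambda>x. L (f \<epsilon> x)) differentiable (at x)"
      unfolding differentiable_def using bounded_linear.has_derivative[OF L] by blast
  qed
qed

lemma tempered_upto_linear: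
  assumes "tempered_upto n F D w f" and L: "bounded_linear L"
  shows "tempered_upto n F D w (\<lambda>\<epsilon> x. L (f \<epsilon> x))"
  using assms(1)
proof (induction n arbitrary: f)
  case 0
  then show ?case by (simp add: controlled_linear L)
next
  case (Suc n)
  have c: "controlled F D w f" using Suc.prems by simp
  have "tempered_upto n F D w (\<lambda>\<epsilon>. pderivs [v] (\<lambda>x. L (f \<epsilon> x)))" if v: "v \<in> Basis" for v
  proof -
    have "tempered_upto n F D w (\<lambda>\<epsilon> x. L (pderivs [v] (f \<epsilon>) x))"
      using Suc v by simp
    then show ?thesis
    proof (rule tempered_upto_cong)
      fix \<epsilon> :: real assume "\<epsilon> \<in> {0<..1}"
      show "(\<lambda>x. L (pderivs [v] (f \<epsilon>) x)) = pderivs [v] (\<lambda>x. L (f \<epsilon> x))"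
        by (rule pderiv_linear[OF controlled_differentiable[OF c \<open>\<epsilon> \<in> {0<..1}\<close>] L, symmetric])
    qed
  qed
  then show ?case using controlled_linear[OF c L] by simp
qed

lemma tempered_upto_add:
  assumes "tempered_upto n F D w f" "tempered_upto n F D w g"
  shows "tempered_upto n F D w (\<lambda>\<epsilon> x. f \<epsilon> x + g \<epsilon> x)"
  using assms
proof (induction n arbitrary: f g)
  case 0
  then show ?case by (simp add: controlled_add)
next
  case (Suc n)
  have c: "controlled F D w f" "controlled F D w g" using Suc.prems by simp_all
  have "tempered_upto n F D w (\<lambda>\<epsilon>. pderivs [v] (\<lambda>x. f \<epsilon> x + g \<epsilon> x))" if v: "v \<in> Basis" for v
  proof -
    have "tempered_upto n F D w (\<lambda>\<epsilon> x. pderivs [v] (f \<epsilon>) x + pderivs [v] (g \<epsilon>) x)"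
      using Suc v by simp
    then show ?thesis
    proof (rule tempered_upto_cong)
      fix \<epsilon> :: real assume e: "\<epsilon> \<in> {0<..1}"
      show "(\<lambda>x. pderivs [v] (f \<epsilon>) x + pderivs [v] (g \<epsilon>) x) = pderivs [v] (\<lambda>x. f \<epsilon> x + g \<epsilon> x)"
        by (rule pderiv_add[OF c[THEN controlled_differentiable, OF e], symmetric])
    qed
  qed
  then show ?case using controlled_add[OF c] by simp
qed

lemma tempered_upto_scaleR:
  assumes "tempered_upto n F D w f" "tempered_upto n F D w g"
  shows "tempered_upto n F D w (\<lambda>\<epsilon> x. f \<epsilon> x *\<^sub>R g \<epsilon> x)"
  using assms
proof (induction n arbitrary: f g)
  case 0
  then show ?case by (simp add: controlled_scaleR)
next
  case (Suc n)
  have c: "controlled F D w f" "controlled F D w g" using Suc.prems by simp_all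
  have n: "tempered_upto n F D w f" "tempered_upto n F D w g"
    using Suc.prems by (auto intro: tempered_upto_Suc_weaken)
  have "tempered_upto n F D w (\<lambda>\<epsilon>. pderivs [v] (\<lambda>x. f \<epsilon> x *\<^sub>R g \<epsilon> x))" if v: "v \<in> Basis" for v
  proof -
    have "tempered_upto n F D w (\<lambda>\<epsilon> x. f \<epsilon> x *\<^sub>R pderivs [v] (g \<epsilon>) x + pderivs [v] (f \<epsilon>) x *\<^sub>R g \<epsilon> x)"
      by (intro tempered_upto_add Suc.IH n) (use Suc.prems v in auto)
    then show ?thesis
    proof (rule tempered_upto_cong)
      fix \<epsilon> :: real assume e: "\<epsilon> \<in> {0<..1}"
      show "(\<lambda>x. f \<epsilon> x *\<^sub>R pderivs [v] (g \<epsilon>) x + pderivs [v] (f \<epsilon>) x *\<^sub>R g \<epsilon> x) = pderivs [v] (\<lambda>x. f \<epsilon> x *\<^sub>R g \<epsilon> x)"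
        by (rule pderiv_scaleR[OF c[THEN controlled_differentiable, OF e], symmetric])
    qed
  qed
  then show ?case using controlled_scaleR[OF c] by simp
qed

lemma tempered_const:
  assumes "\<forall>\<^sub>F \<epsilon> in F. \<forall>x\<in>D. norm (c \<epsilon>) \<le> w \<epsilon> x ^ k"
  shows "tempered F D w (\<lambda>\<epsilon> x. c \<epsilon>)"
  unfolding tempered_def
proof
  fix vs :: "'a list" assume "vs \<in> lists Basis"
  show "controlled F D w (\<lambda>\<epsilon>. pderivs vs (\<lambda>x. c \<epsilon>))"
  proof (cases "vs = []")
    case True
    then show ?thesis using assms by (auto simp: controlled_def)
  next
    case False
    have "\<forall>\<^sub>F \<epsilon> in F. \<forall>x\<in>D. norm (0::'b) \<le> 0 * w \<epsilon> x ^ 0" by simp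
    then have "controlled F D w (\<lambda>\<epsilon> x. 0::'b)"
      by (rule controlled_bound[rotated]) auto
    then show ?thesis by (simp add: pderivs_const[OF False])
  qed
qed

lemma tempered_fixed: "tempered F D w (\<lambda>\<epsilon> x. c)"
proof -
  obtain k where k: "\<And>w::real. 2 \<le> w \<Longrightarrow> norm c * w powr 0 \<le> w ^ k"
    using powr_le_power[of "norm c" 0] by blast
  have "\<forall>\<^sub>F \<epsilon> in F. \<forall>x\<in>D. norm c \<le> w \<epsilon> x ^ k"
    using eventually_weight by eventually_elim (use k in force)
  then show ?thesis by (rule tempered_const)
qed

lemma tempered_ident:
  assumes "\<forall>\<^sub>F \<epsilon> in F. \<forall>x\<in>D. norm x \<le> w \<epsilon> x ^ k"
  shows "tempered F D w (\<lambda>\<epsilon> x. x)"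
  unfolding tempered_iff_upto
proof
  have c: "controlled F D w (\<lambda>\<epsilon> x. x)" using assms by (auto simp: controlled_def)
  fix n show "tempered_upto n F D w (\<lambda>\<epsilon> x. x)"
  proof (cases n)
    case (Suc m)
    have "tempered_upto m F D w (\<lambda>\<epsilon>. pderivs [v] (\<lambda>x. x))" for v
      using tempered_fixed[of v] by (simp add: tempered_iff_upto)
    then show ?thesis using c Suc by simp
  qed (use c in simp)
qed

lemma tempered_add:
  "tempered F D w f \<Longrightarrow> tempered F D w g \<Longrightarrow> tempered F D w (\<lambda>\<epsilon> x. f \<epsilon> x + g \<epsilon> x)"
  by (simp add: tempered_iff_upto tempered_upto_add)

lemma tempered_scaleR:
  "tempered F D w f \<Longrightarrow> tempered F D w g \<Longrightarrow> tempered F D w (\<lambda>\<epsilon> x. f \<epsilon> x *\<^sub>R g \<epsilon> x)"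
  by (simp add: tempered_iff_upto tempered_upto_scaleR)

lemma tempered_linear:
  "tempered F D w f \<Longrightarrow> bounded_linear L \<Longrightarrow> tempered F D w (\<lambda>\<epsilon> x. L (f \<epsilon> x))"
  by (simp add: tempered_iff_upto tempered_upto_linear)

lemma tempered_upto_sum:
  assumes "finite A" "\<And>a. a \<in> A \<Longrightarrow> tempered_upto n F D w (f a)"
  shows "tempered_upto n F D w (\<lambda>\<epsilon> x. \<Sum>a\<in>A. f a \<epsilon> x)"
  using assms
proof (induction rule: finite_induct)
  case empty
  then show ?case by (simp add: tempered_fixed[unfolded tempered_iff_upto])
qed (simp add: tempered_upto_add)

lemma tempered_sum:
  "finite A \<Longrightarrow> (\<And>a. a \<in> A \<Longrightarrow> tempered F D w (f a)) \<Longrightarrow> tempered F D w (\<lambda>\<epsilon> x. \<Sum>a\<in>A. f a \<epsilon> x)"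
  by (simp add: tempered_iff_upto tempered_upto_sum)

lemma tempered_diff:
  "tempered F D w f \<Longrightarrow> tempered F D w g \<Longrightarrow> tempered F D w (\<lambda>\<epsilon> x. f \<epsilon> x - g \<epsilon> x)"
  using tempered_add[of f "\<lambda>\<epsilon> x. - g \<epsilon> x"] tempered_linear[of g uminus]
  by (simp add: bounded_linear_minus bounded_linear_ident)

lemma tempered_Pair:
  assumes "tempered F D w f" "tempered F D w g"
  shows "tempered F D w (\<lambda>\<epsilon> x. (f \<epsilon> x, g \<epsilon> x))"
proof -
  have "bounded_linear (\<lambda>y::'b. (y, 0::'c))" "bounded_linear (\<lambda>y::'c. (0::'b, y))"
    by (auto intro!: bounded_linear_Pair bounded_linear_ident bounded_linear_zero)
  from tempered_add[OF tempered_linear[OF assms(1) this(1)] tempered_linear[OF assms(2) this(2)]]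
  show ?thesis by simp
qed

text \<open>
  The weight of an inner value has to be bounded by a power of the weight of the argument; bounds by
  powers of \<open>w'\<close> then become bounds by powers of \<open>w\<close>.
\<close>
lemma controlled_compose:
  fixes g :: "('a \<Rightarrow> 'c::euclidean_space) net"
  assumes f: "controlled F D' w' f" and g: "controlled F D w g"
    and sub: "\<forall>\<^sub>F \<epsilon> in F. \<forall>x\<in>D. g \<epsilon> x \<in> D' \<and> 0 \<le> w' \<epsilon> (g \<epsilon> x) \<and> w' \<epsilon> (g \<epsilon> x) \<le> w \<epsilon> x ^ m"
  shows "controlled F D w (\<lambda>\<epsilon> x. f \<epsilon> (g \<epsilon> x))"
proof -
  obtain k where "\<forall>\<^sub>F \<epsilon> in F. \<forall>x\<in>D'. norm (f \<epsilon> x) \<le> w' \<epsilon> x ^ k"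
    using f unfolding controlled_def by blast
  with sub have "\<forall>\<^sub>F \<epsilon> in F. \<forall>x\<in>D. norm (f \<epsilon> (g \<epsilon> x)) \<le> 1 * w \<epsilon> x ^ (m * k)"
  proof eventually_elim
    case (elim \<epsilon>)
    show ?case
    proof
      fix x assume x: "x \<in> D"
      have "norm (f \<epsilon> (g \<epsilon> x)) \<le> w' \<epsilon> (g \<epsilon> x) ^ k" using elim x by auto
      also have "\<dots> \<le> (w \<epsilon> x ^ m) ^ k" using elim x by (intro power_mono) auto
      finally show "norm (f \<epsilon> (g \<epsilon> x)) \<le> 1 * w \<epsilon> x ^ (m * k)" by (simp add: power_mult)
    qed
  qed
  then show ?thesis
  proof (rule controlled_bound[rotated])
    fix \<epsilon> :: real and x assume "\<epsilon> \<in> {0<..1}"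
    then show "(\<lambda>x. f \<epsilon> (g \<epsilon> x)) differentiable (at x)"
      using f g differentiable_chain_at[of "g \<epsilon>" x "f \<epsilon>"]
      by (auto simp: controlled_def o_def)
  qed
qed

lemma tempered_upto_compose:
  fixes g :: "('a \<Rightarrow> 'c::euclidean_space) net"
  assumes "tempered_upto n F D' w' f" "tempered_upto n F D w g"
    and sub: "\<forall>\<^sub>F \<epsilon> in F. \<forall>x\<in>D. g \<epsilon> x \<in> D' \<and> 0 \<le> w' \<epsilon> (g \<epsilon> x) \<and> w' \<epsilon> (g \<epsilon> x) \<le> w \<epsilon> x ^ m"
  shows "tempered_upto n F D w (\<lambda>\<epsilon> x. f \<epsilon> (g \<epsilon> x))"
  using assms(1,2)
proof (induction n arbitrary: f)
  case 0
  then show ?case using controlled_compose[OF _ _ sub] by simp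
next
  case (Suc n)
  have c: "controlled F D' w' f" "controlled F D w g" using Suc.prems by simp_all
  have g: "tempered_upto n F D w g"
    using Suc.prems by (auto intro: tempered_upto_Suc_weaken)
  have "tempered_upto n F D w (\<lambda>\<epsilon>. pderivs [v] (\<lambda>x. f \<epsilon> (g \<epsilon> x)))" if v: "v \<in> Basis" for v
  proof -
    have "tempered_upto n F D w (\<lambda>\<epsilon> x. \<Sum>b\<in>Basis. (pderivs [v] (g \<epsilon>) x \<bullet> b) *\<^sub>R pderivs [b] (f \<epsilon>) (g \<epsilon> x))"
      by (intro tempered_upto_sum tempered_upto_scaleR tempered_upto_linear[OF _ bounded_linear_inner_left]
          Suc.IH g) (use Suc.prems v in auto)
    then show ?thesis
    proof (rule tempered_upto_cong)
      fix \<epsilon> :: real assume e: "\<epsilon> \<in> {0<..1}"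
      show "(\<lambda>x. \<Sum>b\<in>Basis. (pderivs [v] (g \<epsilon>) x \<bullet> b) *\<^sub>R pderivs [b] (f \<epsilon>) (g \<epsilon> x))
        = pderivs [v] (\<lambda>x. f \<epsilon> (g \<epsilon> x))"
        by (rule pderiv_compose[OF controlled_differentiable[OF c(2) e] controlled_differentiable[OF c(1) e], symmetric])
    qed
  qed
  then show ?case using controlled_compose[OF c sub] by simp
qed

lemma tempered_compose:
  assumes "tempered F D' w' f" "tempered F D w g"
    and "\<forall>\<^sub>F \<epsilon> in F. \<forall>x\<in>D. g \<epsilon> x \<in> D' \<and> 0 \<le> w' \<epsilon> (g \<epsilon> x) \<and> w' \<epsilon> (g \<epsilon> x) \<le> w \<epsilon> x ^ m"
  shows "tempered F D w (\<lambda>\<epsilon> x. f \<epsilon> (g \<epsilon> x))"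
  using assms by (simp add: tempered_iff_upto tempered_upto_compose[OF _ _ assms(3)])

end

section \<open>Tempered nets as growth bounds\<close>

text \<open>
  A power of this weight bounds the growth in \<open>1/\<epsilon>\<close> and in \<open>x\<close> at the same time.
\<close>
definition tau_weight :: "real \<Rightarrow> 'a::real_normed_vector \<Rightarrow> real" where
  "tau_weight \<epsilon> x = 2 * (1 + norm x) / \<epsilon>"

text \<open>
  A net in \<open>E_tau\<close> is bounded asymptotically for \<open>\<epsilon> \<rightarrow> 0\<close>, and in addition each member belongs to
  \<open>O_M\<close>. The second condition is a growth bound as well, for the principal filter of a single \<open>\<epsilon>\<close>.
  Treating all these filters alike gives both conditions in one argument.
\<close>
definition scale_filter :: "real filter \<Rightarrow> bool" where
  "scale_filter F \<longleftrightarrow> F = at_right 0 \<or> (\<exists>\<epsilon>\<in>{0<..1}. F = principal {\<epsilon>})"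

lemma eventually_unit_interval: "\<forall>\<^sub>F \<epsilon> in at_right (0::real). 0 < \<epsilon> \<and> \<epsilon> \<le> 1/2"
  using eventually_at_right_real[of 0 "1/2::real"] by (auto elim: eventually_mono)

lemma scale_filter_at_right [simp]: "scale_filter (at_right 0)"
  and scale_filter_principal [simp]: "\<epsilon> \<in> {0<..1} \<Longrightarrow> scale_filter (principal {\<epsilon>})"
  by (auto simp: scale_filter_def)

lemma scale_filter_eventually: "scale_filter F \<Longrightarrow> \<forall>\<^sub>F \<epsilon> in F. \<epsilon> \<in> {0<..1}"
  using eventually_unit_interval
  by (auto simp: scale_filter_def eventually_principal elim: eventually_mono)

lemma tau_weight_ge_norm: "\<epsilon> \<in> {0<..1} \<Longrightarrow> 1 + norm x \<le> tau_weight \<epsilon> x"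
proof -
  assume e: "\<epsilon> \<in> {0<..1}"
  then have "(1 + norm x) * \<epsilon> \<le> (1 + norm x) * 2" by (intro mult_left_mono) auto
  then show ?thesis using e by (simp add: tau_weight_def pos_le_divide_eq mult.commute)
qed

lemma tau_weight_ge_2:
  assumes "\<epsilon> \<in> {0<..1}"
  shows "2 \<le> tau_weight \<epsilon> x"
proof -
  have "\<epsilon> \<le> 1 + norm x" using assms by (auto intro: order_trans)
  then show ?thesis using assms by (simp add: tau_weight_def pos_le_divide_eq)
qed

lemma polynomial_bound_iff:
  fixes N :: "'a \<Rightarrow> real" and y :: "'a \<Rightarrow> 'b::real_normed_vector"
  assumes e: "\<epsilon> \<in> {0<..1}"
  shows "(\<exists>r C. \<forall>x\<in>D. N x \<le> C * (1 + norm (y x)) powr r) \<longleftrightarrow> (\<exists>k::nat. \<forall>x\<in>D. N x \<le> tau_weight \<epsilon> (y x) ^ k)"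
proof
  assume "\<exists>r C. \<forall>x\<in>D. N x \<le> C * (1 + norm (y x)) powr r"
  then obtain r C where *: "\<And>x. x \<in> D \<Longrightarrow> N x \<le> C * (1 + norm (y x)) powr r" by blast
  obtain m where m: "\<And>w::real. 2 \<le> w \<Longrightarrow> \<bar>C\<bar> * w powr \<bar>r\<bar> \<le> w ^ m"
    using powr_le_power[of "\<bar>C\<bar>" "\<bar>r\<bar>"] by blast
  have "N x \<le> tau_weight \<epsilon> (y x) ^ m" if "x \<in> D" for x
  proof -
    have "N x \<le> \<bar>C\<bar> * (1 + norm (y x)) powr r"
      by (rule order_trans[OF *[OF that]]) (intro mult_right_mono, auto)
    also have "\<dots> \<le> \<bar>C\<bar> * (1 + norm (y x)) powr \<bar>r\<bar>"
      by (intro mult_left_mono powr_mono) auto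
    also have "\<dots> \<le> \<bar>C\<bar> * tau_weight \<epsilon> (y x) powr \<bar>r\<bar>"
      using tau_weight_ge_norm[OF e, of "y x"] by (intro mult_left_mono powr_mono2) auto
    also have "\<dots> \<le> tau_weight \<epsilon> (y x) ^ m" by (rule m[OF tau_weight_ge_2[OF e]])
    finally show ?thesis .
  qed
  then show "\<exists>k. \<forall>x\<in>D. N x \<le> tau_weight \<epsilon> (y x) ^ k" by blast
next
  assume "\<exists>k. \<forall>x\<in>D. N x \<le> tau_weight \<epsilon> (y x) ^ k"
  then obtain k where "\<And>x. x \<in> D \<Longrightarrow> N x \<le> tau_weight \<epsilon> (y x) ^ k" by blast
  moreover have "tau_weight \<epsilon> (y x) ^ k = (2 / \<epsilon>) ^ k * (1 + norm (y x)) powr (real k)" for x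
    by (subst powr_realpow) (simp_all add: tau_weight_def add_pos_nonneg flip: power_mult_distrib)
  ultimately have "\<forall>x\<in>D. N x \<le> (2 / \<epsilon>) ^ k * (1 + norm (y x)) powr (real k)" by simp
  then show "\<exists>r C. \<forall>x\<in>D. N x \<le> C * (1 + norm (y x)) powr r" by blast
qed

lemma moderate_bound_iff:
  fixes N :: "real \<Rightarrow> 'a \<Rightarrow> real" and y :: "'a \<Rightarrow> 'b::real_normed_vector"
  shows "(\<exists>r>0. \<exists>C. \<forall>\<^sub>F \<epsilon> in at_right 0. \<forall>x\<in>D. N \<epsilon> x \<le> C * \<epsilon> powr (-r) * (1 + norm (y x)) powr r) \<longleftrightarrow>
    (\<exists>k::nat. \<forall>\<^sub>F \<epsilon> in at_right 0. \<forall>x\<in>D. N \<epsilon> x \<le> tau_weight \<epsilon> (y x) ^ k)"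
proof
  assume "\<exists>r>0. \<exists>C. \<forall>\<^sub>F \<epsilon> in at_right 0. \<forall>x\<in>D. N \<epsilon> x \<le> C * \<epsilon> powr (-r) * (1 + norm (y x)) powr r"
  then obtain r C where r: "r > 0" and
    *: "\<forall>\<^sub>F \<epsilon> in at_right 0. \<forall>x\<in>D. N \<epsilon> x \<le> C * \<epsilon> powr (-r) * (1 + norm (y x)) powr r" by blast
  obtain m where m: "\<And>w::real. 2 \<le> w \<Longrightarrow> \<bar>C\<bar> * w powr r \<le> w ^ m"
    using powr_le_power[of "\<bar>C\<bar>" r] by blast
  have "\<forall>\<^sub>F \<epsilon> in at_right 0. \<forall>x\<in>D. N \<epsilon> x \<le> tau_weight \<epsilon> (y x) ^ m"
    using * eventually_unit_interval
  proof eventually_elim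
    case (elim \<epsilon>)
    then have e: "\<epsilon> \<in> {0<..1}" by auto
    show ?case
    proof
      fix x assume x: "x \<in> D"
      have "N \<epsilon> x \<le> C * (\<epsilon> powr (-r) * (1 + norm (y x)) powr r)" using elim x by (simp add: mult.assoc)
      also have "\<dots> \<le> \<bar>C\<bar> * (\<epsilon> powr (-r) * (1 + norm (y x)) powr r)"
        by (intro mult_right_mono) auto
      also have "\<epsilon> powr (-r) * (1 + norm (y x)) powr r = ((1 + norm (y x)) / \<epsilon>) powr r"
        using e by (simp add: powr_divide powr_minus_divide)
      also have "\<bar>C\<bar> * \<dots> \<le> \<bar>C\<bar> * tau_weight \<epsilon> (y x) powr r"
        using e r by (intro mult_left_mono powr_mono2) (auto simp: tau_weight_def intro!: divide_right_mono)
      also have "\<dots> \<le> tau_weight \<epsilon> (y x) ^ m" by (rule m[OF tau_weight_ge_2[OF e]])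
      finally show "N \<epsilon> x \<le> tau_weight \<epsilon> (y x) ^ m" .
    qed
  qed
  then show "\<exists>k::nat. \<forall>\<^sub>F \<epsilon> in at_right 0. \<forall>x\<in>D. N \<epsilon> x \<le> tau_weight \<epsilon> (y x) ^ k" by blast
next
  assume "\<exists>k::nat. \<forall>\<^sub>F \<epsilon> in at_right 0. \<forall>x\<in>D. N \<epsilon> x \<le> tau_weight \<epsilon> (y x) ^ k"
  then obtain k where "\<forall>\<^sub>F \<epsilon> in at_right 0. \<forall>x\<in>D. N \<epsilon> x \<le> tau_weight \<epsilon> (y x) ^ k" by blast
  with eventually_unit_interval have "\<forall>\<^sub>F \<epsilon> in at_right 0. \<forall>x\<in>D.
    N \<epsilon> x \<le> 2 ^ Suc k * \<epsilon> powr (- real (Suc k)) * (1 + norm (y x)) powr (real (Suc k))"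
  proof eventually_elim
    case (elim \<epsilon>)
    then have e: "\<epsilon> \<in> {0<..1}" by auto
    show ?case
    proof
      fix x assume x: "x \<in> D"
      have "N \<epsilon> x \<le> tau_weight \<epsilon> (y x) ^ k" using elim x by blast
      also have "\<dots> \<le> tau_weight \<epsilon> (y x) ^ Suc k"
        using tau_weight_ge_2[OF e, of "y x"] by (intro power_increasing) auto
      also have "\<dots> = 2 ^ Suc k * \<epsilon> powr (- real (Suc k)) * (1 + norm (y x)) powr (real (Suc k))"
      proof -
        have "\<epsilon> > 0" "1 + norm (y x) > 0" using e by (auto simp: add_pos_nonneg)
        then show ?thesis
          unfolding powr_minus powr_realpow[OF \<open>\<epsilon> > 0\<close>] powr_realpow[OF \<open>1 + norm (y x) > 0\<close>]
          by (simp only: tau_weight_def power_mult_distrib power_divide power_inverse divide_inverse mult_ac)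
      qed
      finally show "N \<epsilon> x \<le> 2 ^ Suc k * \<epsilon> powr (- real (Suc k)) * (1 + norm (y x)) powr (real (Suc k))" .
    qed
  qed
  then show "\<exists>r>0. \<exists>C. \<forall>\<^sub>F \<epsilon> in at_right 0. \<forall>x\<in>D. N \<epsilon> x \<le> C * \<epsilon> powr (-r) * (1 + norm (y x)) powr r"
    by - (rule exI[of _ "real (Suc k)"], rule conjI, simp, rule exI)
qed

lemma power_bound_iff:
  fixes N :: "real \<Rightarrow> 'a \<Rightarrow> real"
  shows "(\<exists>r C. \<forall>\<^sub>F \<epsilon> in at_right 0. \<forall>x\<in>D. N \<epsilon> x \<le> C * \<epsilon> powr (-r)) \<longleftrightarrow>
    (\<exists>k::nat. \<forall>\<^sub>F \<epsilon> in at_right 0. \<forall>x\<in>D. N \<epsilon> x \<le> (2 / \<epsilon>) ^ k)"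
proof
  assume "\<exists>r C. \<forall>\<^sub>F \<epsilon> in at_right 0. \<forall>x\<in>D. N \<epsilon> x \<le> C * \<epsilon> powr (-r)"
  then obtain r C where *: "\<forall>\<^sub>F \<epsilon> in at_right 0. \<forall>x\<in>D. N \<epsilon> x \<le> C * \<epsilon> powr (-r)" by blast
  obtain m where m: "\<And>w::real. 2 \<le> w \<Longrightarrow> \<bar>C\<bar> * w powr \<bar>r\<bar> \<le> w ^ m"
    using powr_le_power[of "\<bar>C\<bar>" "\<bar>r\<bar>"] by blast
  have "\<forall>\<^sub>F \<epsilon> in at_right 0. \<forall>x\<in>D. N \<epsilon> x \<le> (2 / \<epsilon>) ^ m"
    using * eventually_unit_interval
  proof eventually_elim
    case (elim \<epsilon>)
    show ?case
    proof
      fix x assume x: "x \<in> D"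
      have h: "1 \<le> 1 / \<epsilon>" "2 \<le> 2 / \<epsilon>" "1 / \<epsilon> \<le> 2 / \<epsilon>"
        using elim(2) by (simp_all add: pos_le_divide_eq divide_right_mono)
      have "N \<epsilon> x \<le> C * \<epsilon> powr (-r)" using elim x by blast
      also have "\<dots> \<le> \<bar>C\<bar> * \<epsilon> powr (-r)"
        by (intro mult_right_mono) auto
      also have "\<epsilon> powr (-r) = (1 / \<epsilon>) powr r"
        using elim by (simp add: powr_divide powr_minus_divide)
      also have "\<bar>C\<bar> * \<dots> \<le> \<bar>C\<bar> * (1 / \<epsilon>) powr \<bar>r\<bar>"
        using h by (intro mult_left_mono powr_mono) simp_all
      also have "\<dots> \<le> \<bar>C\<bar> * (2 / \<epsilon>) powr \<bar>r\<bar>"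
        using h elim(2) by (intro mult_left_mono powr_mono2) simp_all
      also have "\<dots> \<le> (2 / \<epsilon>) ^ m" by (rule m[OF h(2)])
      finally show "N \<epsilon> x \<le> (2 / \<epsilon>) ^ m" .
    qed
  qed
  then show "\<exists>k::nat. \<forall>\<^sub>F \<epsilon> in at_right 0. \<forall>x\<in>D. N \<epsilon> x \<le> (2 / \<epsilon>) ^ k" by blast
next
  assume "\<exists>k::nat. \<forall>\<^sub>F \<epsilon> in at_right 0. \<forall>x\<in>D. N \<epsilon> x \<le> (2 / \<epsilon>) ^ k"
  then obtain k where "\<forall>\<^sub>F \<epsilon> in at_right 0. \<forall>x\<in>D. N \<epsilon> x \<le> (2 / \<epsilon>) ^ k" by blast
  with eventually_unit_interval have "\<forall>\<^sub>F \<epsilon> in at_right 0. \<forall>x\<in>D. N \<epsilon> x \<le> 2 ^ k * \<epsilon> powr (- real k)"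
  proof eventually_elim
    case (elim \<epsilon>)
    then have "(2 / \<epsilon>) ^ k = 2 ^ k * \<epsilon> powr (- real k)"
      by (simp add: powr_minus_divide powr_realpow power_divide)
    with elim show ?case by simp
  qed
  then show "\<exists>r C. \<forall>\<^sub>F \<epsilon> in at_right 0. \<forall>x\<in>D. N \<epsilon> x \<le> C * \<epsilon> powr (-r)" by blast
qed

lemma all_scale_filter_iff:
  "(\<forall>F. scale_filter F \<longrightarrow> P F) \<longleftrightarrow> P (at_right 0) \<and> (\<forall>\<epsilon>\<in>{0<..1}. P (principal {\<epsilon>}))"
  by (auto simp: scale_filter_def)

lemma tempered_alt:
  "tempered F D w u \<longleftrightarrow> (\<forall>\<epsilon>\<in>{0<..1}. smooth (u \<epsilon>)) \<and>
     (\<forall>vs\<in>lists Basis. \<exists>k::nat. \<forall>\<^sub>F \<epsilon> in F. \<forall>x\<in>D. norm (pderivs vs (u \<epsilon>) x) \<le> w \<epsilon> x ^ k)"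
  unfolding tempered_def controlled_def smooth_def by blast

lemma O_M_iff_tempered:
  assumes "\<epsilon> \<in> {0<..1}"
  shows "u \<epsilon> \<in> O_M \<longleftrightarrow> smooth (u \<epsilon>) \<and>
    (\<forall>vs\<in>lists Basis. \<exists>k::nat. \<forall>\<^sub>F \<delta> in principal {\<epsilon>}. \<forall>x\<in>UNIV. norm (pderivs vs (u \<delta>) x) \<le> tau_weight \<delta> x ^ k)"
proof -
  have *: "(\<exists>r C. \<forall>x. norm (pderivs vs (u \<epsilon>) x) \<le> C * (1 + norm x) powr r) \<longleftrightarrow>
    (\<exists>k::nat. \<forall>\<^sub>F \<delta> in principal {\<epsilon>}. \<forall>x\<in>UNIV. norm (pderivs vs (u \<delta>) x) \<le> tau_weight \<delta> x ^ k)" for vs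
    using polynomial_bound_iff[OF assms, of UNIV "\<lambda>x. norm (pderivs vs (u \<epsilon>) x)" "\<lambda>x. x"]
    by (simp add: eventually_principal)
  show ?thesis unfolding O_M_def mem_Collect_eq * ..
qed

lemma E_tau_iff_tempered:
  "u \<in> E_tau \<longleftrightarrow> (\<forall>F. scale_filter F \<longrightarrow> tempered F UNIV tau_weight u)"
proof -
  have *: "(\<exists>r>0. \<exists>C. \<forall>\<^sub>F \<epsilon> in at_right 0. \<forall>x. norm (pderivs vs (u \<epsilon>) x) \<le> C * \<epsilon> powr (-r) * (1 + norm x) powr r)
    \<longleftrightarrow> (\<exists>k::nat. \<forall>\<^sub>F \<epsilon> in at_right 0. \<forall>x\<in>UNIV. norm (pderivs vs (u \<epsilon>) x) \<le> tau_weight \<epsilon> x ^ k)" for vs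
    using moderate_bound_iff[of UNIV "\<lambda>\<epsilon> x. norm (pderivs vs (u \<epsilon>) x)" "\<lambda>x. x"] by simp
  show ?thesis
    unfolding all_scale_filter_iff tempered_alt E_tau_def mem_Collect_eq *
    using O_M_iff_tempered[of _ u] by (smt (verit, del_insts))
qed

lemma O_M_loc_iff_tempered:
  assumes "\<epsilon> \<in> {0<..1}"
  shows "u \<epsilon> \<in> O_M_loc \<longleftrightarrow> smooth (u \<epsilon>) \<and>
    (\<forall>K. compact K \<longrightarrow> (\<forall>vs\<in>lists Basis. \<exists>k::nat. \<forall>\<^sub>F \<delta> in principal {\<epsilon>}. \<forall>p\<in>K \<times> UNIV.
       norm (pderivs vs (u \<delta>) p) \<le> tau_weight \<delta> (snd p) ^ k))"
proof -
  have *: "(\<exists>r C. \<forall>\<eta>\<in>K. \<forall>x. norm (pderivs vs (u \<epsilon>) (\<eta>, x)) \<le> C * (1 + norm x) powr r) \<longleftrightarrow>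
    (\<exists>k::nat. \<forall>\<^sub>F \<delta> in principal {\<epsilon>}. \<forall>p\<in>K \<times> UNIV. norm (pderivs vs (u \<delta>) p) \<le> tau_weight \<delta> (snd p) ^ k)" for vs K
    using polynomial_bound_iff[OF assms, of "K \<times> UNIV" "\<lambda>p. norm (pderivs vs (u \<epsilon>) p)" snd]
    by (simp add: eventually_principal)
  show ?thesis unfolding O_M_loc_def mem_Collect_eq * ..
qed

lemma E_tau_loc_iff_tempered:
  "u \<in> E_tau_loc \<longleftrightarrow>
    (\<forall>F. scale_filter F \<longrightarrow> (\<forall>K. compact K \<longrightarrow> tempered F (K \<times> UNIV) (\<lambda>\<epsilon> p. tau_weight \<epsilon> (snd p)) u))"
proof -
  have *: "(\<exists>r>0. \<exists>C. \<forall>\<^sub>F \<epsilon> in at_right 0. \<forall>\<eta>\<in>K. \<forall>x. norm (pderivs vs (u \<epsilon>) (\<eta>, x)) \<le> C * \<epsilon> powr (-r) * (1 + norm x) powr r)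
    \<longleftrightarrow> (\<exists>k::nat. \<forall>\<^sub>F \<epsilon> in at_right 0. \<forall>p\<in>K \<times> UNIV. norm (pderivs vs (u \<epsilon>) p) \<le> tau_weight \<epsilon> (snd p) ^ k)" for vs K
    using moderate_bound_iff[of "K \<times> UNIV" "\<lambda>\<epsilon> x. norm (pderivs vs (u \<epsilon>) x)" snd] by simp
  show ?thesis
    unfolding all_scale_filter_iff tempered_alt E_tau_loc_def mem_Collect_eq *
    using O_M_loc_iff_tempered[of _ u] compact_empty by (smt (verit, del_insts))
qed

lemma E_M_iff_tempered:
  "u \<in> E_M \<longleftrightarrow> (\<forall>K. compact K \<longrightarrow> tempered (at_right 0) K (\<lambda>\<epsilon> x. 2 / \<epsilon>) u)"
proof -
  have "S \<and> (\<forall>K::'a set. compact K \<longrightarrow> Q K) \<longleftrightarrow> (\<forall>K. compact K \<longrightarrow> S \<and> Q K)" for S Q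
    using compact_empty by blast
  then show ?thesis unfolding E_M_def mem_Collect_eq tempered_alt power_bound_iff .
qed

lemma E_tau_tempered: "u \<in> E_tau \<Longrightarrow> scale_filter F \<Longrightarrow> tempered F UNIV tau_weight u"
  by (simp add: E_tau_iff_tempered)

lemma admissible_tau_weight: "scale_filter F \<Longrightarrow> admissible F D tau_weight"
  using scale_filter_eventually[of F] unfolding admissible_def
  by (auto elim!: eventually_mono simp: tau_weight_def field_simps)

lemma admissible_const_weight: "scale_filter F \<Longrightarrow> admissible F D (\<lambda>\<epsilon> x. 2 / \<epsilon>)"
  using scale_filter_eventually[of F] unfolding admissible_def
  by (auto elim!: eventually_mono)

text \<open>
  A net bounded by a power of \<open>w\<close> takes values of which \<open>tau_weight\<close> is again bounded by a power of
  \<open>w\<close>, which is the condition for composing a tempered net with it.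
\<close>
lemma tau_weight_compose:
  fixes g :: "('a::euclidean_space \<Rightarrow> 'b::euclidean_space) net"
  assumes adm: "admissible F D w" and g: "controlled F D w g"
  obtains m where "\<forall>\<^sub>F \<epsilon> in F. \<forall>x\<in>D. 0 \<le> tau_weight \<epsilon> (g \<epsilon> x) \<and> tau_weight \<epsilon> (g \<epsilon> x) \<le> w \<epsilon> x ^ m"
proof -
  obtain k where "\<forall>\<^sub>F \<epsilon> in F. \<forall>x\<in>D. norm (g \<epsilon> x) \<le> w \<epsilon> x ^ k"
    using g unfolding controlled_def by blast
  with eventually_weight[OF adm]
  have "\<forall>\<^sub>F \<epsilon> in F. \<forall>x\<in>D. 0 \<le> tau_weight \<epsilon> (g \<epsilon> x) \<and> tau_weight \<epsilon> (g \<epsilon> x) \<le> w \<epsilon> x ^ (k + 2)"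
  proof eventually_elim
    case (elim \<epsilon>)
    show ?case
    proof
      fix x assume x: "x \<in> D"
      then have w: "2 \<le> w \<epsilon> x" "2 / \<epsilon> \<le> w \<epsilon> x" and n: "norm (g \<epsilon> x) \<le> w \<epsilon> x ^ k" and e: "\<epsilon> > 0"
        using elim by auto
      have "1 + norm (g \<epsilon> x) \<le> 2 * w \<epsilon> x ^ k" using n one_le_power[of "w \<epsilon> x" k] w by linarith
      also have "\<dots> \<le> w \<epsilon> x * w \<epsilon> x ^ k" using w by (intro mult_right_mono) auto
      finally have "(2 / \<epsilon>) * (1 + norm (g \<epsilon> x)) \<le> w \<epsilon> x * (w \<epsilon> x * w \<epsilon> x ^ k)"
        using w by (intro mult_mono) auto
      then show "0 \<le> tau_weight \<epsilon> (g \<epsilon> x) \<and> tau_weight \<epsilon> (g \<epsilon> x) \<le> w \<epsilon> x ^ (k + 2)"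
        using e by (simp add: tau_weight_def)
    qed
  qed
  then show thesis by (rule that)
qed

lemma E_tau_compose:
  assumes adm: "admissible F D w" and F: "scale_filter F" and u: "u \<in> E_tau" and g: "tempered F D w g"
  shows "tempered F D w (\<lambda>\<epsilon> x. u \<epsilon> (g \<epsilon> x))"
proof -
  obtain m where "\<forall>\<^sub>F \<epsilon> in F. \<forall>x\<in>D. 0 \<le> tau_weight \<epsilon> (g \<epsilon> x) \<and> tau_weight \<epsilon> (g \<epsilon> x) \<le> w \<epsilon> x ^ m"
    using tau_weight_compose[OF adm tempered_controlled[OF g]] by blast
  then show ?thesis
    using tempered_compose[OF adm E_tau_tempered[OF u F] g, of m] by simp
qed

lemma E_tau_loc_compose:
  assumes adm: "admissible F D w" and F: "scale_filter F" and u: "u \<in> E_tau_loc"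
    and \<eta>: "tempered F D w \<eta>" and g: "tempered F D w g"
    and K: "compact K" "\<forall>\<^sub>F \<epsilon> in F. \<forall>x\<in>D. \<eta> \<epsilon> x \<in> K"
  shows "tempered F D w (\<lambda>\<epsilon> x. u \<epsilon> (\<eta> \<epsilon> x, g \<epsilon> x))"
proof -
  obtain m where "\<forall>\<^sub>F \<epsilon> in F. \<forall>x\<in>D. 0 \<le> tau_weight \<epsilon> (g \<epsilon> x) \<and> tau_weight \<epsilon> (g \<epsilon> x) \<le> w \<epsilon> x ^ m"
    using tau_weight_compose[OF adm tempered_controlled[OF g]] by blast
  then have "\<forall>\<^sub>F \<epsilon> in F. \<forall>x\<in>D. (\<eta> \<epsilon> x, g \<epsilon> x) \<in> K \<times> UNIV \<and>
    0 \<le> tau_weight \<epsilon> (snd (\<eta> \<epsilon> x, g \<epsilon> x)) \<and> tau_weight \<epsilon> (snd (\<eta> \<epsilon> x, g \<epsilon> x)) \<le> w \<epsilon> x ^ m"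
    using K(2) by eventually_elim simp
  then show ?thesis
    using tempered_compose[OF adm _ tempered_Pair[OF adm \<eta> g], of "K \<times> UNIV" "\<lambda>\<epsilon> p. tau_weight \<epsilon> (snd p)" u m] u F K(1)
    by (simp add: E_tau_loc_iff_tempered)
qed

lemma tempered_tau_ident: "scale_filter F \<Longrightarrow> tempered F D tau_weight (\<lambda>\<epsilon> x. x)"
proof (rule tempered_ident[OF admissible_tau_weight])
  assume "scale_filter F"
  from scale_filter_eventually[OF this] show "\<forall>\<^sub>F \<epsilon> in F. \<forall>x\<in>D. norm x \<le> tau_weight \<epsilon> x ^ 1"
  proof eventually_elim
    case (elim \<epsilon>)
    have "norm x \<le> tau_weight \<epsilon> x" for x :: 'a using tau_weight_ge_norm[OF elim, of x] by linarith
    then show ?case by simp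
  qed
qed

lemma tempered_tau_bounded:
  assumes F: "scale_filter F" and "\<forall>\<^sub>F \<epsilon> in F. norm (\<eta> \<epsilon>) \<le> R"
  shows "tempered F D tau_weight (\<lambda>\<epsilon> x. \<eta> \<epsilon>)"
proof -
  obtain k where k: "\<And>w::real. 2 \<le> w \<Longrightarrow> R * w powr 0 \<le> w ^ k"
    using powr_le_power[of R 0] by blast
  have "\<forall>\<^sub>F \<epsilon> in F. \<forall>x\<in>D. norm (\<eta> \<epsilon>) \<le> tau_weight \<epsilon> x ^ k"
    using assms(2) scale_filter_eventually[OF F]
  proof eventually_elim
    case (elim \<epsilon>)
    show ?case
    proof
      fix x assume "x \<in> D"
      show "norm (\<eta> \<epsilon>) \<le> tau_weight \<epsilon> x ^ k"
        using k[OF tau_weight_ge_2[OF elim(2), of x]] elim(1) tau_weight_ge_2[OF elim(2), of x] by simp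
    qed
  qed
  then show ?thesis by (rule tempered_const[OF admissible_tau_weight[OF F]])
qed

lemma E_tau_smooth: "u \<in> E_tau \<Longrightarrow> \<epsilon> \<in> {0<..1} \<Longrightarrow> smooth (u \<epsilon>)"
  by (auto simp: E_tau_def O_M_def)

lemma E_tau_loc_smooth: "u \<in> E_tau_loc \<Longrightarrow> \<epsilon> \<in> {0<..1} \<Longrightarrow> smooth (u \<epsilon>)"
  by (auto simp: E_tau_loc_def O_M_loc_def)

lemma E_tau_pderivs: "u \<in> E_tau \<Longrightarrow> vs \<in> lists Basis \<Longrightarrow> (\<lambda>\<epsilon>. pderivs vs (u \<epsilon>)) \<in> E_tau"
  by (simp add: E_tau_iff_tempered tempered_pderivs)

lemma act_on_E_tau:
  fixes \<Xi> :: "(real \<times> 'x::euclidean_space \<Rightarrow> 'x) net" and \<Psi> :: "(real \<times> 'x \<times> 'u::euclidean_space \<Rightarrow> 'u) net"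
  assumes \<Xi>: "\<Xi> \<in> E_tau_loc" and \<Psi>: "\<Psi> \<in> E_tau_loc" and U: "U \<in> E_tau"
    and \<eta>: "\<forall>\<^sub>F \<epsilon> in at_right 0. \<bar>\<eta> \<epsilon>\<bar> \<le> R"
  shows "act_on \<Xi> \<Psi> \<eta> U \<in> E_tau"
  unfolding E_tau_iff_tempered act_on_def
proof (intro allI impI)
  fix F assume F: "scale_filter F"
  have "\<exists>R. \<forall>\<^sub>F \<epsilon> in F. \<bar>\<eta> \<epsilon>\<bar> \<le> R"
    using F \<eta> by (auto simp: scale_filter_def eventually_principal)
  then obtain S where S: "\<forall>\<^sub>F \<epsilon> in F. \<bar>\<eta> \<epsilon>\<bar> \<le> S" by blast
  note adm = admissible_tau_weight[OF F]
  have K: "\<forall>\<^sub>F \<epsilon> in F. \<forall>x\<in>UNIV. - \<eta> \<epsilon> \<in> cball 0 S" "\<forall>\<^sub>F \<epsilon> in F. \<forall>x\<in>UNIV. \<eta> \<epsilon> \<in> cball 0 S"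
    using S by auto
  have t: "tempered F UNIV tau_weight (\<lambda>\<epsilon> x::'x. \<eta> \<epsilon>)" "tempered F UNIV tau_weight (\<lambda>\<epsilon> x::'x. - \<eta> \<epsilon>)"
    by (rule tempered_tau_bounded[OF F, of _ S], use S in simp)+
  have \<Xi>': "tempered F UNIV tau_weight (\<lambda>\<epsilon> x. \<Xi> \<epsilon> (- \<eta> \<epsilon>, x))"
    by (rule E_tau_loc_compose[OF adm F \<Xi> t(2) tempered_tau_ident[OF F] compact_cball K(1)])
  show "tempered F UNIV tau_weight (\<lambda>\<epsilon> x. \<Psi> \<epsilon> (\<eta> \<epsilon>, \<Xi> \<epsilon> (- \<eta> \<epsilon>, x), U \<epsilon> (\<Xi> \<epsilon> (- \<eta> \<epsilon>, x))))"
    by (rule E_tau_loc_compose[OF adm F \<Psi> t(1) tempered_Pair[OF adm \<Xi>' E_tau_compose[OF adm F U \<Xi>']] compact_cball K(2)])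
qed

section \<open>Generalized points\<close>

lemma moderate_pt_iff_power: "moderate_pt r \<longleftrightarrow> (\<exists>k::nat. \<forall>\<^sub>F \<epsilon> in at_right 0. norm (r \<epsilon>) \<le> (2 / \<epsilon>) ^ k)"
proof
  assume "moderate_pt r"
  then obtain s where "\<forall>\<^sub>F \<epsilon> in at_right 0. norm (r \<epsilon>) \<le> \<epsilon> powr (-s)" unfolding moderate_pt_def by blast
  then have "\<exists>s C. \<forall>\<^sub>F \<epsilon> in at_right 0. \<forall>x\<in>{()}. norm (r \<epsilon>) \<le> C * \<epsilon> powr (-s)"
    by (intro exI[of _ s] exI[of _ 1]) simp
  then show "\<exists>k::nat. \<forall>\<^sub>F \<epsilon> in at_right 0. norm (r \<epsilon>) \<le> (2 / \<epsilon>) ^ k" unfolding power_bound_iff by simp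
next
  assume "\<exists>k::nat. \<forall>\<^sub>F \<epsilon> in at_right 0. norm (r \<epsilon>) \<le> (2 / \<epsilon>) ^ k"
  then obtain k where "\<forall>\<^sub>F \<epsilon> in at_right 0. norm (r \<epsilon>) \<le> (2 / \<epsilon>) ^ k" by blast
  with eventually_unit_interval have "\<forall>\<^sub>F \<epsilon> in at_right 0. norm (r \<epsilon>) \<le> \<epsilon> powr (- real (2 * k))"
  proof eventually_elim
    case (elim \<epsilon>)
    have "2 / \<epsilon> \<le> (1 / \<epsilon>)\<^sup>2" using elim(1) by (simp add: power2_eq_square field_simps)
    then have "(2 / \<epsilon>) ^ k \<le> ((1 / \<epsilon>)\<^sup>2) ^ k" using elim(1) by (intro power_mono) auto
    also have "\<dots> = \<epsilon> powr (- real (2 * k))"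
      using elim(1) by (simp only: powr_minus_divide powr_realpow) (simp add: power_mult power_divide)
    finally show ?case using elim(2) by simp
  qed
  then show "moderate_pt r" unfolding moderate_pt_def by blast
qed

text \<open>
  A point is a constant function. Moderateness of points obtained by composition and arithmetic is
  thereby a special case of the closure properties of tempered nets; the domain \<open>\<real>\<close> of the constant
  function is arbitrary.
\<close>
lemma moderate_pt_iff_tempered:
  "moderate_pt r \<longleftrightarrow> tempered (at_right 0) (UNIV :: real set) (\<lambda>\<epsilon> x. 2 / \<epsilon>) (\<lambda>\<epsilon> x. r \<epsilon>)"
proof
  assume "moderate_pt r"
  then show "tempered (at_right 0) (UNIV :: real set) (\<lambda>\<epsilon> x. 2 / \<epsilon>) (\<lambda>\<epsilon> x. r \<epsilon>)"
    unfolding moderate_pt_iff_power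
    by (auto intro!: tempered_const admissible_const_weight)
next
  assume "tempered (at_right 0) (UNIV :: real set) (\<lambda>\<epsilon> x. 2 / \<epsilon>) (\<lambda>\<epsilon> x. r \<epsilon>)"
  from tempered_controlled[OF this] show "moderate_pt r"
    by (auto simp: moderate_pt_iff_power controlled_def)
qed

lemma admissible_points: "admissible (at_right 0) (UNIV :: real set) (\<lambda>\<epsilon> x. 2 / \<epsilon>)"
  by (simp add: admissible_const_weight)

lemma moderate_pt_add: "moderate_pt r \<Longrightarrow> moderate_pt s \<Longrightarrow> moderate_pt (\<lambda>\<epsilon>. r \<epsilon> + s \<epsilon>)"
  by (simp add: moderate_pt_iff_tempered tempered_add[OF admissible_points])

lemma moderate_pt_Pair: "moderate_pt r \<Longrightarrow> moderate_pt s \<Longrightarrow> moderate_pt (\<lambda>\<epsilon>. (r \<epsilon>, s \<epsilon>))"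
  by (simp add: moderate_pt_iff_tempered tempered_Pair[OF admissible_points])

lemma moderate_pt_linear: "bounded_linear L \<Longrightarrow> moderate_pt r \<Longrightarrow> moderate_pt (\<lambda>\<epsilon>. L (r \<epsilon>))"
  unfolding moderate_pt_iff_tempered by (rule tempered_linear[OF admissible_points])

lemma E_tau_moderate:
  "u \<in> E_tau \<Longrightarrow> moderate_pt x \<Longrightarrow> moderate_pt (\<lambda>\<epsilon>. u \<epsilon> (x \<epsilon>))"
  unfolding moderate_pt_iff_tempered
  by (rule E_tau_compose[OF admissible_points scale_filter_at_right])

lemma moderate_pt_bounded: "\<forall>\<^sub>F \<epsilon> in at_right 0. norm (r \<epsilon>) \<le> R \<Longrightarrow> moderate_pt r"
proof -
  assume *: "\<forall>\<^sub>F \<epsilon> in at_right 0. norm (r \<epsilon>) \<le> R"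
  have "\<exists>s C. \<forall>\<^sub>F \<epsilon> in at_right 0. \<forall>x\<in>{()}. norm (r \<epsilon>) \<le> C * \<epsilon> powr (-s)"
    using * eventually_unit_interval
    by (intro exI[of _ 0] exI[of _ R]) (auto elim: eventually_elim2)
  then show ?thesis unfolding power_bound_iff by (simp add: moderate_pt_iff_power)
qed

lemma E_tau_loc_moderate:
  assumes "u \<in> E_tau_loc" "moderate_pt x" "\<forall>\<^sub>F \<epsilon> in at_right 0. norm (\<eta> \<epsilon>) \<le> R"
  shows "moderate_pt (\<lambda>\<epsilon>. u \<epsilon> (\<eta> \<epsilon>, x \<epsilon>))"
  using assms(2) moderate_pt_bounded[OF assms(3)] unfolding moderate_pt_iff_tempered
  by (intro E_tau_loc_compose[OF admissible_points scale_filter_at_right assms(1) _ _ compact_cball[of 0 R]])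
     (use assms(3) in auto)

lemma power_nat_ceiling_le:
  fixes \<epsilon> s :: real
  assumes "0 < \<epsilon>" "\<epsilon> \<le> 1"
  shows "\<epsilon> ^ nat \<lceil>s\<rceil> \<le> \<epsilon> powr s"
proof -
  have "\<epsilon> powr real (nat \<lceil>s\<rceil>) \<le> \<epsilon> powr s" using assms by (intro powr_mono') (linarith | simp)+
  then show ?thesis using assms(1) by (simp add: powr_realpow)
qed

lemma null_pt_iff_power: "null_pt r \<longleftrightarrow> (\<forall>k::nat. \<forall>\<^sub>F \<epsilon> in at_right 0. norm (r \<epsilon>) \<le> \<epsilon> ^ k)"
proof
  assume n: "null_pt r"
  show "\<forall>k::nat. \<forall>\<^sub>F \<epsilon> in at_right 0. norm (r \<epsilon>) \<le> \<epsilon> ^ k"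
  proof
    fix k :: nat
    obtain C where C: "\<forall>\<^sub>F \<epsilon> in at_right 0. norm (r \<epsilon>) \<le> C * \<epsilon> powr (real (Suc k))"
      using n unfolding null_pt_def by blast
    have "\<forall>\<^sub>F \<epsilon> in at_right 0. \<epsilon> \<in> {0<..<1 / (\<bar>C\<bar> + 1)}"
      by (rule eventually_at_right_real) (auto intro: add_nonneg_pos)
    with C show "\<forall>\<^sub>F \<epsilon> in at_right 0. norm (r \<epsilon>) \<le> \<epsilon> ^ k"
    proof eventually_elim
      case (elim \<epsilon>)
      then have e: "0 < \<epsilon>" "\<epsilon> * (\<bar>C\<bar> + 1) < 1" by (auto simp: pos_less_divide_eq)
      have "C * \<epsilon> \<le> \<epsilon> * (\<bar>C\<bar> + 1)" using e(1) by (subst mult.commute, intro mult_left_mono) auto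
      with e have "C * \<epsilon> \<le> 1" by linarith
      then have "C * \<epsilon> * \<epsilon> ^ k \<le> 1 * \<epsilon> ^ k" using e by (intro mult_right_mono) auto
      moreover have "\<epsilon> powr (real (Suc k)) = \<epsilon> * \<epsilon> ^ k" by (subst powr_realpow[OF e(1)]) simp
      ultimately show ?case using elim(1) by (simp add: mult.assoc)
    qed
  qed
next
  assume *: "\<forall>k::nat. \<forall>\<^sub>F \<epsilon> in at_right 0. norm (r \<epsilon>) \<le> \<epsilon> ^ k"
  show "null_pt r" unfolding null_pt_def
  proof
    fix s :: real
    from *[rule_format, of "nat \<lceil>s\<rceil>"] eventually_unit_interval
    have "\<forall>\<^sub>F \<epsilon> in at_right 0. norm (r \<epsilon>) \<le> 1 * \<epsilon> powr s"
    proof eventually_elim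
      case (elim \<epsilon>)
      then have "\<epsilon> ^ nat \<lceil>s\<rceil> \<le> \<epsilon> powr s" by (intro power_nat_ceiling_le) auto
      then show ?case using elim(1) by simp
    qed
    then show "\<exists>C. \<forall>\<^sub>F \<epsilon> in at_right 0. norm (r \<epsilon>) \<le> C * \<epsilon> powr s" by blast
  qed
qed

lemma null_pt_cong: "null_pt r \<Longrightarrow> \<forall>\<^sub>F \<epsilon> in at_right 0. norm (s \<epsilon>) \<le> norm (r \<epsilon>) \<Longrightarrow> null_pt s"
  unfolding null_pt_iff_power by (blast intro: eventually_elim2 order_trans)

lemma null_pt_zero: "null_pt (\<lambda>\<epsilon>. 0)"
  unfolding null_pt_iff_power using eventually_unit_interval by (auto elim!: eventually_mono)

lemma null_pt_scale:
  assumes a: "moderate_pt a" and r: "null_pt r" and "\<forall>\<^sub>F \<epsilon> in at_right 0. norm (s \<epsilon>) \<le> norm (a \<epsilon>) * norm (r \<epsilon>)"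
  shows "null_pt s"
  unfolding null_pt_iff_power
proof
  fix k :: nat
  obtain m where m: "\<forall>\<^sub>F \<epsilon> in at_right 0. norm (a \<epsilon>) \<le> (2 / \<epsilon>) ^ m" using a by (auto simp: moderate_pt_iff_power)
  have "\<forall>\<^sub>F \<epsilon> in at_right 0. norm (r \<epsilon>) \<le> \<epsilon> ^ (2 * m + k)" using r by (simp add: null_pt_iff_power)
  with m assms(3) eventually_unit_interval show "\<forall>\<^sub>F \<epsilon> in at_right 0. norm (s \<epsilon>) \<le> \<epsilon> ^ k"
  proof eventually_elim
    case (elim \<epsilon>)
    have "norm (s \<epsilon>) \<le> (2 / \<epsilon>) ^ m * \<epsilon> ^ (2 * m + k)"
      using elim by (intro order_trans[OF elim(2)] mult_mono) auto
    also have "\<dots> = (2 / \<epsilon> * \<epsilon> ^ 2) ^ m * \<epsilon> ^ k"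
      by (simp only: power_mult_distrib power_add power_mult mult.assoc)
    also have "2 / \<epsilon> * \<epsilon> ^ 2 = 2 * \<epsilon>" using elim(3) by (simp add: power2_eq_square)
    also have "(2 * \<epsilon>) ^ m * \<epsilon> ^ k \<le> 1 * \<epsilon> ^ k"
      using elim(3) by (intro mult_right_mono power_le_one) auto
    finally show ?case by simp
  qed
qed

lemma null_pt_add:
  assumes "null_pt r" "null_pt s"
  shows "null_pt (\<lambda>\<epsilon>. r \<epsilon> + s \<epsilon>)"
  unfolding null_pt_iff_power
proof
  fix k :: nat
  have "\<forall>\<^sub>F \<epsilon> in at_right 0. norm (r \<epsilon>) \<le> \<epsilon> ^ Suc k" "\<forall>\<^sub>F \<epsilon> in at_right 0. norm (s \<epsilon>) \<le> \<epsilon> ^ Suc k"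
    using assms unfolding null_pt_iff_power by blast+
  with eventually_unit_interval show "\<forall>\<^sub>F \<epsilon> in at_right 0. norm (r \<epsilon> + s \<epsilon>) \<le> \<epsilon> ^ k"
  proof eventually_elim
    case (elim \<epsilon>)
    have "norm (r \<epsilon> + s \<epsilon>) \<le> (2 * \<epsilon>) * \<epsilon> ^ k" using elim norm_triangle_ineq[of "r \<epsilon>" "s \<epsilon>"] by simp
    also have "\<dots> \<le> 1 * \<epsilon> ^ k" using elim(1) by (intro mult_right_mono) auto
    finally show ?case by simp
  qed
qed

lemma null_pt_linear: "bounded_linear L \<Longrightarrow> null_pt r \<Longrightarrow> null_pt (\<lambda>\<epsilon>. L (r \<epsilon>))"
proof -
  assume L: "bounded_linear L" and r: "null_pt r"
  obtain B where B: "\<And>y. norm (L y) \<le> norm y * B" using bounded_linear.bounded[OF L] by blast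
  have "moderate_pt (\<lambda>\<epsilon>. B)" by (rule moderate_pt_bounded[of _ "norm B"]) simp
  then show ?thesis
  proof (rule null_pt_scale[OF _ r])
    have "norm (L (r \<epsilon>)) \<le> norm B * norm (r \<epsilon>)" for \<epsilon>
      using B[of "r \<epsilon>"] mult_left_mono[OF abs_ge_self[of B] norm_ge_zero[of "r \<epsilon>"]] by (simp add: mult.commute)
    then show "\<forall>\<^sub>F \<epsilon> in at_right 0. norm (L (r \<epsilon>)) \<le> norm B * norm (r \<epsilon>)" by simp
  qed
qed

lemma null_pt_minus: "null_pt r \<Longrightarrow> null_pt (\<lambda>\<epsilon>. - r \<epsilon>)"
  by (erule null_pt_cong) simp

lemma null_pt_diff: "null_pt r \<Longrightarrow> null_pt s \<Longrightarrow> null_pt (\<lambda>\<epsilon>. r \<epsilon> - s \<epsilon>)"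
  using null_pt_add[OF _ null_pt_minus] by fastforce

lemma null_pt_commute: "null_pt (\<lambda>\<epsilon>. r \<epsilon> - s \<epsilon>) \<Longrightarrow> null_pt (\<lambda>\<epsilon>. s \<epsilon> - r \<epsilon>)"
  using null_pt_minus by fastforce

lemma null_pt_trans: "null_pt (\<lambda>\<epsilon>. r \<epsilon> - s \<epsilon>) \<Longrightarrow> null_pt (\<lambda>\<epsilon>. s \<epsilon> - t \<epsilon>) \<Longrightarrow> null_pt (\<lambda>\<epsilon>. r \<epsilon> - t \<epsilon>)"
  using null_pt_add by fastforce

lemma null_pt_sum:
  "finite A \<Longrightarrow> (\<And>a. a \<in> A \<Longrightarrow> null_pt (r a)) \<Longrightarrow> null_pt (\<lambda>\<epsilon>. \<Sum>a\<in>A. r a \<epsilon>)"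
  by (induction A rule: finite_induct) (auto simp: null_pt_zero null_pt_add)

lemma null_pt_moderate: "null_pt r \<Longrightarrow> moderate_pt r"
proof -
  assume "null_pt r"
  then have "\<forall>\<^sub>F \<epsilon> in at_right 0. norm (r \<epsilon>) \<le> \<epsilon> ^ 0" unfolding null_pt_iff_power by blast
  then show ?thesis by (intro moderate_pt_bounded[of _ 1]) simp
qed

lemma R_c_bounded:
  assumes "\<eta> \<in> R_c"
  obtains R where "\<forall>\<^sub>F \<epsilon> in at_right 0. \<bar>\<eta> \<epsilon>\<bar> \<le> R"
proof -
  obtain \<eta>' K where n: "null_pt (\<lambda>\<epsilon>. \<eta> \<epsilon> - \<eta>' \<epsilon>)" and K: "compact K" "\<forall>\<^sub>F \<epsilon> in at_right 0. \<eta>' \<epsilon> \<in> K"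
    using assms unfolding R_c_def by blast
  obtain B where B: "\<And>x. x \<in> K \<Longrightarrow> norm x \<le> B" using compact_imp_bounded[OF K(1)] by (auto simp: bounded_iff)
  have "\<forall>\<^sub>F \<epsilon> in at_right 0. norm (\<eta> \<epsilon> - \<eta>' \<epsilon>) \<le> \<epsilon> ^ 0" using n unfolding null_pt_iff_power by blast
  with K(2) have "\<forall>\<^sub>F \<epsilon> in at_right 0. \<bar>\<eta> \<epsilon>\<bar> \<le> B + 1"
  proof eventually_elim
    case (elim \<epsilon>)
    then show ?case using B[of "\<eta>' \<epsilon>"] by auto
  qed
  then show thesis by (rule that)
qed

section \<open>Generalized functions are determined by their point values\<close>

lemma directional_mean_value:
  fixes g :: "'a::euclidean_space \<Rightarrow> 'b::euclidean_space"
  assumes g: "\<And>y. g differentiable (at y)" and s: "s > 0"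
  obtains s' where "0 < s'" "s' < s"
    "norm (g (x + s *\<^sub>R v) - g x - s *\<^sub>R d) \<le> s * norm (frechet_derivative g (at (x + s' *\<^sub>R v)) v - d)"
proof -
  define \<phi> where "\<phi> t = g (x + t *\<^sub>R v) - t *\<^sub>R d" for t
  have D: "(\<phi> has_vector_derivative (frechet_derivative g (at (x + t *\<^sub>R v)) v - d)) (at t)" for t
    unfolding \<phi>_def
    by (auto intro!: has_vector_derivative_diff directional_derivative g derivative_eq_intros)
  then have "continuous_on {0..s} \<phi>"
    by (meson continuous_at_imp_continuous_on has_vector_derivative_continuous)
  from mvt_general[OF s this D[unfolded has_vector_derivative_def]]
  obtain s' where "s' \<in> {0<..<s}"
    "norm (\<phi> s - \<phi> 0) \<le> norm ((s - 0) *\<^sub>R (frechet_derivative g (at (x + s' *\<^sub>R v)) v - d))" by blast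
  moreover from this have "norm (\<phi> s - \<phi> 0) \<le> s * norm (frechet_derivative g (at (x + s' *\<^sub>R v)) v - d)"
    using s by simp
  ultimately show thesis by (intro that[of s']) (auto simp: \<phi>_def algebra_simps)
qed

lemma mean_value_bound:
  fixes f :: "'a::euclidean_space \<Rightarrow> 'b::euclidean_space"
  assumes "smooth f"
  shows "\<exists>t\<in>{0..1}. norm (f y - f x) \<le>
    (\<Sum>b\<in>Basis. norm (pderivs [b] f (x + t *\<^sub>R (y - x))) * norm ((y - x) \<bullet> b))"
proof -
  have d: "f differentiable (at z)" for z by (rule smooth_differentiable[OF assms])
  obtain t where t: "0 < t" "t < 1" and
    *: "norm (f (x + 1 *\<^sub>R (y - x)) - f x - 1 *\<^sub>R 0) \<le> 1 * norm (frechet_derivative f (at (x + t *\<^sub>R (y - x))) (y - x) - 0)"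
    by (rule directional_mean_value[OF d zero_less_one])
  let ?L = "frechet_derivative f (at (x + t *\<^sub>R (y - x)))"
  have "linear ?L" by (rule linear_frechet_derivative[OF d])
  then have "?L (y - x) = (\<Sum>b\<in>Basis. ((y - x) \<bullet> b) *\<^sub>R ?L b)"
    by (subst (1) euclidean_representation[symmetric, of "y - x"]) (simp add: linear_sum linear_scale)
  then have "norm (?L (y - x)) \<le> (\<Sum>b\<in>Basis. norm (((y - x) \<bullet> b) *\<^sub>R ?L b))"
    by (simp only: norm_sum)
  then have "norm (f y - f x) \<le> (\<Sum>b\<in>Basis. norm (pderivs [b] f (x + t *\<^sub>R (y - x))) * norm ((y - x) \<bullet> b))"
    using * by (simp add: mult.commute)
  then show ?thesis using t by auto
qed

lemma moderate_pt_dominated: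
  "moderate_pt r \<Longrightarrow> \<forall>\<^sub>F \<epsilon> in at_right 0. norm (s \<epsilon>) \<le> norm (r \<epsilon>) \<Longrightarrow> moderate_pt s"
  unfolding moderate_pt_iff_power by (blast intro: eventually_elim2 order_trans)

lemma moderate_pt_segment:
  assumes "moderate_pt x" "moderate_pt v" "\<And>\<epsilon>. t \<epsilon> \<in> {0..1}"
  shows "moderate_pt (\<lambda>\<epsilon>. x \<epsilon> + t \<epsilon> *\<^sub>R v \<epsilon>)"
proof -
  have "norm (t \<epsilon> *\<^sub>R v \<epsilon>) \<le> norm (v \<epsilon>)" for \<epsilon>
    using assms(3)[of \<epsilon>] mult_right_mono[of "\<bar>t \<epsilon>\<bar>" 1 "norm (v \<epsilon>)"] by simp
  then have "moderate_pt (\<lambda>\<epsilon>. t \<epsilon> *\<^sub>R v \<epsilon>)"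
    by (intro moderate_pt_dominated[OF assms(2)]) simp
  then show ?thesis by (rule moderate_pt_add[OF assms(1)])
qed

text \<open>
  Intermediate points exist for each \<open>\<epsilon>\<close> separately; selecting them gives a net, to which the
  estimates at generalized points apply.
\<close>
lemma choice_on_unit_interval:
  fixes P :: "real \<Rightarrow> real \<Rightarrow> bool"
  assumes "\<And>\<epsilon>. \<epsilon> \<in> {0<..1} \<Longrightarrow> \<exists>t\<in>{0..1}. P \<epsilon> t"
  obtains t :: "real \<Rightarrow> real" where "\<And>\<epsilon>. t \<epsilon> \<in> {0..1}" "\<And>\<epsilon>. \<epsilon> \<in> {0<..1} \<Longrightarrow> P \<epsilon> (t \<epsilon>)"
proof -
  have "\<forall>\<epsilon>. \<exists>t. t \<in> {0..1} \<and> (\<epsilon> \<in> {0<..1} \<longrightarrow> P \<epsilon> t)"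
  proof
    fix \<epsilon> :: real
    show "\<exists>t. t \<in> {0..1} \<and> (\<epsilon> \<in> {0<..1} \<longrightarrow> P \<epsilon> t)"
    proof (cases "\<epsilon> \<in> {0<..1}")
      case True
      then show ?thesis using assms by blast
    next
      case False
      then show ?thesis by (intro exI[of _ 0]) auto
    qed
  qed
  from choice[OF this] show thesis using that by blast
qed

text \<open>
  By the mean value theorem the difference is bounded by a derivative at an intermediate point, which
  is moderate, times the null difference of the arguments.
\<close>
lemma E_tau_null_diff:
  fixes u :: "('a::euclidean_space \<Rightarrow> 'b::euclidean_space) net"
  assumes u: "u \<in> E_tau" and x: "moderate_pt x" and xy: "null_pt (\<lambda>\<epsilon>. x \<epsilon> - y \<epsilon>)"
  shows "null_pt (\<lambda>\<epsilon>. u \<epsilon> (x \<epsilon>) - u \<epsilon> (y \<epsilon>))"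
proof -
  note yx = null_pt_commute[OF xy]
  obtain t where t: "\<And>\<epsilon>. t \<epsilon> \<in> {0..1}" and
    bound: "\<And>\<epsilon>. \<epsilon> \<in> {0<..1} \<Longrightarrow> norm (u \<epsilon> (y \<epsilon>) - u \<epsilon> (x \<epsilon>)) \<le>
      (\<Sum>b\<in>Basis. norm (pderivs [b] (u \<epsilon>) (x \<epsilon> + t \<epsilon> *\<^sub>R (y \<epsilon> - x \<epsilon>))) * norm ((y \<epsilon> - x \<epsilon>) \<bullet> b))"
    by (rule choice_on_unit_interval[where P = "\<lambda>\<epsilon> t. norm (u \<epsilon> (y \<epsilon>) - u \<epsilon> (x \<epsilon>)) \<le>
      (\<Sum>b\<in>Basis. norm (pderivs [b] (u \<epsilon>) (x \<epsilon> + t *\<^sub>R (y \<epsilon> - x \<epsilon>))) * norm ((y \<epsilon> - x \<epsilon>) \<bullet> b))",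
      OF mean_value_bound[OF E_tau_smooth[OF u]]], assumption, rule that)
  have mod: "moderate_pt (\<lambda>\<epsilon>. x \<epsilon> + t \<epsilon> *\<^sub>R (y \<epsilon> - x \<epsilon>))"
    by (rule moderate_pt_segment[OF x null_pt_moderate[OF yx] t])
  have "null_pt (\<lambda>\<epsilon>. \<Sum>b\<in>Basis. norm (pderivs [b] (u \<epsilon>) (x \<epsilon> + t \<epsilon> *\<^sub>R (y \<epsilon> - x \<epsilon>))) * norm ((y \<epsilon> - x \<epsilon>) \<bullet> b))"
  proof (rule null_pt_sum[OF finite_Basis])
    fix b :: 'a assume b: "b \<in> Basis"
    have "moderate_pt (\<lambda>\<epsilon>. pderivs [b] (u \<epsilon>) (x \<epsilon> + t \<epsilon> *\<^sub>R (y \<epsilon> - x \<epsilon>)))"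
      using E_tau_moderate[OF E_tau_pderivs[OF u, of "[b]"] mod] b by simp
    moreover have "null_pt (\<lambda>\<epsilon>. (y \<epsilon> - x \<epsilon>) \<bullet> b)"
      by (rule null_pt_linear[OF bounded_linear_inner_left yx])
    ultimately show "null_pt (\<lambda>\<epsilon>. norm (pderivs [b] (u \<epsilon>) (x \<epsilon> + t \<epsilon> *\<^sub>R (y \<epsilon> - x \<epsilon>))) * norm ((y \<epsilon> - x \<epsilon>) \<bullet> b))"
      by (rule null_pt_scale) simp
  qed
  then have "null_pt (\<lambda>\<epsilon>. u \<epsilon> (y \<epsilon>) - u \<epsilon> (x \<epsilon>))"
  proof (rule null_pt_cong)
    show "\<forall>\<^sub>F \<epsilon> in at_right 0. norm (u \<epsilon> (y \<epsilon>) - u \<epsilon> (x \<epsilon>)) \<le>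
      norm (\<Sum>b\<in>Basis. norm (pderivs [b] (u \<epsilon>) (x \<epsilon> + t \<epsilon> *\<^sub>R (y \<epsilon> - x \<epsilon>))) * norm ((y \<epsilon> - x \<epsilon>) \<bullet> b))"
      using eventually_unit_interval
    proof eventually_elim
      case (elim \<epsilon>)
      then have "\<epsilon> \<in> {0<..1}" by simp
      from order_trans[OF bound[OF this] abs_ge_self] show ?case unfolding real_norm_def .
    qed
  qed
  then show ?thesis by (rule null_pt_commute)
qed

lemma E_tau_null_value:
  "u \<in> E_tau \<Longrightarrow> moderate_pt x \<Longrightarrow> null_pt (\<lambda>\<epsilon>. x \<epsilon> - y \<epsilon>) \<Longrightarrow> null_pt (\<lambda>\<epsilon>. u \<epsilon> (y \<epsilon>)) \<Longrightarrow> null_pt (\<lambda>\<epsilon>. u \<epsilon> (x \<epsilon>))"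
  using null_pt_add[OF E_tau_null_diff[of u x y], of "\<lambda>\<epsilon>. u \<epsilon> (y \<epsilon>)"] by simp

text \<open>
  Taylor's formula \<open>f(x + tv) = f(x) + t \<partial>\<^sub>vf(x) + O(t\<^sup>2)\<close>, solved for the derivative. The point
  \<open>\<sigma>\<close> maximizes the second derivative over the whole segment and therefore does not depend on \<open>t\<close>,
  so that \<open>t\<close> may later be chosen according to the size of that maximum.
\<close>
lemma derivative_interpolation:
  fixes f :: "'a::euclidean_space \<Rightarrow> 'b::euclidean_space"
  assumes f: "smooth f" and v: "v \<in> Basis"
  shows "\<exists>\<sigma>\<in>{0..1}. \<forall>t\<in>{0<..1}. norm (pderivs [v] f x) \<le>
    (norm (f (x + t *\<^sub>R v)) + norm (f x)) / t + t * norm (pderivs [v, v] f (x + \<sigma> *\<^sub>R v))"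
proof -
  have f1: "smooth (pderivs [v] f)" by (rule smooth_pderivs[OF f]) (simp add: v)
  have df: "f differentiable (at y)" "pderivs [v] f differentiable (at y)" for y
    using smooth_differentiable f f1 by blast+
  let ?N = "\<lambda>\<sigma>. norm (pderivs [v, v] f (x + \<sigma> *\<^sub>R v))"
  have vv: "[v, v] \<in> lists Basis" using v by simp
  have "continuous_on {0..1} ?N"
    by (intro continuous_intros continuous_on_compose2[OF continuous_on_pderivs[OF f vv, of UNIV]]) auto
  then obtain \<sigma> where \<sigma>: "\<sigma> \<in> {0..1}" and max: "\<And>s. s \<in> {0..1} \<Longrightarrow> ?N s \<le> ?N \<sigma>"
    using continuous_attains_sup[of "{0..1::real}" ?N] by auto
  have "norm (pderivs [v] f x) \<le> (norm (f (x + t *\<^sub>R v)) + norm (f x)) / t + t * ?N \<sigma>" if t: "t \<in> {0<..1}" for t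
  proof -
    let ?d = "pderivs [v] f x"
    obtain s where s: "0 < s" "s < t" and
      1: "norm (f (x + t *\<^sub>R v) - f x - t *\<^sub>R ?d) \<le> t * norm (frechet_derivative f (at (x + s *\<^sub>R v)) v - ?d)"
      using directional_mean_value[OF df(1)] t by (metis greaterThanAtMost_iff)
    obtain r where r: "0 < r" "r < s" and
      2: "norm (pderivs [v] f (x + s *\<^sub>R v) - ?d - s *\<^sub>R 0) \<le> s * norm (frechet_derivative (pderivs [v] f) (at (x + r *\<^sub>R v)) v - 0)"
      using directional_mean_value[OF df(2) s(1)] by metis
    have "norm (pderivs [v] f (x + s *\<^sub>R v) - ?d) \<le> s * ?N r" using 2 by simp
    also have "\<dots> \<le> t * ?N \<sigma>" using s r t by (intro mult_mono max) auto
    finally have "norm (f (x + t *\<^sub>R v) - f x - t *\<^sub>R ?d) \<le> t * (t * ?N \<sigma>)"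
      using 1 t by (smt (verit) greaterThanAtMost_iff mult_left_mono pderivs.simps)
    moreover have "norm (t *\<^sub>R ?d) \<le> norm (f (x + t *\<^sub>R v)) + norm (f x) + norm (f (x + t *\<^sub>R v) - f x - t *\<^sub>R ?d)"
      by (smt (verit) norm_minus_commute norm_triangle_ineq2 norm_triangle_ineq4)
    ultimately have "t * norm ?d \<le> norm (f (x + t *\<^sub>R v)) + norm (f x) + t * (t * ?N \<sigma>)"
      using t by simp
    then have "t * norm ?d / t \<le> (norm (f (x + t *\<^sub>R v)) + norm (f x) + t * (t * ?N \<sigma>)) / t"
      using t by (intro divide_right_mono) auto
    then show ?thesis using t by (simp add: add_divide_distrib)
  qed
  then show ?thesis using \<sigma> by blast
qed

text \<open>
  If the second derivative is \<open>O(\<epsilon>\<^sup>-\<^sup>m)\<close> along the segment, interpolation with step \<open>t = \<epsilon>\<^sup>j\<close>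
  bounds the first derivative by \<open>O(\<epsilon>\<^sup>j\<^sup>-\<^sup>m)\<close> up to a null term. The class \<open>P\<close> of point nets will be
  that of moderate or that of bounded points; it has to contain the shifted points used.
\<close>
lemma null_derivative:
  fixes u :: "('a::euclidean_space \<Rightarrow> 'b::euclidean_space) net"
  assumes smooth: "\<And>\<epsilon>. \<epsilon> \<in> {0<..1} \<Longrightarrow> smooth (u \<epsilon>)" and v: "v \<in> Basis"
    and shift: "\<And>x t. P x \<Longrightarrow> (\<And>\<epsilon>. t \<epsilon> \<in> {0..1}) \<Longrightarrow> P (\<lambda>\<epsilon>. x \<epsilon> + t \<epsilon> *\<^sub>R v)"
    and moderate: "\<And>x. P x \<Longrightarrow> moderate_pt (\<lambda>\<epsilon>. pderivs [v, v] (u \<epsilon>) (x \<epsilon>))"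
    and null: "\<And>x. P x \<Longrightarrow> null_pt (\<lambda>\<epsilon>. u \<epsilon> (x \<epsilon>))"
    and x: "P x"
  shows "null_pt (\<lambda>\<epsilon>. pderivs [v] (u \<epsilon>) (x \<epsilon>))"
proof -
  obtain \<sigma> where \<sigma>: "\<And>\<epsilon>. \<sigma> \<epsilon> \<in> {0..1}" and
    bound: "\<And>\<epsilon>. \<epsilon> \<in> {0<..1} \<Longrightarrow> \<forall>t\<in>{0<..1}. norm (pderivs [v] (u \<epsilon>) (x \<epsilon>)) \<le>
      (norm (u \<epsilon> (x \<epsilon> + t *\<^sub>R v)) + norm (u \<epsilon> (x \<epsilon>))) / t + t * norm (pderivs [v, v] (u \<epsilon>) (x \<epsilon> + \<sigma> \<epsilon> *\<^sub>R v))"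
    by (rule choice_on_unit_interval[where P = "\<lambda>\<epsilon> \<sigma>. \<forall>t\<in>{0<..1}. norm (pderivs [v] (u \<epsilon>) (x \<epsilon>)) \<le>
      (norm (u \<epsilon> (x \<epsilon> + t *\<^sub>R v)) + norm (u \<epsilon> (x \<epsilon>))) / t + t * norm (pderivs [v, v] (u \<epsilon>) (x \<epsilon> + \<sigma> *\<^sub>R v))",
      OF derivative_interpolation[OF smooth v]], assumption, rule that)
  obtain m where m: "\<forall>\<^sub>F \<epsilon> in at_right 0. norm (pderivs [v, v] (u \<epsilon>) (x \<epsilon> + \<sigma> \<epsilon> *\<^sub>R v)) \<le> (2 / \<epsilon>) ^ m"
    using moderate[OF shift[OF x, of \<sigma>, OF \<sigma>]] unfolding moderate_pt_iff_power by blast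
  show ?thesis
    unfolding null_pt_iff_power
  proof
    fix k :: nat
    \<comment> \<open>\<open>\<epsilon>\<^sup>j (2/\<epsilon>)\<^sup>m \<le> \<epsilon>\<^sup>k\<^sup>+\<^sup>1\<close>, because \<open>(2/\<epsilon>)\<^sup>m \<epsilon>\<^sup>2\<^sup>m = (2\<epsilon>)\<^sup>m \<le> 1\<close>\<close>
    define j where "j = 2 * m + k + 1"
    define t where "t \<epsilon> = (if \<epsilon> \<in> {0<..1} then \<epsilon> ^ j else 1)" for \<epsilon> :: real
    have t: "t \<epsilon> \<in> {0<..1}" for \<epsilon> by (auto simp: t_def power_le_one)
    have t': "t \<epsilon> \<in> {0..1}" for \<epsilon> using t[of \<epsilon>] by simp
    have "\<forall>\<^sub>F \<epsilon> in at_right 0. norm (u \<epsilon> (x \<epsilon> + t \<epsilon> *\<^sub>R v)) \<le> \<epsilon> ^ (j + k + 2)"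
      "\<forall>\<^sub>F \<epsilon> in at_right 0. norm (u \<epsilon> (x \<epsilon>)) \<le> \<epsilon> ^ (j + k + 2)"
      by (rule null[OF shift[OF x, of t, OF t'], unfolded null_pt_iff_power, rule_format],
          rule null[OF x, unfolded null_pt_iff_power, rule_format])
    with m eventually_unit_interval show "\<forall>\<^sub>F \<epsilon> in at_right 0. norm (pderivs [v] (u \<epsilon>) (x \<epsilon>)) \<le> \<epsilon> ^ k"
    proof eventually_elim
      case (elim \<epsilon>)
      then have e: "\<epsilon> \<in> {0<..1}" "\<epsilon> > 0" "\<epsilon> \<le> 1/2" by auto
      have te: "t \<epsilon> = \<epsilon> ^ j" using e by (simp add: t_def)
      have "norm (u \<epsilon> (x \<epsilon> + t \<epsilon> *\<^sub>R v)) + norm (u \<epsilon> (x \<epsilon>)) \<le> (2 * \<epsilon>) * \<epsilon> ^ (j + (k + 1))" using elim by simp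
      also have "\<dots> \<le> 1 * \<epsilon> ^ (j + (k + 1))" using e by (intro mult_right_mono) auto
      finally have "(norm (u \<epsilon> (x \<epsilon> + t \<epsilon> *\<^sub>R v)) + norm (u \<epsilon> (x \<epsilon>))) / t \<epsilon> \<le> \<epsilon> ^ (j + (k + 1)) / t \<epsilon>"
        using e by (intro divide_right_mono) (auto simp: te)
      also have "\<dots> = \<epsilon> * \<epsilon> ^ k" using e by (simp add: te power_add)
      finally have 1: "(norm (u \<epsilon> (x \<epsilon> + t \<epsilon> *\<^sub>R v)) + norm (u \<epsilon> (x \<epsilon>))) / t \<epsilon> \<le> \<epsilon> * \<epsilon> ^ k" .
      have "t \<epsilon> * norm (pderivs [v, v] (u \<epsilon>) (x \<epsilon> + \<sigma> \<epsilon> *\<^sub>R v)) \<le> t \<epsilon> * (2 / \<epsilon>) ^ m"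
        using elim e by (intro mult_left_mono) (auto simp: te)
      also have "t \<epsilon> * (2 / \<epsilon>) ^ m = (2 / \<epsilon> * \<epsilon> ^ 2) ^ m * (\<epsilon> * \<epsilon> ^ k)"
      proof -
        have "t \<epsilon> = (\<epsilon> ^ 2) ^ m * (\<epsilon> * \<epsilon> ^ k)" by (simp add: te j_def power_add power_mult)
        then show ?thesis
          by (simp only: power_mult_distrib mult.assoc mult.commute mult.left_commute)
      qed
      also have "2 / \<epsilon> * \<epsilon> ^ 2 = 2 * \<epsilon>" using e by (simp add: power2_eq_square)
      also have "(2 * \<epsilon>) ^ m * (\<epsilon> * \<epsilon> ^ k) \<le> 1 * (\<epsilon> * \<epsilon> ^ k)"
        using e by (intro mult_right_mono power_le_one) auto
      finally have "norm (pderivs [v] (u \<epsilon>) (x \<epsilon>)) \<le> (2 * \<epsilon>) * \<epsilon> ^ k"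
        using bspec[OF bound[OF e(1)] t[of \<epsilon>]] 1 by (simp only: mult_1 mult_2 distrib_right)
      also have "\<dots> \<le> 1 * \<epsilon> ^ k" using e by (intro mult_right_mono) auto
      finally show ?case by simp
    qed
  qed
qed

lemma null_derivatives:
  fixes u :: "('a::euclidean_space \<Rightarrow> 'b::euclidean_space) net"
  assumes smooth: "\<And>\<epsilon>. \<epsilon> \<in> {0<..1} \<Longrightarrow> smooth (u \<epsilon>)"
    and shift: "\<And>x v t. P x \<Longrightarrow> (\<And>\<epsilon>. t \<epsilon> \<in> {0..1}) \<Longrightarrow> P (\<lambda>\<epsilon>. x \<epsilon> + t \<epsilon> *\<^sub>R v)"
    and moderate: "\<And>vs x. vs \<in> lists Basis \<Longrightarrow> P x \<Longrightarrow> moderate_pt (\<lambda>\<epsilon>. pderivs vs (u \<epsilon>) (x \<epsilon>))"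
    and null: "\<And>x. P x \<Longrightarrow> null_pt (\<lambda>\<epsilon>. u \<epsilon> (x \<epsilon>))"
    and vs: "vs \<in> lists Basis" and x: "P x"
  shows "null_pt (\<lambda>\<epsilon>. pderivs vs (u \<epsilon>) (x \<epsilon>))"
  using vs x
proof (induction vs arbitrary: x rule: list.induct)
  case (Cons v vs)
  then have v: "v \<in> Basis" and vs: "vs \<in> lists Basis" by auto
  have "null_pt (\<lambda>\<epsilon>. pderivs [v] (pderivs vs (u \<epsilon>)) (x \<epsilon>))"
  proof (rule null_derivative[where P = P, OF smooth_pderivs[OF smooth vs] v shift])
    fix x assume "P x"
    then show "moderate_pt (\<lambda>\<epsilon>. pderivs [v, v] (pderivs vs (u \<epsilon>)) (x \<epsilon>))"
      using moderate[of "v # v # vs" x] v vs by simp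
    show "null_pt (\<lambda>\<epsilon>. pderivs vs (u \<epsilon>) (x \<epsilon>))"
      by (rule Cons.IH[OF vs \<open>P x\<close>])
  qed (use Cons.prems in auto)
  then show ?case by simp
qed (use null in simp)

text \<open>
  For each \<open>\<epsilon>\<close> for which the estimate fails somewhere in \<open>S \<epsilon>\<close>, choose a point where it fails. Since
  \<open>u\<close> is null along the net of these points, the estimate fails for no small \<open>\<epsilon>\<close>.
\<close>
lemma uniformly_null:
  fixes u :: "('a \<Rightarrow> 'b::euclidean_space) net"
  assumes ne: "\<And>\<epsilon>. S \<epsilon> \<noteq> {}" and null: "\<And>x. (\<And>\<epsilon>. x \<epsilon> \<in> S \<epsilon>) \<Longrightarrow> null_pt (\<lambda>\<epsilon>. u \<epsilon> (x \<epsilon>))"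
  shows "\<forall>\<^sub>F \<epsilon> in at_right 0. \<forall>x\<in>S \<epsilon>. norm (u \<epsilon> x) \<le> \<epsilon> ^ k"
proof -
  have "\<forall>\<epsilon>. \<exists>x\<in>S \<epsilon>. norm (u \<epsilon> x) \<le> \<epsilon> ^ k \<longrightarrow> (\<forall>y\<in>S \<epsilon>. norm (u \<epsilon> y) \<le> \<epsilon> ^ k)"
    using ne by blast
  then have "\<forall>\<epsilon>. \<exists>x. x \<in> S \<epsilon> \<and> (norm (u \<epsilon> x) \<le> \<epsilon> ^ k \<longrightarrow> (\<forall>y\<in>S \<epsilon>. norm (u \<epsilon> y) \<le> \<epsilon> ^ k))"
    by blast
  from choice[OF this] obtain x where x: "\<And>\<epsilon>. x \<epsilon> \<in> S \<epsilon>" and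
    worst: "\<And>\<epsilon>. norm (u \<epsilon> (x \<epsilon>)) \<le> \<epsilon> ^ k \<Longrightarrow> \<forall>y\<in>S \<epsilon>. norm (u \<epsilon> y) \<le> \<epsilon> ^ k" by blast
  have "\<forall>\<^sub>F \<epsilon> in at_right 0. norm (u \<epsilon> (x \<epsilon>)) \<le> \<epsilon> ^ k"
    using null[OF x] unfolding null_pt_iff_power by blast
  then show ?thesis by (rule eventually_mono) (rule worst)
qed

lemma E_M_smooth: "u \<in> E_M \<Longrightarrow> \<epsilon> \<in> {0<..1} \<Longrightarrow> smooth (u \<epsilon>)"
  by (auto simp: E_M_def)

lemma E_M_moderate:
  assumes u: "u \<in> E_M" and vs: "vs \<in> lists Basis" and x: "\<forall>\<^sub>F \<epsilon> in at_right 0. norm (x \<epsilon>) \<le> R"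
  shows "moderate_pt (\<lambda>\<epsilon>. pderivs vs (u \<epsilon>) (x \<epsilon>))"
proof -
  have "tempered (at_right 0) (cball 0 R) (\<lambda>\<epsilon> x. 2 / \<epsilon>) u"
    using u by (simp add: E_M_iff_tempered)
  then obtain k where "\<forall>\<^sub>F \<epsilon> in at_right 0. \<forall>x\<in>cball 0 R. norm (pderivs vs (u \<epsilon>) x) \<le> (2 / \<epsilon>) ^ k"
    using vs unfolding tempered_def controlled_def by blast
  with x have "\<forall>\<^sub>F \<epsilon> in at_right 0. norm (pderivs vs (u \<epsilon>) (x \<epsilon>)) \<le> (2 / \<epsilon>) ^ k"
    by eventually_elim simp
  then show ?thesis unfolding moderate_pt_iff_power by blast
qed

lemma N_M_pointwise:
  fixes u :: "('a::euclidean_space \<Rightarrow> 'b::euclidean_space) net"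
  assumes u: "u \<in> E_M" and null: "\<And>x R. (\<And>\<epsilon>. norm (x \<epsilon>) \<le> R) \<Longrightarrow> null_pt (\<lambda>\<epsilon>. u \<epsilon> (x \<epsilon>))"
  shows "u \<in> N_M"
proof -
  define P where "P x \<longleftrightarrow> (\<exists>R. \<forall>\<epsilon>. norm (x \<epsilon>) \<le> R)" for x :: "'a net"
  have null': "null_pt (\<lambda>\<epsilon>. pderivs vs (u \<epsilon>) (x \<epsilon>))" if vs: "vs \<in> lists Basis" and "P x" for vs x
  proof (rule null_derivatives[where P = P, OF E_M_smooth[OF u]])
    show "P (\<lambda>\<epsilon>. x \<epsilon> + t \<epsilon> *\<^sub>R v)" if x: "P x" and t: "\<And>\<epsilon>. t \<epsilon> \<in> {0..1}" for x v and t :: "real \<Rightarrow> real"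
    proof -
      obtain R where R: "\<And>\<epsilon>. norm (x \<epsilon>) \<le> R" using x unfolding P_def by blast
      have "norm (x \<epsilon> + t \<epsilon> *\<^sub>R v) \<le> R + norm v" for \<epsilon>
        using R[of \<epsilon>] t[of \<epsilon>] mult_right_mono[of "t \<epsilon>" 1 "norm v"]
        by (intro order_trans[OF norm_triangle_ineq] add_mono) auto
      then show ?thesis unfolding P_def by blast
    qed
    show "moderate_pt (\<lambda>\<epsilon>. pderivs vs (u \<epsilon>) (x \<epsilon>))" if "vs \<in> lists Basis" "P x" for vs x
      using that E_M_moderate[OF u] unfolding P_def by (meson always_eventually)
  qed (use that null in \<open>auto simp: P_def\<close>)
  show ?thesis
    unfolding N_M_def mem_Collect_eq
  proof (intro conjI ballI allI impI)
    fix K :: "'a set" and vs :: "'a list" and s :: real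
    assume K: "compact K" and vs: "vs \<in> lists Basis"
    have "\<forall>\<^sub>F \<epsilon> in at_right 0. \<forall>x\<in>K. norm (pderivs vs (u \<epsilon>) x) \<le> \<epsilon> ^ nat \<lceil>s\<rceil>"
    proof (cases "K = {}")
      case False
      obtain R where "\<And>x. x \<in> K \<Longrightarrow> norm x \<le> R" using compact_imp_bounded[OF K] by (auto simp: bounded_iff)
      with False null'[OF vs] show ?thesis by (intro uniformly_null) (auto simp: P_def)
    qed simp
    with eventually_unit_interval
    have "\<forall>\<^sub>F \<epsilon> in at_right 0. \<forall>x\<in>K. norm (pderivs vs (u \<epsilon>) x) \<le> 1 * \<epsilon> powr s"
    proof eventually_elim
      case (elim \<epsilon>)
      then have "\<epsilon> ^ nat \<lceil>s\<rceil> \<le> \<epsilon> powr s" by (intro power_nat_ceiling_le) auto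
      then show ?case using elim(2) by auto
    qed
    then show "\<exists>C. \<forall>\<^sub>F \<epsilon> in at_right 0. \<forall>x\<in>K. norm (pderivs vs (u \<epsilon>) x) \<le> C * \<epsilon> powr s" by blast
  qed (rule E_M_smooth[OF u])
qed

text \<open>
  On the region \<open>|x| \<le> \<epsilon>\<^sup>-\<^sup>(\<^sup>r\<^sup>+\<^sup>s\<^sup>)\<close>, which consists of moderate points, nullness is uniform. Outside
  of it one additional factor \<open>1 + |x|\<close> compensates \<open>\<epsilon>\<^sup>-\<^sup>r\<^sup>-\<^sup>s\<close> in the moderate bound. The exponent
  \<open>r + 1\<close> obtained in this way does not depend on \<open>s\<close>, as negligibility demands.
\<close>
lemma N_tau_pointwise:
  fixes u :: "('a::euclidean_space \<Rightarrow> 'b::euclidean_space) net"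
  assumes u: "u \<in> E_tau" and null: "\<And>x. moderate_pt x \<Longrightarrow> null_pt (\<lambda>\<epsilon>. u \<epsilon> (x \<epsilon>))"
  shows "u \<in> N_tau"
proof -
  have null': "null_pt (\<lambda>\<epsilon>. pderivs vs (u \<epsilon>) (x \<epsilon>))" if vs: "vs \<in> lists Basis" and "moderate_pt x" for vs x
  proof (rule null_derivatives[where P = moderate_pt, OF E_tau_smooth[OF u]])
    show "moderate_pt (\<lambda>\<epsilon>. x \<epsilon> + t \<epsilon> *\<^sub>R v)" if "moderate_pt x" "\<And>\<epsilon>. t \<epsilon> \<in> {0..1}" for x and v :: 'a and t :: "real \<Rightarrow> real"
      using that(2) by (intro moderate_pt_segment[OF that(1)] moderate_pt_bounded[of _ "norm v"]) auto
    show "moderate_pt (\<lambda>\<epsilon>. pderivs vs (u \<epsilon>) (x \<epsilon>))" if "vs \<in> lists Basis" "moderate_pt x" for vs x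
      by (rule E_tau_moderate[OF E_tau_pderivs[OF u that(1)] that(2)])
  qed (use that null in auto)
  have "\<exists>r>0. \<forall>s>0. \<exists>C. \<forall>\<^sub>F \<epsilon> in at_right 0. \<forall>x. norm (pderivs vs (u \<epsilon>) x) \<le> C * \<epsilon> powr s * (1 + norm x) powr r"
    if vs: "vs \<in> lists Basis" for vs
  proof -
    obtain r C where r: "r > 0" and
      bd: "\<forall>\<^sub>F \<epsilon> in at_right 0. \<forall>x. norm (pderivs vs (u \<epsilon>) x) \<le> C * \<epsilon> powr (-r) * (1 + norm x) powr r"
      using u vs unfolding E_tau_def by blast
    have "\<exists>C. \<forall>\<^sub>F \<epsilon> in at_right 0. \<forall>x. norm (pderivs vs (u \<epsilon>) x) \<le> C * \<epsilon> powr s * (1 + norm x) powr (r + 1)"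
      if s: "s > 0" for s
    proof -
      have P: "\<forall>\<^sub>F \<epsilon> in at_right 0. \<forall>x\<in>{x. norm x \<le> \<epsilon> powr (-(r + s))}. norm (pderivs vs (u \<epsilon>) x) \<le> \<epsilon> ^ nat \<lceil>s\<rceil>"
      proof (rule uniformly_null)
        fix x :: "'a net" assume "\<And>\<epsilon>. x \<epsilon> \<in> {x. norm x \<le> \<epsilon> powr (-(r + s))}"
        then have "moderate_pt x" unfolding moderate_pt_def by (intro exI[of _ "r + s"]) simp
        then show "null_pt (\<lambda>\<epsilon>. pderivs vs (u \<epsilon>) (x \<epsilon>))" by (rule null'[OF vs])
      qed (auto intro!: exI[of _ 0])
      have "\<forall>\<^sub>F \<epsilon> in at_right 0. \<forall>x. norm (pderivs vs (u \<epsilon>) x) \<le> (\<bar>C\<bar> + 1) * \<epsilon> powr s * (1 + norm x) powr (r + 1)"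
        using P bd eventually_unit_interval
      proof eventually_elim
        case (elim \<epsilon>)
        show ?case
        proof
          fix x :: 'a
          let ?n = "norm (pderivs vs (u \<epsilon>) x)" and ?w = "1 + norm x"
          have w: "1 \<le> ?w powr (r + 1)" using r by (simp add: ge_one_powr_ge_zero)
          show "?n \<le> (\<bar>C\<bar> + 1) * \<epsilon> powr s * ?w powr (r + 1)"
          proof (cases "norm x \<le> \<epsilon> powr (-(r + s))")
            case True
            then have "?n \<le> \<epsilon> ^ nat \<lceil>s\<rceil>" using elim by auto
            also have "\<dots> \<le> \<epsilon> powr s" using elim by (intro power_nat_ceiling_le) auto
            also have "\<dots> = 1 * \<epsilon> powr s * 1" by simp
            also have "\<dots> \<le> (\<bar>C\<bar> + 1) * \<epsilon> powr s * ?w powr (r + 1)"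
              using w by (intro mult_mono) auto
            finally show ?thesis .
          next
            case False
            have "\<epsilon> powr (-r) = \<epsilon> powr s * \<epsilon> powr (-(r + s))" by (simp flip: powr_add)
            also have "\<dots> \<le> \<epsilon> powr s * ?w" using False by (intro mult_left_mono) auto
            finally have *: "\<epsilon> powr (-r) \<le> \<epsilon> powr s * ?w" .
            have "?n \<le> C * (\<epsilon> powr (-r) * ?w powr r)" using elim by (simp add: mult.assoc)
            also have "\<dots> \<le> (\<bar>C\<bar> + 1) * (\<epsilon> powr (-r) * ?w powr r)"
              by (intro mult_right_mono) auto
            also have "\<dots> \<le> (\<bar>C\<bar> + 1) * (\<epsilon> powr s * ?w * ?w powr r)"
              using * by (intro mult_left_mono mult_right_mono) auto
            also have "\<epsilon> powr s * ?w * ?w powr r = \<epsilon> powr s * ?w powr (r + 1)"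
              using add_pos_nonneg[of 1 "norm x"] by (simp add: powr_add)
            finally show ?thesis by (simp add: mult.assoc)
          qed
        qed
      qed
      then show ?thesis by blast
    qed
    then show ?thesis using r by (intro exI[of _ "r + 1"]) auto
  qed
  then show ?thesis using u unfolding N_tau_def E_tau_def by blast
qed

lemma null_pt_of_powr_bound:
  assumes "\<And>s. s > 0 \<Longrightarrow> \<exists>C. \<forall>\<^sub>F \<epsilon> in at_right 0. norm (r \<epsilon>) \<le> C * \<epsilon> powr s * (1 + norm (x \<epsilon>)) powr q"
    and x: "moderate_pt x" and q: "q > 0"
  shows "null_pt r"
  unfolding null_pt_def
proof
  fix s :: real
  obtain m where "\<forall>\<^sub>F \<epsilon> in at_right 0. norm (x \<epsilon>) \<le> \<epsilon> powr (-m)" using x unfolding moderate_pt_def by blast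
  define l where "l = max m 0 + 1"
  have l: "\<forall>\<^sub>F \<epsilon> in at_right 0. 1 + norm (x \<epsilon>) \<le> \<epsilon> powr (-l)"
    using \<open>\<forall>\<^sub>F \<epsilon> in at_right 0. norm (x \<epsilon>) \<le> \<epsilon> powr (-m)\<close> eventually_unit_interval
  proof eventually_elim
    case (elim \<epsilon>)
    have "norm (x \<epsilon>) \<le> \<epsilon> powr (- max m 0)"
      using elim by (intro order_trans[OF elim(1)] powr_mono') auto
    moreover have "1 \<le> \<epsilon> powr (- max m 0)"
      using elim powr_mono'[of "- max m 0" 0 \<epsilon>] by auto
    ultimately have "1 + norm (x \<epsilon>) \<le> 2 * \<epsilon> powr (- max m 0)" by linarith
    also have "\<dots> \<le> (1 / \<epsilon>) * \<epsilon> powr (- max m 0)"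
      using elim by (intro mult_right_mono) (auto simp: field_simps)
    also have "\<dots> = \<epsilon> powr (-l)" using elim by (simp add: l_def powr_diff)
    finally show ?case .
  qed
  have pos: "\<bar>s\<bar> + l * q + 1 > 0" using q by (auto simp: l_def intro!: add_nonneg_pos)
  obtain C where "\<forall>\<^sub>F \<epsilon> in at_right 0. norm (r \<epsilon>) \<le> C * \<epsilon> powr (\<bar>s\<bar> + l * q + 1) * (1 + norm (x \<epsilon>)) powr q"
    using assms(1)[OF pos] by blast
  with l eventually_unit_interval have "\<forall>\<^sub>F \<epsilon> in at_right 0. norm (r \<epsilon>) \<le> \<bar>C\<bar> * \<epsilon> powr s"
  proof eventually_elim
    case (elim \<epsilon>)
    have "norm (r \<epsilon>) \<le> C * (\<epsilon> powr (\<bar>s\<bar> + l * q + 1) * (1 + norm (x \<epsilon>)) powr q)"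
      using elim(3) by (simp add: mult.assoc)
    also have "\<dots> \<le> \<bar>C\<bar> * (\<epsilon> powr (\<bar>s\<bar> + l * q + 1) * (1 + norm (x \<epsilon>)) powr q)"
      by (intro mult_right_mono) auto
    also have "\<dots> \<le> \<bar>C\<bar> * (\<epsilon> powr (\<bar>s\<bar> + l * q + 1) * (\<epsilon> powr (-l)) powr q)"
      using elim(1) q by (intro mult_left_mono powr_mono2) auto
    also have "\<epsilon> powr (\<bar>s\<bar> + l * q + 1) * (\<epsilon> powr (-l)) powr q = \<epsilon> powr (\<bar>s\<bar> + 1)"
      by (simp add: powr_powr flip: powr_add)
    also have "\<bar>C\<bar> * \<epsilon> powr (\<bar>s\<bar> + 1) \<le> \<bar>C\<bar> * \<epsilon> powr s"
      using elim(2) by (intro mult_left_mono powr_mono') auto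
    finally show ?case .
  qed
  then show "\<exists>C. \<forall>\<^sub>F \<epsilon> in at_right 0. norm (r \<epsilon>) \<le> C * \<epsilon> powr s" by blast
qed

lemma N_tau_null:
  assumes u: "u \<in> N_tau" and vs: "vs \<in> lists Basis" and x: "moderate_pt x"
  shows "null_pt (\<lambda>\<epsilon>. pderivs vs (u \<epsilon>) (x \<epsilon>))"
proof -
  obtain q where q: "q > 0" and
    *: "\<And>s. s > 0 \<Longrightarrow> \<exists>C. \<forall>\<^sub>F \<epsilon> in at_right 0. \<forall>x. norm (pderivs vs (u \<epsilon>) x) \<le> C * \<epsilon> powr s * (1 + norm x) powr q"
    using u vs unfolding N_tau_def by blast
  show ?thesis
    by (rule null_pt_of_powr_bound[OF _ x q]) (use * in \<open>blast intro: eventually_mono\<close>)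
qed

lemma N_tau_loc_null:
  assumes u: "u \<in> N_tau_loc" and vs: "vs \<in> lists Basis" and x: "moderate_pt x"
    and \<eta>: "\<forall>\<^sub>F \<epsilon> in at_right 0. norm (\<eta> \<epsilon>) \<le> R"
  shows "null_pt (\<lambda>\<epsilon>. pderivs vs (u \<epsilon>) (\<eta> \<epsilon>, x \<epsilon>))"
proof -
  obtain q where q: "q > 0" and
    *: "\<And>s. s > 0 \<Longrightarrow> \<exists>C. \<forall>\<^sub>F \<epsilon> in at_right 0. \<forall>\<eta>\<in>cball 0 R. \<forall>x. norm (pderivs vs (u \<epsilon>) (\<eta>, x)) \<le> C * \<epsilon> powr s * (1 + norm x) powr q"
    using u vs compact_cball[of 0 R] unfolding N_tau_loc_def by blast
  show ?thesis
  proof (rule null_pt_of_powr_bound[OF _ x q])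
    fix s :: real assume "s > 0"
    from *[OF this] obtain C where "\<forall>\<^sub>F \<epsilon> in at_right 0. \<forall>\<eta>\<in>cball 0 R. \<forall>x. norm (pderivs vs (u \<epsilon>) (\<eta>, x)) \<le> C * \<epsilon> powr s * (1 + norm x) powr q" by blast
    with \<eta> have "\<forall>\<^sub>F \<epsilon> in at_right 0. norm (pderivs vs (u \<epsilon>) (\<eta> \<epsilon>, x \<epsilon>)) \<le> C * \<epsilon> powr s * (1 + norm (x \<epsilon>)) powr q"
      by eventually_elim simp
    then show "\<exists>C. \<forall>\<^sub>F \<epsilon> in at_right 0. norm (pderivs vs (u \<epsilon>) (\<eta> \<epsilon>, x \<epsilon>)) \<le> C * \<epsilon> powr s * (1 + norm (x \<epsilon>)) powr q" by blast
  qed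
qed

lemma N_M_null:
  assumes u: "u \<in> N_M" and x: "\<forall>\<^sub>F \<epsilon> in at_right 0. norm (x \<epsilon>) \<le> R"
  shows "null_pt (\<lambda>\<epsilon>. u \<epsilon> (x \<epsilon>))"
  unfolding null_pt_def
proof
  fix s :: real
  obtain C where "\<forall>\<^sub>F \<epsilon> in at_right 0. \<forall>x\<in>cball 0 R. norm (pderivs [] (u \<epsilon>) x) \<le> C * \<epsilon> powr s"
    using u compact_cball[of 0 R] unfolding N_M_def by blast
  with x have "\<forall>\<^sub>F \<epsilon> in at_right 0. norm (u \<epsilon> (x \<epsilon>)) \<le> C * \<epsilon> powr s"
    by eventually_elim simp
  then show "\<exists>C. \<forall>\<^sub>F \<epsilon> in at_right 0. norm (u \<epsilon> (x \<epsilon>)) \<le> C * \<epsilon> powr s" by blast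
qed

section \<open>Jets\<close>

text \<open>
  For the trivial filter a growth bound is vacuous and only smoothness remains; closure properties of
  smooth functions are inherited from those of tempered nets.
\<close>
lemma smooth_iff_tempered: "smooth f \<longleftrightarrow> tempered bot UNIV (\<lambda>\<epsilon> x. 2) (\<lambda>\<epsilon>. f)"
  by (auto simp: tempered_alt intro: zero_less_one bexI[of _ 1])

lemma admissible_bot: "admissible bot D w"
  by (simp add: admissible_def)

lemma smooth_compose: "smooth f \<Longrightarrow> smooth g \<Longrightarrow> smooth (\<lambda>x. f (g x))"
  unfolding smooth_iff_tempered by (rule tempered_compose[OF admissible_bot]) auto

lemma smooth_scaleR: "smooth f \<Longrightarrow> smooth g \<Longrightarrow> smooth (\<lambda>x. f x *\<^sub>R g x)"
  unfolding smooth_iff_tempered by (rule tempered_scaleR[OF admissible_bot])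

lemma smooth_linear: "smooth f \<Longrightarrow> bounded_linear L \<Longrightarrow> smooth (\<lambda>x. L (f x))"
  unfolding smooth_iff_tempered by (rule tempered_linear[OF admissible_bot])

lemma smooth_sum: "finite A \<Longrightarrow> (\<And>a. a \<in> A \<Longrightarrow> smooth (f a)) \<Longrightarrow> smooth (\<lambda>x. \<Sum>a\<in>A. f a x)"
  unfolding smooth_iff_tempered by (rule tempered_sum[OF admissible_bot])

lemma smooth_Pair: "smooth f \<Longrightarrow> smooth g \<Longrightarrow> smooth (\<lambda>x. (f x, g x))"
  unfolding smooth_iff_tempered by (rule tempered_Pair[OF admissible_bot])

lemma smooth_const: "smooth (\<lambda>x. c)"
  unfolding smooth_iff_tempered by (rule tempered_fixed[OF admissible_bot])

lemma smooth_ident: "smooth (\<lambda>x. x)"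
  unfolding smooth_iff_tempered by (rule tempered_ident[OF admissible_bot]) simp

lemma pderivs_linear:
  assumes "smooth f" "bounded_linear L" "vs \<in> lists Basis"
  shows "pderivs vs (\<lambda>x. L (f x)) = (\<lambda>x. L (pderivs vs f x))"
  using assms(3)
proof (induction vs rule: list.induct)
  case (Cons v vs)
  then have "pderivs [v] (pderivs vs (\<lambda>x. L (f x))) = pderivs [v] (\<lambda>x. L (pderivs vs f x))" by simp
  also have "\<dots> = (\<lambda>x. L (pderivs [v] (pderivs vs f) x))"
    by (rule pderiv_linear[OF smoothD[OF assms(1)] assms(2)]) (use Cons.prems in auto)
  finally show ?case by simp
qed simp

lemma pderivs_add:
  assumes "smooth f" "smooth g" "vs \<in> lists Basis"
  shows "pderivs vs (\<lambda>x. f x + g x) = (\<lambda>x. pderivs vs f x + pderivs vs g x)"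
  using assms(3)
proof (induction vs rule: list.induct)
  case (Cons v vs)
  then have "pderivs [v] (pderivs vs (\<lambda>x. f x + g x)) = pderivs [v] (\<lambda>x. pderivs vs f x + pderivs vs g x)" by simp
  also have "\<dots> = (\<lambda>x. pderivs [v] (pderivs vs f) x + pderivs [v] (pderivs vs g) x)"
    by (rule pderiv_add[OF smoothD[OF assms(1)] smoothD[OF assms(2)]]) (use Cons.prems in auto)
  finally show ?case by simp
qed simp

lemma pderivs_zero: "pderivs vs (\<lambda>x. 0) = (\<lambda>x. 0)"
  by (cases "vs = []") (simp_all add: pderivs_const)

lemma pderivs_sum:
  assumes "finite A" "\<And>a. a \<in> A \<Longrightarrow> smooth (f a)" and vs: "vs \<in> lists Basis"
  shows "pderivs vs (\<lambda>x. \<Sum>a\<in>A. f a x) = (\<lambda>x. \<Sum>a\<in>A. pderivs vs (f a) x)"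
  using assms(1,2)
proof (induction A rule: finite_induct)
  case (insert a A)
  then show ?case
    using pderivs_add[OF _ smooth_sum[of A f] vs, of "f a"] by simp
qed (simp add: pderivs_zero)

definition same_jet ::
  "nat \<Rightarrow> ('a::euclidean_space \<Rightarrow> 'b::euclidean_space) \<Rightarrow> ('a \<Rightarrow> 'b) \<Rightarrow> 'a \<Rightarrow> bool" where
  "same_jet n f g x \<longleftrightarrow> (\<forall>vs\<in>lists Basis. length vs \<le> n \<longrightarrow> pderivs vs f x = pderivs vs g x)"

lemma same_jet_0 [simp]: "same_jet 0 f g x \<longleftrightarrow> f x = g x"
  by (auto simp: same_jet_def)

lemma same_jet_Suc:
  fixes f g :: "'a::euclidean_space \<Rightarrow> 'b::euclidean_space"
  shows "same_jet (Suc n) f g x \<longleftrightarrow> f x = g x \<and> (\<forall>v\<in>Basis. same_jet n (pderivs [v] f) (pderivs [v] g) x)"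
proof safe
  assume L: "same_jet (Suc n) f g x"
  show "f x = g x" using bspec[OF L[unfolded same_jet_def], of "[]"] by simp
  fix v :: 'a assume v: "v \<in> Basis"
  show "same_jet n (pderivs [v] f) (pderivs [v] g) x"
    unfolding same_jet_def
  proof (intro ballI impI)
    fix vs :: "'a list" assume "vs \<in> lists Basis" "length vs \<le> n"
    then show "pderivs vs (pderivs [v] f) x = pderivs vs (pderivs [v] g) x"
      using bspec[OF L[unfolded same_jet_def], of "vs @ [v]"] v by (simp add: pderivs_append)
  qed
next
  assume 0: "f x = g x" and 1: "\<forall>v\<in>Basis. same_jet n (pderivs [v] f) (pderivs [v] g) x"
  show "same_jet (Suc n) f g x"
    unfolding same_jet_def
  proof (intro ballI impI)
    fix vs :: "'a list" assume vs: "vs \<in> lists Basis" "length vs \<le> Suc n"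
    show "pderivs vs f x = pderivs vs g x"
    proof (cases vs rule: rev_cases)
      case (snoc ws v)
      then have "same_jet n (pderivs [v] f) (pderivs [v] g) x" "ws \<in> lists Basis" "length ws \<le> n"
        using vs 1 by auto
      then have "pderivs ws (pderivs [v] f) x = pderivs ws (pderivs [v] g) x" unfolding same_jet_def by blast
      then show ?thesis using snoc by (simp add: pderivs_append)
    qed (use 0 in simp)
  qed
qed

lemma same_jet_refl: "same_jet n f f x"
  by (simp add: same_jet_def)

lemma same_jet_Suc_weaken: "same_jet (Suc n) f g x \<Longrightarrow> same_jet n f g x"
  by (simp add: same_jet_def)

lemma same_jet_sum:
  fixes f g :: "'i \<Rightarrow> 'a::euclidean_space \<Rightarrow> 'b::euclidean_space"
  assumes "finite A" "\<And>a. a \<in> A \<Longrightarrow> smooth (f a)" "\<And>a. a \<in> A \<Longrightarrow> smooth (g a)"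
    "\<And>a. a \<in> A \<Longrightarrow> same_jet n (f a) (g a) x"
  shows "same_jet n (\<lambda>x. \<Sum>a\<in>A. f a x) (\<lambda>x. \<Sum>a\<in>A. g a x) x"
  unfolding same_jet_def
proof (intro ballI impI)
  fix vs :: "'a list" assume vs: "vs \<in> lists Basis" "length vs \<le> n"
  show "pderivs vs (\<lambda>x. \<Sum>a\<in>A. f a x) x = pderivs vs (\<lambda>x. \<Sum>a\<in>A. g a x) x"
    using assms vs by (subst (1 2) pderivs_sum) (auto simp: same_jet_def intro!: sum.cong)
qed

lemma same_jet_linear:
  assumes "smooth f" "smooth g" "bounded_linear L" "same_jet n f g x"
  shows "same_jet n (\<lambda>x. L (f x)) (\<lambda>x. L (g x)) x"
  using assms unfolding same_jet_def by (simp add: pderivs_linear)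

lemma same_jet_add:
  assumes "smooth f" "smooth g" "smooth f'" "smooth g'" "same_jet n f f' x" "same_jet n g g' x"
  shows "same_jet n (\<lambda>x. f x + g x) (\<lambda>x. f' x + g' x) x"
  using assms unfolding same_jet_def by (simp add: pderivs_add)

lemma same_jet_scaleR:
  assumes "smooth f" "smooth g" "smooth f'" "smooth g'" "same_jet n f f' x" "same_jet n g g' x"
  shows "same_jet n (\<lambda>x. f x *\<^sub>R g x) (\<lambda>x. f' x *\<^sub>R g' x) x"
  using assms
proof (induction n arbitrary: f g f' g')
  case (Suc n)
  note sm = Suc.prems(1-4)
  have "same_jet n (pderivs [v] (\<lambda>x. f x *\<^sub>R g x)) (pderivs [v] (\<lambda>x. f' x *\<^sub>R g' x)) x" if v: "v \<in> Basis" for v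
  proof -
    note d = sm[THEN smooth_pderiv, OF v]
    have "same_jet n (\<lambda>x. f x *\<^sub>R pderivs [v] g x + pderivs [v] f x *\<^sub>R g x)
      (\<lambda>x. f' x *\<^sub>R pderivs [v] g' x + pderivs [v] f' x *\<^sub>R g' x) x"
      using Suc.prems v
      by (intro same_jet_add Suc.IH smooth_scaleR sm d) (auto simp: same_jet_Suc intro: same_jet_Suc_weaken)
    then show ?thesis
      using sm by (subst (1 2) pderiv_scaleR) (auto intro: smooth_differentiable)
  qed
  then show ?case using Suc.prems(5,6) by (simp add: same_jet_Suc)
qed simp

lemma same_jet_Pair:
  assumes "smooth f" "smooth g" "smooth f'" "smooth g'" "same_jet n f f' x" "same_jet n g g' x"
  shows "same_jet n (\<lambda>x. (f x, g x)) (\<lambda>x. (f' x, g' x)) x"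
proof -
  have L: "bounded_linear (\<lambda>y::'b. (y, 0::'c))" "bounded_linear (\<lambda>y::'c. (0::'b, y))"
    by (auto intro!: bounded_linear_Pair bounded_linear_ident bounded_linear_zero)
  have "same_jet n (\<lambda>x. (f x, 0) + (0, g x)) (\<lambda>x. (f' x, 0) + (0, g' x)) x"
    using assms by (intro same_jet_add same_jet_linear[OF _ _ L(1)] same_jet_linear[OF _ _ L(2)]
        smooth_linear[OF _ L(1)] smooth_linear[OF _ L(2)])
  then show ?thesis by simp
qed

text \<open>
  The first derivatives of the composites are, by the chain rule, sums of products of functions with
  the same \<open>n\<close>-jet.
\<close>
lemma same_jet_compose:
  fixes f :: "'b::euclidean_space \<Rightarrow> 'c::euclidean_space" and g :: "'a::euclidean_space \<Rightarrow> 'b"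
  assumes "smooth f" "smooth f'" "smooth g" "smooth g'" "same_jet n f f' (g x)" "same_jet n g g' x"
  shows "same_jet n (\<lambda>x. f (g x)) (\<lambda>x. f' (g' x)) x"
  using assms
proof (induction n arbitrary: f f')
  case 0
  then show ?case by simp
next
  case (Suc n)
  have g': "same_jet n g g' x" by (rule same_jet_Suc_weaken[OF Suc.prems(6)])
  note sm = Suc.prems(1-4)
  have "same_jet n (pderivs [v] (\<lambda>x. f (g x))) (pderivs [v] (\<lambda>x. f' (g' x))) x" if v: "v \<in> Basis" for v
  proof -
    note dg = sm(3,4)[THEN smooth_pderiv, OF v]
    have gb: "smooth (\<lambda>x. pderivs [v] g x \<bullet> b)" "smooth (\<lambda>x. pderivs [v] g' x \<bullet> b)"
      "same_jet n (\<lambda>x. pderivs [v] g x \<bullet> b) (\<lambda>x. pderivs [v] g' x \<bullet> b) x" for b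
      using Suc.prems(6) v
      by (auto intro!: smooth_linear[OF _ bounded_linear_inner_left] same_jet_linear[OF _ _ bounded_linear_inner_left]
          dg simp: same_jet_Suc simp del: pderivs.simps)
    have fb: "smooth (\<lambda>x. pderivs [b] f (g x))" "smooth (\<lambda>x. pderivs [b] f' (g' x))"
      "same_jet n (\<lambda>x. pderivs [b] f (g x)) (\<lambda>x. pderivs [b] f' (g' x)) x" if b: "b \<in> Basis" for b
    proof -
      note df = sm(1,2)[THEN smooth_pderiv, OF b]
      show "smooth (\<lambda>x. pderivs [b] f (g x))" "smooth (\<lambda>x. pderivs [b] f' (g' x))"
        by (rule smooth_compose[OF df(1) sm(3)], rule smooth_compose[OF df(2) sm(4)])
      have "same_jet n (pderivs [b] f) (pderivs [b] f') (g x)"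
        using Suc.prems(5) b unfolding same_jet_Suc by blast
      then show "same_jet n (\<lambda>x. pderivs [b] f (g x)) (\<lambda>x. pderivs [b] f' (g' x)) x"
        by (rule Suc.IH[OF df sm(3,4) _ g'])
    qed
    have "same_jet n (\<lambda>x. \<Sum>b\<in>Basis. (pderivs [v] g x \<bullet> b) *\<^sub>R pderivs [b] f (g x))
      (\<lambda>x. \<Sum>b\<in>Basis. (pderivs [v] g' x \<bullet> b) *\<^sub>R pderivs [b] f' (g' x)) x"
      by (rule same_jet_sum[OF finite_Basis]; (rule same_jet_scaleR smooth_scaleR)?; (rule gb fb)?; assumption?)
    then show ?thesis
      using Suc.prems by (subst (1 2) pderiv_compose) (auto intro: smooth_differentiable)
  qed
  moreover have "f (g x) = f' (g' x)"
    using Suc.prems(5,6) by (auto simp: same_jet_Suc)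
  ultimately show ?case by (simp add: same_jet_Suc del: pderivs.simps)
qed

section \<open>Multi-indices\<close>

lemma count_list_eq_count: "count_list js i = count (mset js) i"
  by (simp add: count_mset)

lemma exists_count_list:
  fixes \<alpha> :: "'p::finite \<Rightarrow> nat"
  shows "\<exists>js. \<forall>i. count_list js i = \<alpha> i"
proof -
  obtain js where "mset js = (\<Sum>i\<in>UNIV. replicate_mset (\<alpha> i) i)" using ex_mset by blast
  then have "count_list js i = \<alpha> i" for i
    by (simp add: count_list_eq_count count_sum)
  then show ?thesis by blast
qed

lemma axis_list_in_Basis: "map (\<lambda>i. axis i (1::real)) js \<in> lists Basis"
  by (auto simp: axis_in_Basis_iff)

lemma multi_deriv_eq_pderivs:
  fixes f :: "real ^ 'p::finite \<Rightarrow> 'b::euclidean_space"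
  assumes f: "smooth f" and js: "\<And>i. count_list js i = \<alpha> i"
  shows "multi_deriv \<alpha> f = pderivs (map (\<lambda>i. axis i 1) js) f"
proof -
  define ks where "ks = (SOME js. \<forall>i. count_list js i = \<alpha> i)"
  have "\<forall>i. count_list ks i = \<alpha> i" unfolding ks_def using exists_count_list[of \<alpha>] by (rule someI_ex)
  then have "mset ks = mset js" using js by (intro multiset_eqI) (simp flip: count_list_eq_count)
  then have "pderivs (map (\<lambda>i. axis i 1) ks) f = pderivs (map (\<lambda>i. axis i 1) js) f"
    by (intro pderivs_mset_cong f axis_list_in_Basis) simp
  then show ?thesis unfolding multi_deriv_def ks_def .
qed

lemma multi_deriv_conv_pderivs:
  obtains js where "\<And>i. count_list js i = \<alpha> i"
    "\<And>f. smooth f \<Longrightarrow> multi_deriv \<alpha> f = pderivs (map (\<lambda>i. axis i 1) js) f"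
  using exists_count_list[of \<alpha>] multi_deriv_eq_pderivs[of _ _ \<alpha>] by blast

lemma lists_Basis_axis:
  assumes "vs \<in> lists (Basis :: (real ^ 'p::finite) set)"
  obtains js where "vs = map (\<lambda>i. axis i 1) js"
proof -
  have eq: "(Basis :: (real ^ 'p) set) = (\<lambda>i. axis i 1) ` UNIV" by (auto simp: Basis_vec_def)
  have "vs \<in> map (\<lambda>i. axis i 1) ` lists UNIV" using assms unfolding eq lists_image .
  then show thesis using that by blast
qed

lemma length_eq_sum_count: "(\<Sum>i\<in>UNIV. count_list js (i::'p::finite)) = length js"
  by (rule sum_count_set) auto

text \<open>
  Every list of at most \<open>n\<close> coordinate directions has a multi-index enumerated by \<open>\<mu>\<close>, and the order
  of differentiation is immaterial.
\<close>
lemma same_jet_iff_pr: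
  fixes f g :: "real ^ 'p::finite \<Rightarrow> real ^ 'q::finite"
  assumes \<mu>: "enumerates_multi_indices \<mu> n" and f: "smooth f" and g: "smooth g"
  shows "same_jet n f g x \<longleftrightarrow> pr \<mu> f x = pr \<mu> g x"
proof
  assume j: "same_jet n f g x"
  have "multi_deriv (\<mu> k) f x = multi_deriv (\<mu> k) g x" for k
  proof -
    obtain js where js: "\<And>i. count_list js i = \<mu> k i"
      "\<And>f :: real ^ 'p \<Rightarrow> real ^ 'q. smooth f \<Longrightarrow> multi_deriv (\<mu> k) f = pderivs (map (\<lambda>i. axis i 1) js) f"
      by (rule multi_deriv_conv_pderivs[of "\<mu> k"]) blast
    have "\<mu> k \<in> {\<alpha>. (\<Sum>i\<in>UNIV. \<alpha> i) \<le> n}"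
      using \<mu> unfolding enumerates_multi_indices_def by (auto dest: bij_betwE)
    then have "length js \<le> n" using length_eq_sum_count[of js] js(1) by simp
    then show ?thesis using j js(2) f g axis_list_in_Basis[of js] unfolding same_jet_def by simp
  qed
  then show "pr \<mu> f x = pr \<mu> g x" by (simp add: pr_def)
next
  assume pr: "pr \<mu> f x = pr \<mu> g x"
  show "same_jet n f g x"
    unfolding same_jet_def
  proof (intro ballI impI)
    fix vs :: "(real ^ 'p) list" assume vs: "vs \<in> lists Basis" "length vs \<le> n"
    obtain js where js: "vs = map (\<lambda>i. axis i 1) js" by (rule lists_Basis_axis[OF vs(1)])
    have "count_list js \<in> {\<alpha>. (\<Sum>i\<in>UNIV. \<alpha> i) \<le> n}" using vs(2) js length_eq_sum_count[of js] by simp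
    then obtain k where k: "\<mu> k = count_list js"
      using \<mu> unfolding enumerates_multi_indices_def bij_betw_def by (metis imageE)
    have "multi_deriv (\<mu> k) f x = multi_deriv (\<mu> k) g x"
      using pr by (simp add: pr_def vec_eq_iff)
    then show "pderivs vs f x = pderivs vs g x"
      using multi_deriv_eq_pderivs[OF f, of js "\<mu> k"] multi_deriv_eq_pderivs[OF g, of js "\<mu> k"] k js by simp
  qed
qed

section \<open>Taylor polynomials\<close>

definition monomial :: "('p::finite \<Rightarrow> nat) \<Rightarrow> real ^ 'p \<Rightarrow> real ^ 'p \<Rightarrow> real" where
  "monomial \<alpha> a y = (\<Prod>i\<in>UNIV. (y $ i - a $ i) ^ \<alpha> i / fact (\<alpha> i))"

lemma taylor_eq_monomials: "taylor \<mu> z = (\<lambda>y. \<Sum>k\<in>UNIV. monomial (\<mu> k) (fst z) y *\<^sub>R (snd z $ k))"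
  by (auto simp: taylor_def monomial_def)

lemma monomial_center: "monomial \<alpha> a a = (if \<alpha> = (\<lambda>_. 0) then 1 else 0)"
proof (cases "\<alpha> = (\<lambda>_. 0)")
  case False
  then obtain i where "\<alpha> i \<noteq> 0" by auto
  then show ?thesis using False by (auto simp: monomial_def intro!: bexI[of _ i])
qed (simp add: monomial_def)

context
  fixes F :: "real filter" and D :: "'a::euclidean_space set" and w :: "real \<Rightarrow> 'a \<Rightarrow> real"
  assumes adm: "admissible F D w"
begin

lemma tempered_power: "tempered F D w f \<Longrightarrow> tempered F D w (\<lambda>\<epsilon> x. f \<epsilon> x ^ k :: real)"
proof (induction k)
  case (Suc k)
  then show ?case using tempered_scaleR[OF adm, of f "\<lambda>\<epsilon> x. f \<epsilon> x ^ k"] by simp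
qed (simp add: tempered_fixed[OF adm])

lemma tempered_prod:
  "finite A \<Longrightarrow> (\<And>a. a \<in> A \<Longrightarrow> tempered F D w (f a)) \<Longrightarrow> tempered F D w (\<lambda>\<epsilon> x. \<Prod>a\<in>A. f a \<epsilon> x :: real)"
proof (induction A rule: finite_induct)
  case (insert a A)
  then show ?case using tempered_scaleR[OF adm, of "f a" "\<lambda>\<epsilon> x. \<Prod>a\<in>A. f a \<epsilon> x"] by simp
qed (simp add: tempered_fixed[OF adm])

end

lemma tempered_tau_moderate:
  assumes z: "moderate_pt z" and F: "scale_filter F"
  shows "tempered F D tau_weight (\<lambda>\<epsilon> x. z \<epsilon>)"
proof (cases "F = at_right 0")
  case True
  obtain k where "\<forall>\<^sub>F \<epsilon> in at_right 0. norm (z \<epsilon>) \<le> (2 / \<epsilon>) ^ k" using z unfolding moderate_pt_iff_power by blast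
  with eventually_unit_interval have "\<forall>\<^sub>F \<epsilon> in at_right 0. \<forall>x\<in>D. norm (z \<epsilon>) \<le> tau_weight \<epsilon> x ^ k"
  proof eventually_elim
    case (elim \<epsilon>)
    show ?case
    proof
      fix x assume "x \<in> D"
      have "(2 / \<epsilon>) ^ k \<le> tau_weight \<epsilon> x ^ k"
        using elim(1) by (intro power_mono) (auto simp: tau_weight_def intro!: divide_right_mono)
      then show "norm (z \<epsilon>) \<le> tau_weight \<epsilon> x ^ k" using elim(2) by simp
    qed
  qed
  then show ?thesis using tempered_const[OF admissible_tau_weight[OF F]] True by simp
next
  case False
  then obtain \<epsilon> where "F = principal {\<epsilon>}" using F by (auto simp: scale_filter_def)
  then show ?thesis by (intro tempered_tau_bounded[OF F, of z "norm (z \<epsilon>)"]) (simp add: eventually_principal)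
qed

text \<open>
  The coefficients and the centre of a Taylor polynomial are values at a generalized point and vary
  with \<open>\<epsilon>\<close>, so these polynomials form moderate nets rather than a single function.
\<close>
lemma monomial_E_tau:
  fixes a :: "(real ^ 'p::finite) net"
  assumes "moderate_pt a"
  shows "(\<lambda>\<epsilon>. monomial \<alpha> (a \<epsilon>)) \<in> E_tau"
  unfolding E_tau_iff_tempered
proof (intro allI impI)
  fix F assume F: "scale_filter F"
  note adm = admissible_tau_weight[OF F]
  have "tempered F UNIV tau_weight (\<lambda>\<epsilon> y. y $ i - a \<epsilon> $ i)" for i
    using tempered_linear[OF adm tempered_tau_ident[OF F] bounded_linear_vec_nth[of i]]
      tempered_linear[OF adm tempered_tau_moderate[OF assms F] bounded_linear_vec_nth[of i]]
    by (rule tempered_diff[OF adm])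
  then have "tempered F UNIV tau_weight (\<lambda>\<epsilon> y. \<Prod>i\<in>UNIV. (y $ i - a \<epsilon> $ i) ^ \<alpha> i / fact (\<alpha> i))"
    by (intro tempered_prod[OF adm] tempered_linear[OF adm _ bounded_linear_divide] tempered_power[OF adm]) auto
  then show "tempered F UNIV tau_weight (\<lambda>\<epsilon>. monomial \<alpha> (a \<epsilon>))"
    by (simp add: monomial_def[abs_def])
qed

lemma smooth_monomial: "smooth (monomial \<alpha> a)"
  using E_tau_smooth[OF monomial_E_tau[of "\<lambda>_. a" \<alpha>], of 1] moderate_pt_bounded[of "\<lambda>_. a" "norm a"] by simp

lemma taylor_E_tau:
  fixes z :: "('p::finite, 'q::finite, 'k::finite) jets net"
  assumes z: "moderate_pt z"
  shows "(\<lambda>\<epsilon>. taylor \<mu> (z \<epsilon>)) \<in> E_tau"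
  unfolding E_tau_iff_tempered
proof (intro allI impI)
  fix F assume F: "scale_filter F"
  note adm = admissible_tau_weight[OF F]
  have "tempered F UNIV tau_weight (\<lambda>\<epsilon>. monomial (\<mu> k) (fst (z \<epsilon>)))" for k
    by (rule E_tau_tempered[OF monomial_E_tau[OF moderate_pt_linear[OF bounded_linear_fst z]] F])
  moreover have "tempered F UNIV tau_weight (\<lambda>\<epsilon> y. snd (z \<epsilon>) $ k)" for k
    by (rule tempered_tau_moderate[OF moderate_pt_linear[OF bounded_linear_vec_nth moderate_pt_linear[OF bounded_linear_snd z]] F])
  ultimately show "tempered F UNIV tau_weight (\<lambda>\<epsilon>. taylor \<mu> (z \<epsilon>))"
    unfolding taylor_eq_monomials by (intro tempered_sum[OF adm] tempered_scaleR[OF adm]) auto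
qed

lemma pderiv_eq_line:
  fixes f :: "'a::euclidean_space \<Rightarrow> 'b::euclidean_space"
  assumes "f differentiable (at x)" "((\<lambda>t. f (x + t *\<^sub>R v)) has_vector_derivative d) (at 0)"
  shows "pderivs [v] f x = d"
proof -
  have "((\<lambda>t. f (x + t *\<^sub>R v)) has_vector_derivative pderivs [v] f x) (at 0)"
    using directional_derivative[of f x 0 v] assms(1) by simp
  from vector_derivative_at[OF this] vector_derivative_at[OF assms(2)] show ?thesis by (rule trans[OF sym])
qed

lemma pderiv_monomial:
  "pderivs [axis j 1] (monomial \<alpha> a) = (if \<alpha> j = 0 then (\<lambda>_. 0) else monomial (\<alpha>(j := \<alpha> j - 1)) a)"
proof
  fix y
  let ?c = "\<Prod>i\<in>UNIV - {j}. (y $ i - a $ i) ^ \<alpha> i / fact (\<alpha> i)"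
  let ?d = "if \<alpha> j = 0 then 0 else (y $ j - a $ j) ^ (\<alpha> j - 1) / fact (\<alpha> j - 1)"
  have split: "monomial \<beta> a x = (x $ j - a $ j) ^ \<beta> j / fact (\<beta> j) * (\<Prod>i\<in>UNIV - {j}. (x $ i - a $ i) ^ \<beta> i / fact (\<beta> i))" for \<beta> x
    unfolding monomial_def by (rule prod.remove) auto
  have "monomial \<alpha> a (y + t *\<^sub>R axis j 1) = (t + (y $ j - a $ j)) ^ \<alpha> j / fact (\<alpha> j) * ?c" for t
    by (subst split) (auto simp: axis_def algebra_simps intro!: arg_cong2[of _ _ _ _ "(*)"] prod.cong)
  moreover have "((\<lambda>t. (t + (y $ j - a $ j)) ^ \<alpha> j / fact (\<alpha> j) * ?c) has_real_derivative ?d * ?c) (at 0)"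
    by (auto intro!: derivative_eq_intros simp: fact_reduce)
  ultimately have "pderivs [axis j 1] (monomial \<alpha> a) y = ?d * ?c"
    by (intro pderiv_eq_line smooth_differentiable smooth_monomial)
      (simp add: has_real_derivative_iff_has_vector_derivative)
  also have "\<dots> = (if \<alpha> j = 0 then (\<lambda>_. 0) else monomial (\<alpha>(j := \<alpha> j - 1)) a) y"
    by (auto simp: split intro!: prod.cong)
  finally show "pderivs [axis j 1] (monomial \<alpha> a) y = (if \<alpha> j = 0 then (\<lambda>_. 0) else monomial (\<alpha>(j := \<alpha> j - 1)) a) y" .
qed

lemma pderivs_monomial:
  "pderivs (map (\<lambda>i. axis i 1) js) (monomial \<alpha> a) =
    (if \<forall>i. count_list js i \<le> \<alpha> i then monomial (\<lambda>i. \<alpha> i - count_list js i) a else (\<lambda>_. 0))"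
proof (induction js)
  case (Cons j js)
  have "pderivs (map (\<lambda>i. axis i 1) (j # js)) (monomial \<alpha> a) =
    pderivs [axis j 1] (pderivs (map (\<lambda>i. axis i 1) js) (monomial \<alpha> a))" by simp
  also have "\<dots> = (if \<forall>i. count_list js i \<le> \<alpha> i then
      (if \<alpha> j - count_list js j = 0 then (\<lambda>_. 0)
       else monomial ((\<lambda>i. \<alpha> i - count_list js i)(j := \<alpha> j - count_list js j - 1)) a) else (\<lambda>_. 0))"
    unfolding Cons.IH by (simp only: pderiv_monomial pderivs_zero if_distrib[of "pderivs _"])
  also have "\<dots> = (if \<forall>i. count_list (j # js) i \<le> \<alpha> i then monomial (\<lambda>i. \<alpha> i - count_list (j # js) i) a else (\<lambda>_. 0))"
  proof (cases "\<forall>i. count_list (j # js) i \<le> \<alpha> i")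
    case True
    have "count_list js i \<le> \<alpha> i" for i
      using spec[OF True, of i] by (simp split: if_splits)
    then have "\<forall>i. count_list js i \<le> \<alpha> i" by blast
    moreover have "\<alpha> j - count_list js j \<noteq> 0" using spec[OF True, of j] by simp
    moreover have "(\<lambda>i. \<alpha> i - count_list js i)(j := \<alpha> j - count_list js j - 1) = (\<lambda>i. \<alpha> i - count_list (j # js) i)"
      by auto
    ultimately show ?thesis using True by simp
  next
    case False
    then obtain i where i: "\<not> count_list (j # js) i \<le> \<alpha> i" by blast
    show ?thesis
    proof (cases "\<forall>i. count_list js i \<le> \<alpha> i")
      case le: True
      then have "count_list js i \<le> \<alpha> i" by blast
      with i have "i = j" "\<alpha> j - count_list js j = 0" by (simp_all split: if_splits)
      then show ?thesis unfolding if_not_P[OF False] if_P[OF le] by simp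
    next
      case lt: False
      show ?thesis unfolding if_not_P[OF False] if_not_P[OF lt] ..
    qed
  qed
  finally show ?case .
qed simp

lemma pr_taylor:
  fixes z :: "('p::finite, 'q::finite, 'k::finite) jets"
  assumes \<mu>: "enumerates_multi_indices \<mu> n"
  shows "pr \<mu> (taylor \<mu> z) (fst z) = snd z"
proof -
  have "moderate_pt (\<lambda>_. z)" by (rule moderate_pt_bounded[of _ "norm z"]) simp
  from E_tau_smooth[OF taylor_E_tau[OF this], of 1] have sm: "smooth (taylor \<mu> z)" by simp
  have "multi_deriv (\<mu> l) (taylor \<mu> z) (fst z) = snd z $ l" for l
  proof -
    obtain js where js: "\<And>i. count_list js i = \<mu> l i"
      "multi_deriv (\<mu> l) (taylor \<mu> z) = pderivs (map (\<lambda>i. axis i 1) js) (taylor \<mu> z)"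
      using multi_deriv_conv_pderivs[of "\<mu> l"] sm by metis
    have js': "count_list js = \<mu> l" using js(1) by auto
    have "pderivs (map (\<lambda>i. axis i 1) js) (taylor \<mu> z) (fst z) =
      (\<Sum>k\<in>UNIV. pderivs (map (\<lambda>i. axis i 1) js) (monomial (\<mu> k) (fst z)) (fst z) *\<^sub>R (snd z $ k))"
      unfolding taylor_eq_monomials
      by (simp add: pderivs_sum smooth_linear[OF smooth_monomial bounded_linear_scaleR_left] axis_list_in_Basis
          pderivs_linear[OF smooth_monomial bounded_linear_scaleR_left])
    also have "\<dots> = (\<Sum>k\<in>UNIV. if k = l then snd z $ k else 0)"
    proof (rule sum.cong[OF refl])
      fix k
      have "pderivs (map (\<lambda>i. axis i 1) js) (monomial (\<mu> k) (fst z)) (fst z) = (if \<mu> k = \<mu> l then 1 else 0)"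
      proof (cases "\<forall>i. \<mu> l i \<le> \<mu> k i")
        case True
        have "(\<lambda>i. \<mu> k i - \<mu> l i) = (\<lambda>_. 0) \<longleftrightarrow> \<mu> k = \<mu> l"
          using True by (auto simp: fun_eq_iff intro: le_antisym)
        then show ?thesis using True by (simp add: pderivs_monomial js' monomial_center)
      next
        case False
        then show ?thesis by (auto simp: pderivs_monomial js')
      qed
      moreover have "\<mu> k = \<mu> l \<longleftrightarrow> k = l"
        using \<mu> unfolding enumerates_multi_indices_def bij_betw_def by (auto simp: inj_eq)
      ultimately show "pderivs (map (\<lambda>i. axis i 1) js) (monomial (\<mu> k) (fst z)) (fst z) *\<^sub>R (snd z $ k) =
        (if k = l then snd z $ k else 0)" by simp
    qed
    finally show ?thesis using js(2) by simp
  qed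
  then show ?thesis by (simp add: pr_def vec_eq_iff)
qed

lemma bounded_linear_axis: "bounded_linear (axis k :: 'b::euclidean_space \<Rightarrow> 'b ^ 'k::finite)"
  by (intro linear_conv_bounded_linear[THEN iffD1] linearI) (auto simp: vec_eq_iff axis_def)

lemma pr_E_tau:
  fixes V :: "(real ^ 'p::finite \<Rightarrow> real ^ 'q::finite) net" and \<mu> :: "'k::finite \<Rightarrow> 'p \<Rightarrow> nat"
  assumes V: "V \<in> E_tau"
  shows "(\<lambda>\<epsilon>. pr \<mu> (V \<epsilon>)) \<in> E_tau"
  unfolding E_tau_iff_tempered
proof (intro allI impI)
  fix F assume F: "scale_filter F"
  note adm = admissible_tau_weight[OF F]
  have t: "tempered F UNIV tau_weight (\<lambda>\<epsilon> x. multi_deriv (\<mu> k) (V \<epsilon>) x)" for k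
    using tempered_pderivs[OF E_tau_tempered[OF V F] axis_list_in_Basis] by (simp add: multi_deriv_def)
  have "tempered F UNIV tau_weight (\<lambda>\<epsilon> x. \<Sum>k\<in>UNIV. axis k (multi_deriv (\<mu> k) (V \<epsilon>) x))"
    by (intro tempered_sum[OF adm] tempered_linear[OF adm t bounded_linear_axis]) auto
  moreover have "(\<Sum>k\<in>UNIV. axis k (multi_deriv (\<mu> k) (V \<epsilon>) x)) = pr \<mu> (V \<epsilon>) x" for \<epsilon> x
    by (simp add: pr_def vec_eq_iff axis_def if_distrib cong: if_cong)
  ultimately show "tempered F UNIV tau_weight (\<lambda>\<epsilon>. pr \<mu> (V \<epsilon>))" by simp
qed

lemma jet_E_tau:
  assumes V: "V \<in> E_tau"
  shows "(\<lambda>\<epsilon> x. (x, pr \<mu> (V \<epsilon>) x)) \<in> E_tau"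
  unfolding E_tau_iff_tempered
  by (intro allI impI tempered_Pair[OF admissible_tau_weight] tempered_tau_ident E_tau_tempered[OF pr_E_tau[OF V]])

section \<open>Differential equations at generalized points\<close>

lemma E_M_E_tau_compose:
  assumes "u \<in> E_tau" "H \<in> E_M"
  shows "(\<lambda>\<epsilon> t. u \<epsilon> (H \<epsilon> t)) \<in> E_M"
  using assms(2) unfolding E_M_iff_tempered
  by (auto intro!: E_tau_compose[OF admissible_const_weight scale_filter_at_right assms(1)])

lemma E_tau_E_tau_compose:
  assumes "u \<in> E_tau" "g \<in> E_tau"
  shows "(\<lambda>\<epsilon> x. u \<epsilon> (g \<epsilon> x)) \<in> E_tau"
  using assms(2) unfolding E_tau_iff_tempered
  by (auto intro!: E_tau_compose[OF admissible_tau_weight _ assms(1)])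

lemma E_M_curve:
  fixes u :: "(real \<times> 'a::euclidean_space \<Rightarrow> 'b::euclidean_space) net"
  assumes u: "u \<in> E_tau_loc" and z: "moderate_pt z"
  shows "(\<lambda>\<epsilon> t. u \<epsilon> (t, z \<epsilon>)) \<in> E_M"
  unfolding E_M_iff_tempered
proof (intro allI impI)
  fix K :: "real set" assume K: "compact K"
  let ?w = "\<lambda>\<epsilon> x::real. 2 / \<epsilon>"
  have adm: "admissible (at_right 0) K ?w" by (simp add: admissible_const_weight)
  obtain R where R: "\<And>t. t \<in> K \<Longrightarrow> norm t \<le> R" using compact_imp_bounded[OF K] by (auto simp: bounded_iff)
  have "moderate_pt (\<lambda>_. R)" by (rule moderate_pt_bounded[of _ "norm R"]) simp
  then obtain k where "\<forall>\<^sub>F \<epsilon> in at_right 0. norm R \<le> (2 / \<epsilon>) ^ k" unfolding moderate_pt_iff_power by blast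
  then have "\<forall>\<^sub>F \<epsilon> in at_right 0. \<forall>t\<in>K. norm t \<le> (2 / \<epsilon>) ^ k"
    by (rule eventually_mono) (use R in force)
  then have t: "tempered (at_right 0) K ?w (\<lambda>\<epsilon> t. t)" by (rule tempered_ident[OF adm])
  obtain l where "\<forall>\<^sub>F \<epsilon> in at_right 0. norm (z \<epsilon>) \<le> (2 / \<epsilon>) ^ l" using z unfolding moderate_pt_iff_power by blast
  then have "tempered (at_right 0) K ?w (\<lambda>\<epsilon> t. z \<epsilon>)" by (intro tempered_const[OF adm, of _ l]) simp
  then show "tempered (at_right 0) K ?w (\<lambda>\<epsilon> t. u \<epsilon> (t, z \<epsilon>))"
    by (rule E_tau_loc_compose[OF adm scale_filter_at_right u t _ K]) simp
qed

lemma vector_derivative_eq_pderiv: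
  "smooth y \<Longrightarrow> vector_derivative y (at t) = pderivs [1] y t"
  using frechet_derivative_eq_vector_derivative[OF smooth_differentiable, of y t] by simp

lemma has_vector_derivative_first:
  assumes "G differentiable (at (t, x))"
  shows "((\<lambda>t. G (t, x)) has_vector_derivative pderivs [(1, 0)] G (t, x)) (at t)"
  using directional_derivative[of G "(0, x)" t "(1, 0)"] assms by simp

text \<open>
  The defect of the equation is a moderate net, so it is negligible if it is null at all bounded
  generalized times.
\<close>
lemma ode_solution_pointwise:
  assumes y: "y \<in> E_M" and \<zeta>: "\<zeta> \<in> E_tau"
    and eq: "\<And>t R. (\<And>\<epsilon>. norm (t \<epsilon>) \<le> R) \<Longrightarrow>
      null_pt (\<lambda>\<epsilon>. vector_derivative (y \<epsilon>) (at (t \<epsilon>)) - \<zeta> \<epsilon> (y \<epsilon> (t \<epsilon>)))"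
    and init: "null_pt (\<lambda>\<epsilon>. y \<epsilon> t0 - x0 \<epsilon>)"
  shows "ode_solution \<zeta> t0 x0 y"
proof -
  have "(\<lambda>\<epsilon> t. vector_derivative (y \<epsilon>) (at t) - \<zeta> \<epsilon> (y \<epsilon> t)) \<in> E_M"
    unfolding E_M_iff_tempered
  proof (intro allI impI)
    fix K :: "real set" assume K: "compact K"
    let ?w = "\<lambda>\<epsilon> x::real. 2 / \<epsilon>"
    have adm: "admissible (at_right 0) K ?w" by (simp add: admissible_const_weight)
    have "tempered (at_right 0) K ?w y" using y K by (simp add: E_M_iff_tempered)
    then have "tempered (at_right 0) K ?w (\<lambda>\<epsilon> t. pderivs [1] (y \<epsilon>) t)"
      by (rule tempered_pderivs) simp
    moreover have "tempered (at_right 0) K ?w (\<lambda>\<epsilon> t. \<zeta> \<epsilon> (y \<epsilon> t))"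
      using E_M_E_tau_compose[OF \<zeta> y] K by (simp add: E_M_iff_tempered)
    ultimately have "tempered (at_right 0) K ?w (\<lambda>\<epsilon> t. pderivs [1] (y \<epsilon>) t - \<zeta> \<epsilon> (y \<epsilon> t))"
      by (rule tempered_diff[OF adm])
    then show "tempered (at_right 0) K ?w (\<lambda>\<epsilon> t. vector_derivative (y \<epsilon>) (at t) - \<zeta> \<epsilon> (y \<epsilon> t))"
      by (rule tempered_cong[OF adm]) (simp add: vector_derivative_eq_pderiv[OF E_M_smooth[OF y]] del: pderivs.simps)
  qed
  then have "(\<lambda>\<epsilon> t. vector_derivative (y \<epsilon>) (at t) - \<zeta> \<epsilon> (y \<epsilon> t)) \<in> N_M"
  proof (rule N_M_pointwise)
    fix t :: "real net" and R assume "\<And>\<epsilon>. norm (t \<epsilon>) \<le> R"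
    then show "null_pt (\<lambda>\<epsilon>. vector_derivative (y \<epsilon>) (at (t \<epsilon>)) - \<zeta> \<epsilon> (y \<epsilon> (t \<epsilon>)))" by (rule eq)
  qed
  then show ?thesis
    unfolding ode_solution_def using y init by blast
qed

lemma null_pt_Pair: "null_pt r \<Longrightarrow> null_pt s \<Longrightarrow> null_pt (\<lambda>\<epsilon>. (r \<epsilon>, s \<epsilon>))"
proof -
  assume r: "null_pt r" and s: "null_pt s"
  have "bounded_linear (\<lambda>y. (y, 0))" "bounded_linear (\<lambda>y. (0, y))"
    by (auto intro!: bounded_linear_Pair bounded_linear_ident bounded_linear_zero)
  from null_pt_add[OF null_pt_linear[OF this(1) r] null_pt_linear[OF this(2) s]] show ?thesis by simp
qed

lemma null_pt_eq_on_unit_interval: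
  assumes "null_pt r" "\<And>\<epsilon>. \<epsilon> \<in> {0<..1} \<Longrightarrow> s \<epsilon> = r \<epsilon>"
  shows "null_pt s"
proof (rule null_pt_cong[OF assms(1)])
  show "\<forall>\<^sub>F \<epsilon> in at_right 0. norm (s \<epsilon>) \<le> norm (r \<epsilon>)"
    using eventually_unit_interval by eventually_elim (simp add: assms(2))
qed

lemma frechet_derivative_sum:
  fixes f :: "'a::euclidean_space \<Rightarrow> 'b::euclidean_space"
  assumes "f differentiable (at x)"
  shows "frechet_derivative f (at x) v = (\<Sum>b\<in>Basis. (v \<bullet> b) *\<^sub>R pderivs [b] f x)"
  using linear_frechet_derivative[OF assms]
  by (subst (1) euclidean_representation[symmetric, of v]) (simp add: linear_sum linear_scale)

lemma null_frechet_derivative: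
  fixes u :: "('a::euclidean_space \<Rightarrow> 'b::euclidean_space) net"
  assumes smooth: "\<And>\<epsilon>. \<epsilon> \<in> {0<..1} \<Longrightarrow> smooth (u \<epsilon>)"
    and "\<And>b. b \<in> Basis \<Longrightarrow> null_pt (\<lambda>\<epsilon>. (v \<epsilon> \<bullet> b) *\<^sub>R pderivs [b] (u \<epsilon>) (x \<epsilon>))"
  shows "null_pt (\<lambda>\<epsilon>. frechet_derivative (u \<epsilon>) (at (x \<epsilon>)) (v \<epsilon>))"
proof (rule null_pt_eq_on_unit_interval)
  show "null_pt (\<lambda>\<epsilon>. \<Sum>b\<in>Basis. (v \<epsilon> \<bullet> b) *\<^sub>R pderivs [b] (u \<epsilon>) (x \<epsilon>))"
    by (rule null_pt_sum[OF finite_Basis assms(2)])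
qed (rule frechet_derivative_sum[OF smooth_differentiable[OF smooth]])

lemma E_tau_null_direction:
  assumes u: "u \<in> E_tau" and x: "moderate_pt x" and v: "null_pt v"
  shows "null_pt (\<lambda>\<epsilon>. frechet_derivative (u \<epsilon>) (at (x \<epsilon>)) (v \<epsilon>))"
proof (rule null_frechet_derivative[OF E_tau_smooth[OF u]])
  fix b :: 'a assume b: "b \<in> Basis"
  have "moderate_pt (\<lambda>\<epsilon>. pderivs [b] (u \<epsilon>) (x \<epsilon>))"
    by (rule E_tau_moderate[OF E_tau_pderivs[OF u] x]) (simp add: b)
  then show "null_pt (\<lambda>\<epsilon>. (v \<epsilon> \<bullet> b) *\<^sub>R pderivs [b] (u \<epsilon>) (x \<epsilon>))"
    by (rule null_pt_scale[OF _ null_pt_linear[OF bounded_linear_inner_left[of b] v]]) (simp add: mult.commute)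
qed

lemma N_tau_smooth: "u \<in> N_tau \<Longrightarrow> \<epsilon> \<in> {0<..1} \<Longrightarrow> smooth (u \<epsilon>)"
  by (auto simp: N_tau_def O_M_def)

lemma N_tau_loc_smooth: "u \<in> N_tau_loc \<Longrightarrow> \<epsilon> \<in> {0<..1} \<Longrightarrow> smooth (u \<epsilon>)"
  by (auto simp: N_tau_loc_def O_M_loc_def)

lemma N_tau_moderate_direction:
  assumes u: "u \<in> N_tau" and x: "moderate_pt x" and v: "moderate_pt v"
  shows "null_pt (\<lambda>\<epsilon>. frechet_derivative (u \<epsilon>) (at (x \<epsilon>)) (v \<epsilon>))"
proof (rule null_frechet_derivative[OF N_tau_smooth[OF u]])
  fix b :: 'a assume b: "b \<in> Basis"
  have "null_pt (\<lambda>\<epsilon>. pderivs [b] (u \<epsilon>) (x \<epsilon>))"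
    by (rule N_tau_null[OF u _ x]) (simp add: b)
  then show "null_pt (\<lambda>\<epsilon>. (v \<epsilon> \<bullet> b) *\<^sub>R pderivs [b] (u \<epsilon>) (x \<epsilon>))"
    by (rule null_pt_scale[OF moderate_pt_linear[OF bounded_linear_inner_left[of b] v]]) simp
qed

section \<open>Orbits of generalized group actions\<close>

lemma generator_eq:
  "\<Phi> \<in> E_tau_loc \<Longrightarrow> \<epsilon> \<in> {0<..1} \<Longrightarrow> generator \<Phi> \<epsilon> x = pderivs [(1, 0)] (\<Phi> \<epsilon>) (0, x)"
  unfolding generator_def
  by (rule vector_derivative_at[OF has_vector_derivative_first[OF smooth_differentiable[OF E_tau_loc_smooth]]])

text \<open>
  Differentiating the group law \<open>\<Phi>(\<eta>\<^sub>1 + \<eta>\<^sub>2, x) = \<Phi>(\<eta>\<^sub>1, \<Phi>(\<eta>\<^sub>2, x))\<close> with respect to \<open>\<eta>\<^sub>1\<close> at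
  \<open>0\<close>: on the right the generator appears, by its definition.
\<close>
lemma orbit_velocity:
  assumes \<Phi>: "group_action \<Phi>" and x: "moderate_pt x" and t: "\<And>\<epsilon>. norm (t \<epsilon>) \<le> R"
  shows "null_pt (\<lambda>\<epsilon>. vector_derivative (\<lambda>t. \<Phi> \<epsilon> (t, x \<epsilon>)) (at (t \<epsilon>)) - generator \<Phi> \<epsilon> (\<Phi> \<epsilon> (t \<epsilon>, x \<epsilon>)))"
proof -
  define \<delta> where "\<delta> = (\<lambda>\<epsilon> ((\<eta>1, \<eta>2), x). \<Phi> \<epsilon> (\<eta>1 + \<eta>2, x) - \<Phi> \<epsilon> (\<eta>1, \<Phi> \<epsilon> (\<eta>2, x)))"
  have loc: "\<Phi> \<in> E_tau_loc" and \<delta>: "\<delta> \<in> N_tau_loc" using \<Phi> unfolding group_action_def \<delta>_def by blast+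
  have "((1, 0), 0) \<in> (Basis :: ((real \<times> real) \<times> 'a) set)" by (simp add: Basis_prod_def zero_prod_def)
  then have "null_pt (\<lambda>\<epsilon>. pderivs [((1, 0), 0)] (\<delta> \<epsilon>) ((0, t \<epsilon>), x \<epsilon>))"
    using t by (intro N_tau_loc_null[OF \<delta> _ x, of _ _ R]) (auto simp: norm_Pair)
  then show ?thesis
  proof (rule null_pt_eq_on_unit_interval)
    fix \<epsilon> :: real assume e: "\<epsilon> \<in> {0<..1}"
    let ?a = "t \<epsilon>" and ?x = "x \<epsilon>"
    have d: "\<Phi> \<epsilon> differentiable (at p)" for p by (rule smooth_differentiable[OF E_tau_loc_smooth[OF loc e]])
    have "((\<lambda>s. \<Phi> \<epsilon> (?a + s, ?x)) has_vector_derivative pderivs [(1, 0)] (\<Phi> \<epsilon>) (?a, ?x)) (at 0)"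
      using directional_derivative[of "\<Phi> \<epsilon>" "(?a, ?x)" 0 "(1, 0)"] d by simp
    from has_vector_derivative_diff[OF this has_vector_derivative_first[OF d[of "(0, \<Phi> \<epsilon> (?a, ?x))"]]]
    have "((\<lambda>s. \<delta> \<epsilon> (((0, ?a), ?x) + s *\<^sub>R ((1, 0), 0))) has_vector_derivative
      pderivs [(1, 0)] (\<Phi> \<epsilon>) (?a, ?x) - pderivs [(1, 0)] (\<Phi> \<epsilon>) (0, \<Phi> \<epsilon> (?a, ?x))) (at 0)"
      by (simp add: \<delta>_def add.commute del: pderivs.simps)
    then have "pderivs [((1, 0), 0)] (\<delta> \<epsilon>) ((0, ?a), ?x) =
      pderivs [(1, 0)] (\<Phi> \<epsilon>) (?a, ?x) - pderivs [(1, 0)] (\<Phi> \<epsilon>) (0, \<Phi> \<epsilon> (?a, ?x))"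
      by (intro pderiv_eq_line smooth_differentiable N_tau_loc_smooth[OF \<delta> e])
    then show "vector_derivative (\<lambda>t. \<Phi> \<epsilon> (t, ?x)) (at ?a) - generator \<Phi> \<epsilon> (\<Phi> \<epsilon> (?a, ?x)) =
      pderivs [((1, 0), 0)] (\<delta> \<epsilon>) ((0, ?a), ?x)"
      unfolding generator_eq[OF loc e] vector_derivative_at[OF has_vector_derivative_first[OF d]] by (rule sym)
  qed
qed

lemma orbit_solves_ode:
  assumes \<Phi>: "G_complete_action \<Phi>" and x: "moderate_pt x"
  shows "ode_solution (generator \<Phi>) 0 x (\<lambda>\<epsilon> t. \<Phi> \<epsilon> (t, x \<epsilon>))"
proof (rule ode_solution_pointwise)
  have \<Phi>': "group_action \<Phi>" and \<Phi>_loc: "\<Phi> \<in> E_tau_loc" and id: "(\<lambda>\<epsilon> x. \<Phi> \<epsilon> (0, x) - x) \<in> N_tau"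
    using \<Phi> unfolding G_complete_action_def group_action_def by blast+
  show "(\<lambda>\<epsilon> t. \<Phi> \<epsilon> (t, x \<epsilon>)) \<in> E_M" by (rule E_M_curve[OF \<Phi>_loc x])
  show "generator \<Phi> \<in> E_tau" using \<Phi> unfolding G_complete_action_def G_complete_field_def by blast
  show "null_pt (\<lambda>\<epsilon>. \<Phi> \<epsilon> (0, x \<epsilon>) - x \<epsilon>)" using N_tau_null[OF id _ x, of "[]"] by simp
  fix t :: "real net" and R assume "\<And>\<epsilon>. norm (t \<epsilon>) \<le> R"
  then show "null_pt (\<lambda>\<epsilon>. vector_derivative (\<lambda>t. \<Phi> \<epsilon> (t, x \<epsilon>)) (at (t \<epsilon>)) - generator \<Phi> \<epsilon> (\<Phi> \<epsilon> (t \<epsilon>, x \<epsilon>)))"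
    by (rule orbit_velocity[OF \<Phi>' x])
qed

lemma ode_solutions_agree:
  assumes \<zeta>: "G_complete_field \<zeta>" and z: "moderate_pt z"
    and x: "ode_solution \<zeta> t0 z x" and y: "ode_solution \<zeta> t0 z y"
    and \<eta>: "\<forall>\<^sub>F \<epsilon> in at_right 0. norm (\<eta> \<epsilon>) \<le> R"
  shows "null_pt (\<lambda>\<epsilon>. x \<epsilon> (\<eta> \<epsilon>) - y \<epsilon> (\<eta> \<epsilon>))"
proof -
  obtain s where "\<And>y. ode_solution \<zeta> t0 z y \<Longrightarrow> (\<lambda>\<epsilon> t. y \<epsilon> t - s \<epsilon> t) \<in> N_M"
    using \<zeta> z unfolding G_complete_field_def by blast
  then have "null_pt (\<lambda>\<epsilon>. x \<epsilon> (\<eta> \<epsilon>) - s \<epsilon> (\<eta> \<epsilon>))" "null_pt (\<lambda>\<epsilon>. y \<epsilon> (\<eta> \<epsilon>) - s \<epsilon> (\<eta> \<epsilon>))"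
    using x y N_M_null[OF _ \<eta>] by blast+
  from null_pt_trans[OF this(1) null_pt_commute[OF this(2)]] show ?thesis .
qed

section \<open>Graphs as zero sets\<close>

lemma bounded_linear_omit_coord: "bounded_linear (omit_coord e)"
  by (intro linear_conv_bounded_linear[THEN iffD1] linearI)
    (auto simp: omit_coord_def vec_eq_iff inner_add_left)

lemma bounded_linear_insert_coord:
  "bounded_linear (\<lambda>p. insert_coord e (b::'a::euclidean_space) (fst p) (snd p))"
  by (intro linear_conv_bounded_linear[THEN iffD1] linearI)
    (auto simp: insert_coord_def scaleR_add_left sum.distrib scaleR_sum_right algebra_simps)

lemma insert_coord_diff: "insert_coord e b x s - insert_coord e b y t = insert_coord e b (x - y) (s - t)"
  by (simp add: insert_coord_def scaleR_diff_left sum_subtractf)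

context
  fixes e :: "'r::finite \<Rightarrow> 'a::euclidean_space" and b :: 'a
  assumes b: "b \<in> Basis" and e: "bij_betw e UNIV (Basis - {b})"
begin

lemma coord_Basis: "e j \<in> Basis" "e j \<noteq> b"
  using bij_betwE[OF e] by auto

lemma coord_inj: "e i = e j \<longleftrightarrow> i = j"
  using e by (auto simp: bij_betw_def inj_eq)

lemma omit_insert_coord: "omit_coord e (insert_coord e b z' t) = z'"
  using coord_Basis b
  by (auto simp: omit_coord_def insert_coord_def vec_eq_iff inner_add_left inner_sum_left inner_Basis coord_inj
      if_distrib cong: if_cong)

lemma insert_coord_inner: "insert_coord e b z' t \<bullet> b = t"
  using coord_Basis b
  by (auto simp: insert_coord_def inner_add_left inner_sum_left inner_Basis)

lemma insert_omit_coord: "insert_coord e b (omit_coord e z) (z \<bullet> b) = z"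
proof -
  have "(\<Sum>j\<in>UNIV. (z \<bullet> e j) *\<^sub>R e j) = (\<Sum>v\<in>Basis - {b}. (z \<bullet> v) *\<^sub>R v)"
    by (rule sum.reindex_bij_betw[OF e])
  then have "insert_coord e b (omit_coord e z) (z \<bullet> b) = (\<Sum>v\<in>Basis. (z \<bullet> v) *\<^sub>R v)"
    using sum.remove[OF finite_Basis b, of "\<lambda>v. (z \<bullet> v) *\<^sub>R v"]
    by (simp add: insert_coord_def omit_coord_def add.commute)
  then show ?thesis by (simp add: euclidean_representation)
qed

text \<open>
  The field applied to \<open>\<Delta> = z\<^sub>b - f(z')\<close> is the \<open>b\<close>-component of the field minus the derivative of
  \<open>f\<close> along the remaining components, so its vanishing is tangency to the graph of \<open>f\<close>.
\<close>
lemma tangent_to_graph: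
  fixes \<Delta> :: "('a \<Rightarrow> real) net" and f :: "(real ^ 'r \<Rightarrow> real) net"
  assumes \<Delta>: "\<Delta> \<in> E_tau" and f: "f \<in> E_tau"
    and graph: "(\<lambda>\<epsilon> z. \<Delta> \<epsilon> z - (z \<bullet> b - f \<epsilon> (omit_coord e z))) \<in> N_tau"
    and \<zeta>: "\<zeta> \<in> E_tau" and y: "moderate_pt y"
    and X: "null_pt (\<lambda>\<epsilon>. apply_field \<zeta> \<Delta> \<epsilon> (y \<epsilon>))"
  shows "null_pt (\<lambda>\<epsilon>. \<zeta> \<epsilon> (y \<epsilon>) \<bullet> b -
    frechet_derivative (f \<epsilon>) (at (omit_coord e (y \<epsilon>))) (omit_coord e (\<zeta> \<epsilon> (y \<epsilon>))))"
proof -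
  define \<rho> where "\<rho> \<epsilon> z = \<Delta> \<epsilon> z - (z \<bullet> b - f \<epsilon> (omit_coord e z))" for \<epsilon> z
  have \<rho>: "\<rho> \<in> N_tau" using graph by (simp add: \<rho>_def[abs_def])
  have "null_pt (\<lambda>\<epsilon>. apply_field \<zeta> \<Delta> \<epsilon> (y \<epsilon>) - frechet_derivative (\<rho> \<epsilon>) (at (y \<epsilon>)) (\<zeta> \<epsilon> (y \<epsilon>)))"
    by (rule null_pt_diff[OF X N_tau_moderate_direction[OF \<rho> y E_tau_moderate[OF \<zeta> y]]])
  then show ?thesis
  proof (rule null_pt_eq_on_unit_interval)
    fix \<epsilon> :: real assume \<epsilon>: "\<epsilon> \<in> {0<..1}"
    let ?y = "y \<epsilon>" and ?v = "\<zeta> \<epsilon> (y \<epsilon>)"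
    have d\<Delta>: "\<Delta> \<epsilon> differentiable (at ?y)" and df: "f \<epsilon> differentiable (at (omit_coord e ?y))"
      using E_tau_smooth[OF \<Delta> \<epsilon>] E_tau_smooth[OF f \<epsilon>] by (auto intro: smooth_differentiable)
    have b': "((\<lambda>z. z \<bullet> b) has_derivative (\<lambda>v. v \<bullet> b)) (at ?y)"
      by (rule bounded_linear_imp_has_derivative[OF bounded_linear_inner_left])
    have f': "((\<lambda>z. f \<epsilon> (omit_coord e z)) has_derivative
      (\<lambda>v. frechet_derivative (f \<epsilon>) (at (omit_coord e ?y)) (omit_coord e v))) (at ?y)"
      by (rule has_derivative_compose[OF bounded_linear_imp_has_derivative[OF bounded_linear_omit_coord]
            differentiable_has_derivative[OF df]])
    have "frechet_derivative (\<rho> \<epsilon>) (at ?y) = (\<lambda>v. frechet_derivative (\<Delta> \<epsilon>) (at ?y) v -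
      (v \<bullet> b - frechet_derivative (f \<epsilon>) (at (omit_coord e ?y)) (omit_coord e v)))"
      unfolding \<rho>_def
      by (rule frechet_derivative_at[OF has_derivative_diff[OF differentiable_has_derivative[OF d\<Delta>]
            has_derivative_diff[OF b' f']], symmetric])
    moreover have "apply_field \<zeta> \<Delta> \<epsilon> ?y = frechet_derivative (\<Delta> \<epsilon>) (at ?y) ?v"
      unfolding apply_field_def by (subst frechet_derivative_sum[OF d\<Delta>, of ?v]) simp
    ultimately show "?v \<bullet> b - frechet_derivative (f \<epsilon>) (at (omit_coord e ?y)) (omit_coord e ?v) =
      apply_field \<zeta> \<Delta> \<epsilon> ?y - frechet_derivative (\<rho> \<epsilon>) (at ?y) ?v"
      by simp
  qed
qed

text \<open>
  The flow of the restricted field, lifted to the graph of \<open>f\<close>. Its velocity is the field in the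
  coordinates other than \<open>b\<close> since \<open>h\<close> is a flow, and in the coordinate \<open>b\<close> since the field is
  tangent to the graph. All of this holds up to null terms, and these are preserved because the
  derivative of \<open>f\<close> along the curve is moderate.
\<close>
lemma lifted_flow_solves_ode:
  fixes \<Delta> :: "('a \<Rightarrow> real) net" and f :: "(real ^ 'r \<Rightarrow> real) net"
  assumes \<Delta>: "\<Delta> \<in> E_tau" and f: "f \<in> E_tau"
    and graph: "(\<lambda>\<epsilon> z. \<Delta> \<epsilon> z - (z \<bullet> b - f \<epsilon> (omit_coord e z))) \<in> N_tau"
    and \<zeta>: "\<zeta> \<in> E_tau" and h: "is_flow (restrict_field e b f \<zeta>) h"
    and X: "\<And>z. moderate_pt z \<Longrightarrow> null_pt (\<lambda>\<epsilon>. \<Delta> \<epsilon> (z \<epsilon>)) \<Longrightarrow>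
           null_pt (\<lambda>\<epsilon>. apply_field \<zeta> \<Delta> \<epsilon> (z \<epsilon>))"
    and z: "moderate_pt z" and \<Delta>z: "null_pt (\<lambda>\<epsilon>. \<Delta> \<epsilon> (z \<epsilon>))"
  defines "H \<equiv> \<lambda>\<epsilon> t. h \<epsilon> (t, omit_coord e (z \<epsilon>))"
  defines "y \<equiv> \<lambda>\<epsilon> t. insert_coord e b (H \<epsilon> t) (f \<epsilon> (H \<epsilon> t))"
  shows "ode_solution \<zeta> 0 z y"
    and "\<forall>\<^sub>F \<epsilon> in at_right 0. norm (\<eta> \<epsilon>) \<le> R \<Longrightarrow> null_pt (\<lambda>\<epsilon>. \<Delta> \<epsilon> (y \<epsilon> (\<eta> \<epsilon>)))"
proof -
  have h_loc: "h \<in> E_tau_loc"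
    and h_ode: "(\<lambda>\<epsilon> (\<eta>, a). vector_derivative (\<lambda>t. h \<epsilon> (t, a)) (at \<eta>) - restrict_field e b f \<zeta> \<epsilon> (h \<epsilon> (\<eta>, a))) \<in> N_tau_loc"
    and h_init: "(\<lambda>\<epsilon> a. h \<epsilon> (0, a) - a) \<in> N_tau"
    using h unfolding is_flow_def by blast+
  have z': "moderate_pt (\<lambda>\<epsilon>. omit_coord e (z \<epsilon>))" by (rule moderate_pt_linear[OF bounded_linear_omit_coord z])
  have H: "H \<in> E_M" unfolding H_def by (rule E_M_curve[OF h_loc z'])
  have fH: "(\<lambda>\<epsilon> t. f \<epsilon> (H \<epsilon> t)) \<in> E_M" by (rule E_M_E_tau_compose[OF f H])
  have y: "y \<in> E_M"
    unfolding E_M_iff_tempered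
  proof (intro allI impI)
    fix K :: "real set" assume K: "compact K"
    have adm: "admissible (at_right 0) K (\<lambda>\<epsilon> x. 2 / \<epsilon>)" by (simp add: admissible_const_weight)
    have "tempered (at_right 0) K (\<lambda>\<epsilon> x. 2 / \<epsilon>) (\<lambda>\<epsilon> t. (H \<epsilon> t, f \<epsilon> (H \<epsilon> t)))"
      using H fH K by (intro tempered_Pair[OF adm]) (auto simp: E_M_iff_tempered)
    from tempered_linear[OF adm this bounded_linear_insert_coord[of e b]]
    show "tempered (at_right 0) K (\<lambda>\<epsilon> x. 2 / \<epsilon>) y" by (simp add: y_def)
  qed
  have omit_y: "omit_coord e (y \<epsilon> t) = H \<epsilon> t" and y_b: "y \<epsilon> t \<bullet> b = f \<epsilon> (H \<epsilon> t)" for \<epsilon> t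
    by (simp_all add: y_def omit_insert_coord insert_coord_inner)
  have on_graph: "null_pt (\<lambda>\<epsilon>. \<Delta> \<epsilon> (x \<epsilon>) - (x \<epsilon> \<bullet> b - f \<epsilon> (omit_coord e (x \<epsilon>))))" if "moderate_pt x" for x
    using N_tau_null[OF graph _ that, of "[]"] by simp
  have y_mod: "moderate_pt (\<lambda>\<epsilon>. y \<epsilon> (\<eta> \<epsilon>))" if "\<forall>\<^sub>F \<epsilon> in at_right 0. norm (\<eta> \<epsilon>) \<le> R" for \<eta> R
    using E_M_moderate[OF y _ that, of "[]"] by simp
  show \<Delta>y: "null_pt (\<lambda>\<epsilon>. \<Delta> \<epsilon> (y \<epsilon> (\<eta> \<epsilon>)))" if "\<forall>\<^sub>F \<epsilon> in at_right 0. norm (\<eta> \<epsilon>) \<le> R" for \<eta> R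
    using on_graph[OF y_mod[OF that]] by (simp add: omit_y y_b)
  show "ode_solution \<zeta> 0 z y"
  proof (rule ode_solution_pointwise[OF y \<zeta>])
    have h0: "null_pt (\<lambda>\<epsilon>. H \<epsilon> 0 - omit_coord e (z \<epsilon>))"
      using N_tau_null[OF h_init _ z', of "[]"] by (simp add: H_def)
    have "null_pt (\<lambda>\<epsilon>. \<Delta> \<epsilon> (z \<epsilon>) - (\<Delta> \<epsilon> (z \<epsilon>) - (z \<epsilon> \<bullet> b - f \<epsilon> (omit_coord e (z \<epsilon>)))))"
      by (rule null_pt_diff[OF \<Delta>z on_graph[OF z]])
    then have "null_pt (\<lambda>\<epsilon>. z \<epsilon> \<bullet> b - f \<epsilon> (omit_coord e (z \<epsilon>)))" by simp
    then have "null_pt (\<lambda>\<epsilon>. f \<epsilon> (omit_coord e (z \<epsilon>)) - z \<epsilon> \<bullet> b)"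
      by (rule null_pt_commute)
    moreover have "null_pt (\<lambda>\<epsilon>. f \<epsilon> (H \<epsilon> 0) - f \<epsilon> (omit_coord e (z \<epsilon>)))"
      by (rule null_pt_commute[OF E_tau_null_diff[OF f z' null_pt_commute[OF h0]]])
    ultimately have "null_pt (\<lambda>\<epsilon>. f \<epsilon> (H \<epsilon> 0) - z \<epsilon> \<bullet> b)" by (rule null_pt_trans[rotated])
    from null_pt_linear[OF bounded_linear_insert_coord[of e b] null_pt_Pair[OF h0 this]]
    have "null_pt (\<lambda>\<epsilon>. y \<epsilon> 0 - insert_coord e b (omit_coord e (z \<epsilon>)) (z \<epsilon> \<bullet> b))"
      by (simp add: y_def insert_coord_diff)
    then show "null_pt (\<lambda>\<epsilon>. y \<epsilon> 0 - z \<epsilon>)" by (simp add: insert_omit_coord)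
  next
    fix t :: "real net" and R assume t: "\<And>\<epsilon>. norm (t \<epsilon>) \<le> R"
    then have t': "\<forall>\<^sub>F \<epsilon> in at_right 0. norm (t \<epsilon>) \<le> R" by simp
    let ?Y = "\<lambda>\<epsilon>. y \<epsilon> (t \<epsilon>)" and ?H = "\<lambda>\<epsilon>. H \<epsilon> (t \<epsilon>)"
    let ?V = "\<lambda>\<epsilon>. vector_derivative (H \<epsilon>) (at (t \<epsilon>))"
    let ?Df = "\<lambda>\<epsilon>. frechet_derivative (f \<epsilon>) (at (?H \<epsilon>))"
    note Y = y_mod[OF t']
    have H_mod: "moderate_pt ?H" using moderate_pt_linear[OF bounded_linear_omit_coord[of e] Y] by (simp add: omit_y)
    have V: "null_pt (\<lambda>\<epsilon>. ?V \<epsilon> - omit_coord e (\<zeta> \<epsilon> (?Y \<epsilon>)))"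
      using N_tau_loc_null[OF h_ode _ z' t', of "[]"] by (simp add: restrict_field_def y_def H_def)
    \<comment> \<open>The infinitesimal criterion applies at \<open>y\<close>, since \<open>y\<close> runs in the graph.\<close>
    have normal: "null_pt (\<lambda>\<epsilon>. \<zeta> \<epsilon> (?Y \<epsilon>) \<bullet> b - ?Df \<epsilon> (omit_coord e (\<zeta> \<epsilon> (?Y \<epsilon>))))"
      using tangent_to_graph[OF \<Delta> f graph \<zeta> Y X[OF Y \<Delta>y[OF t']]] by (simp add: omit_y)
    have "null_pt (\<lambda>\<epsilon>. ?Df \<epsilon> (?V \<epsilon> - omit_coord e (\<zeta> \<epsilon> (?Y \<epsilon>))) -
      (\<zeta> \<epsilon> (?Y \<epsilon>) \<bullet> b - ?Df \<epsilon> (omit_coord e (\<zeta> \<epsilon> (?Y \<epsilon>)))))"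
      by (rule null_pt_diff[OF E_tau_null_direction[OF f H_mod V] normal])
    from null_pt_linear[OF bounded_linear_insert_coord[of e b] null_pt_Pair[OF V this]]
    show "null_pt (\<lambda>\<epsilon>. vector_derivative (y \<epsilon>) (at (t \<epsilon>)) - \<zeta> \<epsilon> (?Y \<epsilon>))"
    proof (rule null_pt_eq_on_unit_interval)
      fix \<epsilon> :: real assume \<epsilon>: "\<epsilon> \<in> {0<..1}"
      have df: "f \<epsilon> differentiable (at (?H \<epsilon>))" by (rule smooth_differentiable[OF E_tau_smooth[OF f \<epsilon>]])
      have HV: "(H \<epsilon> has_vector_derivative ?V \<epsilon>) (at (t \<epsilon>))"
        using smooth_differentiable[OF E_M_smooth[OF H \<epsilon>]] by (simp add: vector_derivative_works)
      have lin: "linear (?Df \<epsilon>)" by (rule linear_frechet_derivative[OF df])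
      have "((\<lambda>s. f \<epsilon> (H \<epsilon> s)) has_vector_derivative ?Df \<epsilon> (?V \<epsilon>)) (at (t \<epsilon>))"
        using has_derivative_compose[OF HV[unfolded has_vector_derivative_def] differentiable_has_derivative[OF df]]
        by (simp add: has_vector_derivative_def linear_scale[OF lin])
      from bounded_linear.has_vector_derivative[OF bounded_linear_insert_coord[of e b] has_vector_derivative_Pair[OF HV this]]
      have "(y \<epsilon> has_vector_derivative insert_coord e b (?V \<epsilon>) (?Df \<epsilon> (?V \<epsilon>))) (at (t \<epsilon>))"
        by (simp add: y_def[abs_def])
      then have "vector_derivative (y \<epsilon>) (at (t \<epsilon>)) - \<zeta> \<epsilon> (?Y \<epsilon>) = insert_coord e b (?V \<epsilon>) (?Df \<epsilon> (?V \<epsilon>)) -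
        insert_coord e b (omit_coord e (\<zeta> \<epsilon> (?Y \<epsilon>))) (\<zeta> \<epsilon> (?Y \<epsilon>) \<bullet> b)"
        by (simp add: vector_derivative_at insert_omit_coord)
      then show "vector_derivative (y \<epsilon>) (at (t \<epsilon>)) - \<zeta> \<epsilon> (?Y \<epsilon>) =
        insert_coord e b (fst (?V \<epsilon> - omit_coord e (\<zeta> \<epsilon> (?Y \<epsilon>)), ?Df \<epsilon> (?V \<epsilon> - omit_coord e (\<zeta> \<epsilon> (?Y \<epsilon>))) -
          (\<zeta> \<epsilon> (?Y \<epsilon>) \<bullet> b - ?Df \<epsilon> (omit_coord e (\<zeta> \<epsilon> (?Y \<epsilon>))))))
         (snd (?V \<epsilon> - omit_coord e (\<zeta> \<epsilon> (?Y \<epsilon>)), ?Df \<epsilon> (?V \<epsilon> - omit_coord e (\<zeta> \<epsilon> (?Y \<epsilon>))) -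
          (\<zeta> \<epsilon> (?Y \<epsilon>) \<bullet> b - ?Df \<epsilon> (omit_coord e (\<zeta> \<epsilon> (?Y \<epsilon>))))))"
        by (simp add: insert_coord_diff linear_diff[OF lin])
    qed
  qed
qed

text \<open>
  The orbit and the lifted flow solve the same initial value problem, so by uniqueness they are equal
  as generalized functions. The lifted flow runs in the graph, on which \<open>\<Delta>\<close> vanishes.
\<close>
lemma zero_set_invariant:
  fixes \<Delta> :: "('a \<Rightarrow> real) net" and f :: "(real ^ 'r \<Rightarrow> real) net" and \<Phi> :: "(real \<times> 'a \<Rightarrow> 'a) net"
  assumes \<Phi>: "G_complete_action \<Phi>" and \<Delta>: "\<Delta> \<in> E_tau" and f: "f \<in> E_tau"
    and graph: "(\<lambda>\<epsilon> z. \<Delta> \<epsilon> z - (z \<bullet> b - f \<epsilon> (omit_coord e z))) \<in> N_tau"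
    and h: "is_flow (restrict_field e b f (generator \<Phi>)) h"
    and X: "\<And>z. moderate_pt z \<Longrightarrow> null_pt (\<lambda>\<epsilon>. \<Delta> \<epsilon> (z \<epsilon>)) \<Longrightarrow>
           null_pt (\<lambda>\<epsilon>. apply_field (generator \<Phi>) \<Delta> \<epsilon> (z \<epsilon>))"
    and z: "moderate_pt z" and \<Delta>z: "null_pt (\<lambda>\<epsilon>. \<Delta> \<epsilon> (z \<epsilon>))"
    and \<eta>: "\<forall>\<^sub>F \<epsilon> in at_right 0. norm (\<eta> \<epsilon>) \<le> R"
  shows "null_pt (\<lambda>\<epsilon>. \<Delta> \<epsilon> (\<Phi> \<epsilon> (\<eta> \<epsilon>, z \<epsilon>)))"
proof -
  have \<zeta>: "G_complete_field (generator \<Phi>)" "generator \<Phi> \<in> E_tau" and \<Phi>_loc: "\<Phi> \<in> E_tau_loc"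
    using \<Phi> unfolding G_complete_action_def G_complete_field_def group_action_def by blast+
  define H where "H = (\<lambda>\<epsilon> t. h \<epsilon> (t, omit_coord e (z \<epsilon>)))"
  define y where "y = (\<lambda>\<epsilon> t. insert_coord e b (H \<epsilon> t) (f \<epsilon> (H \<epsilon> t)))"
  have "ode_solution (generator \<Phi>) 0 z y" unfolding y_def H_def
    by (rule lifted_flow_solves_ode(1)[OF \<Delta> f graph \<zeta>(2) h _ z \<Delta>z]) (rule X)
  from ode_solutions_agree[OF \<zeta>(1) z orbit_solves_ode[OF \<Phi> z] this \<eta>]
  have close: "null_pt (\<lambda>\<epsilon>. \<Phi> \<epsilon> (\<eta> \<epsilon>, z \<epsilon>) - y \<epsilon> (\<eta> \<epsilon>))" .
  have "null_pt (\<lambda>\<epsilon>. \<Delta> \<epsilon> (y \<epsilon> (\<eta> \<epsilon>)))" unfolding y_def H_def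
    by (rule lifted_flow_solves_ode(2)[OF \<Delta> f graph \<zeta>(2) h _ z \<Delta>z \<eta>]) (rule X)
  with close show ?thesis
    by (rule E_tau_null_value[OF \<Delta> E_tau_loc_moderate[OF \<Phi>_loc z \<eta>]])
qed

end

section \<open>Prolongation and solutions\<close>

lemma act_on_same_jet:
  assumes \<Xi>: "\<Xi> \<in> E_tau_loc" and \<Psi>: "\<Psi> \<in> E_tau_loc" and \<epsilon>: "\<epsilon> \<in> {0<..1}"
    and U: "smooth (U \<epsilon>)" and T: "smooth (T \<epsilon>)" and jet: "same_jet n (U \<epsilon>) (T \<epsilon>) (\<Xi> \<epsilon> (- \<eta> \<epsilon>, x))"
  shows "same_jet n (act_on \<Xi> \<Psi> \<eta> U \<epsilon>) (act_on \<Xi> \<Psi> \<eta> T \<epsilon>) x"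
proof -
  let ?A = "\<lambda>y. \<Xi> \<epsilon> (- \<eta> \<epsilon>, y)"
  have A: "smooth ?A"
    by (rule smooth_compose[OF E_tau_loc_smooth[OF \<Xi> \<epsilon>] smooth_Pair[OF smooth_const smooth_ident]])
  have UA: "smooth (\<lambda>y. U \<epsilon> (?A y))" and TA: "smooth (\<lambda>y. T \<epsilon> (?A y))"
    by (rule smooth_compose[OF U A], rule smooth_compose[OF T A])
  have "same_jet n (\<lambda>y. U \<epsilon> (?A y)) (\<lambda>y. T \<epsilon> (?A y)) x"
    by (rule same_jet_compose[OF U T A A jet same_jet_refl])
  from same_jet_Pair[OF A UA A TA same_jet_refl this]
  have "same_jet n (\<lambda>y. (?A y, U \<epsilon> (?A y))) (\<lambda>y. (?A y, T \<epsilon> (?A y))) x" .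
  note smooth_Pair[OF A UA] smooth_Pair[OF A TA]
  from same_jet_Pair[OF smooth_const this(1) smooth_const this(2) same_jet_refl
      \<open>same_jet n (\<lambda>y. (?A y, U \<epsilon> (?A y))) (\<lambda>y. (?A y, T \<epsilon> (?A y))) x\<close>]
  have "same_jet n (\<lambda>y. (\<eta> \<epsilon>, ?A y, U \<epsilon> (?A y))) (\<lambda>y. (\<eta> \<epsilon>, ?A y, T \<epsilon> (?A y))) x" .
  from same_jet_compose[OF E_tau_loc_smooth[OF \<Psi> \<epsilon>] E_tau_loc_smooth[OF \<Psi> \<epsilon>]
      smooth_Pair[OF smooth_const smooth_Pair[OF A UA]] smooth_Pair[OF smooth_const smooth_Pair[OF A TA]]
      same_jet_refl this]
  show ?thesis unfolding act_on_def .
qed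

lemma group_action_inverse:
  assumes \<Phi>: "group_action \<Phi>" and x: "moderate_pt x" and \<eta>: "\<forall>\<^sub>F \<epsilon> in at_right 0. norm (\<eta> \<epsilon>) \<le> R"
  shows "null_pt (\<lambda>\<epsilon>. x \<epsilon> - \<Phi> \<epsilon> (\<eta> \<epsilon>, \<Phi> \<epsilon> (- \<eta> \<epsilon>, x \<epsilon>)))"
proof -
  have id: "(\<lambda>\<epsilon> x. \<Phi> \<epsilon> (0, x) - x) \<in> N_tau"
    and law: "(\<lambda>\<epsilon> ((\<eta>1, \<eta>2), x). \<Phi> \<epsilon> (\<eta>1 + \<eta>2, x) - \<Phi> \<epsilon> (\<eta>1, \<Phi> \<epsilon> (\<eta>2, x))) \<in> N_tau_loc"
    using \<Phi> unfolding group_action_def by blast+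
  have "\<forall>\<^sub>F \<epsilon> in at_right 0. norm (\<eta> \<epsilon>, - \<eta> \<epsilon>) \<le> R + R"
    using \<eta>
  proof eventually_elim
    case (elim \<epsilon>)
    with norm_Pair_le[of "\<eta> \<epsilon>" "- \<eta> \<epsilon>"] show ?case by simp
  qed
  from N_tau_loc_null[OF law _ x this, of "[]"]
  have "null_pt (\<lambda>\<epsilon>. \<Phi> \<epsilon> (0, x \<epsilon>) - \<Phi> \<epsilon> (\<eta> \<epsilon>, \<Phi> \<epsilon> (- \<eta> \<epsilon>, x \<epsilon>)))" by simp
  moreover have "null_pt (\<lambda>\<epsilon>. x \<epsilon> - \<Phi> \<epsilon> (0, x \<epsilon>))"
    by (rule null_pt_commute) (use N_tau_null[OF id _ x, of "[]"] in simp)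
  ultimately show ?thesis by (rule null_pt_trans[rotated])
qed

text \<open>
  At a jet of \<open>U\<close> the prolonged action is computed with the Taylor polynomial \<open>T\<close> of \<open>U\<close> at \<open>x\<close>.
  Replacing \<open>T\<close> by \<open>U\<close> does not change the jet of the transformed function at \<open>X\<close>. What remains is
  the passage from \<open>X\<close> to the point \<open>X' = \<Xi>\<^sub>\<eta>(\<Xi>\<^sub>-\<^sub>\<eta>(X))\<close> at which the prolonged action evaluates; on
  representatives these points differ by a null net.
\<close>
lemma prolong_jet:
  fixes \<mu> :: "'k::finite \<Rightarrow> 'p::finite \<Rightarrow> nat" and U :: "(real ^ 'p \<Rightarrow> real ^ 'q::finite) net"
  assumes \<mu>: "enumerates_multi_indices \<mu> n" and \<Xi>: "\<Xi> \<in> E_tau_loc" and \<Psi>: "\<Psi> \<in> E_tau_loc"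
    and P: "group_action (prolong \<mu> \<Xi> \<Psi> :: (real \<times> ('p, 'q, 'k) jets \<Rightarrow> ('p, 'q, 'k) jets) net)"
    and U: "U \<in> E_tau" and \<eta>: "\<forall>\<^sub>F \<epsilon> in at_right 0. \<bar>\<eta> \<epsilon>\<bar> \<le> R" and X: "moderate_pt X"
  defines "x \<equiv> \<lambda>\<epsilon>. \<Xi> \<epsilon> (- \<eta> \<epsilon>, X \<epsilon>)"
  shows "null_pt (\<lambda>\<epsilon>. (X \<epsilon>, pr \<mu> (act_on \<Xi> \<Psi> \<eta> U \<epsilon>) (X \<epsilon>)) - prolong \<mu> \<Xi> \<Psi> \<epsilon> (\<eta> \<epsilon>, x \<epsilon>, pr \<mu> (U \<epsilon>) (x \<epsilon>)))"
proof -
  define T where "T = (\<lambda>\<epsilon>. taylor \<mu> (x \<epsilon>, pr \<mu> (U \<epsilon>) (x \<epsilon>)))"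
  define W where "W = act_on \<Xi> \<Psi> \<eta> T"
  define X' where "X' = (\<lambda>\<epsilon>. \<Xi> \<epsilon> (\<eta> \<epsilon>, x \<epsilon>))"
  have prolong: "prolong \<mu> \<Xi> \<Psi> \<epsilon> (\<eta> \<epsilon>, x \<epsilon>, pr \<mu> (U \<epsilon>) (x \<epsilon>)) = (X' \<epsilon>, pr \<mu> (W \<epsilon>) (X' \<epsilon>))" for \<epsilon>
    by (simp add: prolong_def X'_def W_def T_def act_on_def)
  have "\<forall>\<^sub>F \<epsilon> in at_right 0. norm (- \<eta> \<epsilon>) \<le> R" using \<eta> by simp
  then have x: "moderate_pt x" unfolding x_def by (rule E_tau_loc_moderate[OF \<Xi> X])
  have "T \<in> E_tau" unfolding T_def
    by (rule taylor_E_tau[OF E_tau_moderate[OF jet_E_tau[OF U] x]])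
  then have W: "W \<in> E_tau" unfolding W_def by (rule act_on_E_tau[OF \<Xi> \<Psi> _ \<eta>])
  \<comment> \<open>The prolonged action covers \<open>\<Xi>\<close>, so its group law, at an arbitrary jet over \<open>X\<close>, gives that of \<open>\<Xi>\<close>.\<close>
  have "moderate_pt (\<lambda>\<epsilon>. 0 :: real ^ 'q ^ 'k)" by (rule moderate_pt_bounded[of _ 0]) simp
  from group_action_inverse[OF P moderate_pt_Pair[OF X this]] \<eta>
  have "null_pt (\<lambda>\<epsilon>. (X \<epsilon>, 0) - prolong \<mu> \<Xi> \<Psi> \<epsilon> (\<eta> \<epsilon>, prolong \<mu> \<Xi> \<Psi> \<epsilon> (- \<eta> \<epsilon>, X \<epsilon>, 0 :: real ^ 'q ^ 'k)))" by simp
  from null_pt_linear[OF bounded_linear_fst this] have XX': "null_pt (\<lambda>\<epsilon>. X \<epsilon> - X' \<epsilon>)"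
    by (simp add: prolong_def X'_def x_def)
  have "null_pt (\<lambda>\<epsilon>. (X \<epsilon> - X' \<epsilon>, pr \<mu> (W \<epsilon>) (X \<epsilon>) - pr \<mu> (W \<epsilon>) (X' \<epsilon>)))"
    by (rule null_pt_Pair[OF XX' E_tau_null_diff[OF pr_E_tau[OF W] X XX']])
  then show ?thesis
  proof (rule null_pt_eq_on_unit_interval)
    fix \<epsilon> :: real assume \<epsilon>: "\<epsilon> \<in> {0<..1}"
    have sm: "smooth (U \<epsilon>)" "smooth (T \<epsilon>)" "smooth (act_on \<Xi> \<Psi> \<eta> U \<epsilon>)" "smooth (W \<epsilon>)"
      using E_tau_smooth[OF _ \<epsilon>] U \<open>T \<in> E_tau\<close> W act_on_E_tau[OF \<Xi> \<Psi> U \<eta>] by blast+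
    have "pr \<mu> (U \<epsilon>) (x \<epsilon>) = pr \<mu> (T \<epsilon>) (x \<epsilon>)"
      using pr_taylor[OF \<mu>, of "(x \<epsilon>, pr \<mu> (U \<epsilon>) (x \<epsilon>))"] by (simp add: T_def)
    then have "same_jet n (U \<epsilon>) (T \<epsilon>) (x \<epsilon>)" by (simp add: same_jet_iff_pr[OF \<mu> sm(1,2)])
    then have "same_jet n (act_on \<Xi> \<Psi> \<eta> U \<epsilon>) (W \<epsilon>) (X \<epsilon>)"
      unfolding W_def x_def by (rule act_on_same_jet[where U = U and T = T, OF \<Xi> \<Psi> \<epsilon> sm(1,2)])
    then have "pr \<mu> (act_on \<Xi> \<Psi> \<eta> U \<epsilon>) (X \<epsilon>) = pr \<mu> (W \<epsilon>) (X \<epsilon>)"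
      by (simp add: same_jet_iff_pr[OF \<mu> sm(3,4)])
    then show "(X \<epsilon>, pr \<mu> (act_on \<Xi> \<Psi> \<eta> U \<epsilon>) (X \<epsilon>)) - prolong \<mu> \<Xi> \<Psi> \<epsilon> (\<eta> \<epsilon>, x \<epsilon>, pr \<mu> (U \<epsilon>) (x \<epsilon>)) =
      (X \<epsilon> - X' \<epsilon>, pr \<mu> (W \<epsilon>) (X \<epsilon>) - pr \<mu> (W \<epsilon>) (X' \<epsilon>))"
      by (simp add: prolong)
  qed
qed

theorem theorem4p16:
  fixes n :: nat
    and \<mu> :: "'k::finite \<Rightarrow> 'p::finite \<Rightarrow> nat"
    and \<Delta> :: "(('p, 'q::finite, 'k) jets \<Rightarrow> real) net"
    and \<Phi> :: "(real \<times> (real ^ 'p) \<times> (real ^ 'q) \<Rightarrow> (real ^ 'p) \<times> (real ^ 'q)) net"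
    and \<Xi> :: "(real \<times> (real ^ 'p) \<Rightarrow> real ^ 'p) net"
    and \<Psi> :: "(real \<times> (real ^ 'p) \<times> (real ^ 'q) \<Rightarrow> real ^ 'q) net"
    and \<zeta> :: "(('p, 'q, 'k) jets \<Rightarrow> ('p, 'q, 'k) jets) net"
    and b :: "('p, 'q, 'k) jets"
    and e :: "'r::finite \<Rightarrow> ('p, 'q, 'k) jets"
    and f :: "(real ^ 'r \<Rightarrow> real) net"
  assumes "enumerates_multi_indices \<mu> n"
    and "\<Delta> \<in> E_tau"
    and "projectable \<Phi> \<Xi> \<Psi>"
    and "G_n_complete \<mu> \<Phi> \<Xi> \<Psi>"
    and "\<zeta> = generator (prolong \<mu> \<Xi> \<Psi>)"
    and "b \<in> Basis"
    and "bij_betw e UNIV (Basis - {b})"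
    and "f \<in> E_tau"
    and "(\<lambda>\<epsilon> z. \<Delta> \<epsilon> z - (z \<bullet> b - f \<epsilon> (omit_coord e z))) \<in> N_tau"
    and "restrict_field e b f \<zeta> \<in> E_tau"
    and "\<exists>h. is_flow (restrict_field e b f \<zeta>) h"
    and "\<And>z. moderate_pt z \<Longrightarrow> null_pt (\<lambda>\<epsilon>. \<Delta> \<epsilon> (z \<epsilon>)) \<Longrightarrow>
           null_pt (\<lambda>\<epsilon>. apply_field \<zeta> \<Delta> \<epsilon> (z \<epsilon>))"
  shows "is_symmetry_group \<mu> \<Delta> \<Xi> \<Psi>"
  unfolding is_symmetry_group_def
proof (intro allI impI ballI)
  fix U \<eta> assume sol: "is_solution \<mu> \<Delta> U" and "\<eta> \<in> R_c"
  then obtain R where \<eta>: "\<forall>\<^sub>F \<epsilon> in at_right 0. \<bar>\<eta> \<epsilon>\<bar> \<le> R" using R_c_bounded by blast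
  then have \<eta>': "\<forall>\<^sub>F \<epsilon> in at_right 0. norm (\<eta> \<epsilon>) \<le> R" "\<forall>\<^sub>F \<epsilon> in at_right 0. norm (- \<eta> \<epsilon>) \<le> R" by simp_all
  let ?P = "prolong \<mu> \<Xi> \<Psi>" and ?V = "act_on \<Xi> \<Psi> \<eta> U"
  have U: "U \<in> E_tau" and U0: "(\<lambda>\<epsilon> x. \<Delta> \<epsilon> (x, pr \<mu> (U \<epsilon>) x)) \<in> N_tau" using sol unfolding is_solution_def by auto
  have \<Xi>: "\<Xi> \<in> E_tau_loc" and \<Psi>: "\<Psi> \<in> E_tau_loc" using assms(3) unfolding projectable_def by auto
  have P: "G_complete_action ?P" using assms(4) unfolding G_n_complete_def by auto
  then have P': "group_action ?P" unfolding G_complete_action_def by blast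
  obtain h where h: "is_flow (restrict_field e b f (generator ?P)) h" using assms(5,11) by blast
  have V: "?V \<in> E_tau" by (rule act_on_E_tau[OF \<Xi> \<Psi> U \<eta>])
  have "(\<lambda>\<epsilon> x. \<Delta> \<epsilon> (x, pr \<mu> (?V \<epsilon>) x)) \<in> N_tau"
  proof (rule N_tau_pointwise[OF E_tau_E_tau_compose[OF assms(2) jet_E_tau[OF V]]])
    fix X :: "(real ^ 'p) net" assume X: "moderate_pt X"
    define x where "x = (\<lambda>\<epsilon>. \<Xi> \<epsilon> (- \<eta> \<epsilon>, X \<epsilon>))"
    have x: "moderate_pt x" unfolding x_def by (rule E_tau_loc_moderate[OF \<Xi> X \<eta>'(2)])
    have z: "moderate_pt (\<lambda>\<epsilon>. (x \<epsilon>, pr \<mu> (U \<epsilon>) (x \<epsilon>)))" by (rule E_tau_moderate[OF jet_E_tau[OF U] x])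
    have \<Delta>z: "null_pt (\<lambda>\<epsilon>. \<Delta> \<epsilon> (x \<epsilon>, pr \<mu> (U \<epsilon>) (x \<epsilon>)))" using N_tau_null[OF U0 _ x, of "[]"] by simp
    have "null_pt (\<lambda>\<epsilon>. \<Delta> \<epsilon> (?P \<epsilon> (\<eta> \<epsilon>, x \<epsilon>, pr \<mu> (U \<epsilon>) (x \<epsilon>))))"
      by (rule zero_set_invariant[OF assms(6,7) P assms(2,8,9) h _ z \<Delta>z \<eta>'(1)])
        (rule assms(12)[unfolded assms(5)])
    moreover have "null_pt (\<lambda>\<epsilon>. (X \<epsilon>, pr \<mu> (?V \<epsilon>) (X \<epsilon>)) - ?P \<epsilon> (\<eta> \<epsilon>, x \<epsilon>, pr \<mu> (U \<epsilon>) (x \<epsilon>)))"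
      unfolding x_def by (rule prolong_jet[OF assms(1) \<Xi> \<Psi> P' U \<eta> X])
    ultimately show "null_pt (\<lambda>\<epsilon>. \<Delta> \<epsilon> (X \<epsilon>, pr \<mu> (?V \<epsilon>) (X \<epsilon>)))"
      by (intro E_tau_null_value[OF assms(2) E_tau_moderate[OF jet_E_tau[OF V] X]])
  qed
  then show "is_solution \<mu> \<Delta> ?V" unfolding is_solution_def using V by blast
qed

end
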